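(* Let $(M,g,f)$ be a compact gradient Ricci soliton of dimension $n\ge 3$, i.e. $(M,g)$ is a compact Riemannian $n$-manifold, $f\in C^\infty(M)$, and $$\mathrm{Ric}_g+\mathrm{Hess}_g f=\lambda g$$ for a constant $\lambda\in\mathbb R$. Then $\lambda=\frac{\bar s_g}{n}$, and $g$ is a harmonic critical metric.
   Context: Notation: $\mathrm{Ric}_g$ is the Ricci tensor, $s_g$ the scalar curvature, $E_g=\mathrm{Ric}_g-\frac12 s_g g$ the Einstein tensor, $\bar s_g=\frac{1}{\mathrm{Vol}(M,g)}\int_M s_g\,dv_g$ the average scalar curvature. For a 1-form $\theta$: $\delta\theta=-\nabla^i\theta_i$, $(\delta^*\theta)_{ij}=\frac12(\nabla_i\theta_j+\nabla_j\theta_i)$, and $B_g^*\theta=\delta^*\theta+\frac12(\delta\theta)g$. $\mathrm{Hess}_g f=\nabla df$. A Riemannian metric $g$ on a compact $n$-manifold is called harmonic critical if there exists a smooth 1-form $\theta$ such that $$E_g=B_g^*\theta-\frac{n-2}{2n}\,\bar s_g\,g .$$ *)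

theory Defs
  imports "HOL-Analysis.Analysis"
begin

section \<open>Smooth maps on open subsets of Euclidean space\<close>

definition partial :: "'n::finite \<Rightarrow> (real^'n \<Rightarrow> 'b::real_normed_vector) \<Rightarrow> real^'n \<Rightarrow> 'b" where
  "partial i f x = frechet_derivative f (at x) (axis i 1)"

primrec Ck_on :: "nat \<Rightarrow> (real^'n::finite) set \<Rightarrow> (real^'n \<Rightarrow> 'b::real_normed_vector) \<Rightarrow> bool" where
  "Ck_on 0 S f \<longleftrightarrow> continuous_on S f"
| "Ck_on (Suc k) S f \<longleftrightarrow> (\<forall>x\<in>S. f differentiable (at x)) \<and> (\<forall>i. Ck_on k S (partial i f))"

definition smooth_on :: "(real^'n::finite) set \<Rightarrow> (real^'n \<Rightarrow> 'b::real_normed_vector) \<Rightarrow> bool" where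
  "smooth_on S f \<longleftrightarrow> (\<forall>k. Ck_on k S f)"


section \<open>Smooth manifolds\<close>

text \<open>A chart is a pair of its domain and its coordinate map; the coordinate map is only
  relevant on the domain.  The dimension of the manifold is \<open>CARD('n)\<close>.\<close>

type_synonym ('a, 'n) chart = "'a set \<times> ('a \<Rightarrow> real^'n)"

abbreviation chart_dom :: "('a, 'n::finite) chart \<Rightarrow> 'a set" where
  "chart_dom c \<equiv> fst c"

abbreviation chart_map :: "('a, 'n::finite) chart \<Rightarrow> 'a \<Rightarrow> real^'n" where
  "chart_map c \<equiv> snd c"

definition chart_img :: "('a, 'n::finite) chart \<Rightarrow> (real^'n) set" where
  "chart_img c = chart_map c ` chart_dom c"

definition chart_inv :: "('a, 'n::finite) chart \<Rightarrow> real^'n \<Rightarrow> 'a" where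
  "chart_inv c = inv_into (chart_dom c) (chart_map c)"

definition is_chart :: "'a topology \<Rightarrow> ('a, 'n::finite) chart \<Rightarrow> bool" where
  "is_chart X c \<longleftrightarrow>
     openin X (chart_dom c) \<and> open (chart_img c) \<and>
     homeomorphic_map (subtopology X (chart_dom c)) (top_of_set (chart_img c)) (chart_map c)"

definition transition :: "('a, 'n::finite) chart \<Rightarrow> ('a, 'n) chart \<Rightarrow> real^'n \<Rightarrow> real^'n" where
  "transition c d = chart_map d \<circ> chart_inv c"

definition smooth_manifold :: "'a topology \<Rightarrow> ('a, 'n::finite) chart set \<Rightarrow> bool" where
  "smooth_manifold X A \<longleftrightarrow>
     topspace X \<noteq> {} \<and> Hausdorff_space X \<and> second_countable X \<and>
     (\<forall>c\<in>A. is_chart X c) \<and> \<Union> (chart_dom ` A) = topspace X \<and>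
     (\<forall>c\<in>A. \<forall>d\<in>A. smooth_on (chart_map c ` (chart_dom c \<inter> chart_dom d)) (transition c d))"

definition smooth_function :: "('a, 'n::finite) chart set \<Rightarrow> ('a \<Rightarrow> real) \<Rightarrow> bool" where
  "smooth_function A f \<longleftrightarrow> (\<forall>c\<in>A. smooth_on (chart_img c) (f \<circ> chart_inv c))"

text \<open>Tensor fields are given by their components in each chart, as functions of the local
  coordinates, subject to the tensorial transformation law
  \<open>\<theta>\<^sub>i = (\<partial>y\<^sup>a/\<partial>x\<^sup>i) \<theta>\<^sub>a\<close> and \<open>T\<^sub>i\<^sub>j = (\<partial>y\<^sup>a/\<partial>x\<^sup>i) (\<partial>y\<^sup>b/\<partial>x\<^sup>j) T\<^sub>a\<^sub>b\<close>.  Accordingly, an equation between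
  tensor fields is the equation between their components in every chart of the atlas.\<close>

definition smooth_one_form ::
  "('a, 'n::finite) chart set \<Rightarrow> (('a, 'n) chart \<Rightarrow> real^'n \<Rightarrow> real^'n) \<Rightarrow> bool" where
  "smooth_one_form A \<theta> \<longleftrightarrow>
     (\<forall>c\<in>A. smooth_on (chart_img c) (\<theta> c)) \<and>
     (\<forall>c\<in>A. \<forall>d\<in>A. \<forall>p \<in> chart_dom c \<inter> chart_dom d.
        let J = jacobian (transition c d) (at (chart_map c p))
        in \<theta> c (chart_map c p) = transpose J *v \<theta> d (chart_map d p))"

definition smooth_two_tensor ::
  "('a, 'n::finite) chart set \<Rightarrow> (('a, 'n) chart \<Rightarrow> real^'n \<Rightarrow> real^'n^'n) \<Rightarrow> bool" where
  "smooth_two_tensor A T \<longleftrightarrow>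
     (\<forall>c\<in>A. smooth_on (chart_img c) (T c)) \<and>
     (\<forall>c\<in>A. \<forall>d\<in>A. \<forall>p \<in> chart_dom c \<inter> chart_dom d.
        let J = jacobian (transition c d) (at (chart_map c p))
        in T c (chart_map c p) = transpose J ** T d (chart_map d p) ** J)"

definition riemannian_metric ::
  "('a, 'n::finite) chart set \<Rightarrow> (('a, 'n) chart \<Rightarrow> real^'n \<Rightarrow> real^'n^'n) \<Rightarrow> bool" where
  "riemannian_metric A g \<longleftrightarrow>
     smooth_two_tensor A g \<and>
     (\<forall>c\<in>A. \<forall>x\<in>chart_img c.
        transpose (g c x) = g c x \<and> (\<forall>v. v \<noteq> 0 \<longrightarrow> v \<bullet> (g c x *v v) > 0))"

definition compact_riemannian_manifold ::
  "'a topology \<Rightarrow> ('a, 'n::finite) chart set \<Rightarrow> (('a, 'n) chart \<Rightarrow> real^'n \<Rightarrow> real^'n^'n) \<Rightarrow> bool" where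
  "compact_riemannian_manifold X A g \<longleftrightarrow>
     smooth_manifold X A \<and> compact_space X \<and> riemannian_metric A g"


section \<open>Riemannian geometry in local coordinates\<close>

text \<open>In this section \<open>G\<close> is the matrix of components of the metric in a chart, as a function of
  the coordinates.\<close>

definition trace_wrt :: "(real^'n \<Rightarrow> real^'n^'n) \<Rightarrow> real^'n \<Rightarrow> real^'n^'n \<Rightarrow> real" where
  "trace_wrt G x T = (\<Sum>i\<in>UNIV. \<Sum>j\<in>UNIV. matrix_inv (G x) $ i $ j * T $ i $ j)"

text \<open>\<open>christoffel G k i j\<close> is \<open>\<Gamma>\<^sup>k\<^sub>i\<^sub>j\<close>, where \<open>\<nabla>\<^sub>i \<partial>\<^sub>j = \<Gamma>\<^sup>k\<^sub>i\<^sub>j \<partial>\<^sub>k\<close>.\<close>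

definition christoffel ::
  "(real^'n \<Rightarrow> real^'n^'n) \<Rightarrow> 'n::finite \<Rightarrow> 'n \<Rightarrow> 'n \<Rightarrow> real^'n \<Rightarrow> real" where
  "christoffel G k i j x =
     (\<Sum>l\<in>UNIV. 1/2 * matrix_inv (G x) $ k $ l *
        (partial i (\<lambda>y. G y $ j $ l) x + partial j (\<lambda>y. G y $ i $ l) x
          - partial l (\<lambda>y. G y $ i $ j) x))"

text \<open>\<open>riemann G l i j k\<close> is the \<open>l\<close>-th component of \<open>R(\<partial>\<^sub>i, \<partial>\<^sub>j) \<partial>\<^sub>k\<close>, where
  \<open>R(u, v) = \<nabla>\<^sub>u \<nabla>\<^sub>v - \<nabla>\<^sub>v \<nabla>\<^sub>u - \<nabla>\<^bsub>[u, v]\<^esub>\<close>.  The Ricci tensor at \<open>(\<partial>\<^sub>j, \<partial>\<^sub>k)\<close> is the trace of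
  \<open>u \<mapsto> R(u, \<partial>\<^sub>j) \<partial>\<^sub>k\<close>, so that round spheres have positive Ricci curvature.\<close>

definition riemann ::
  "(real^'n \<Rightarrow> real^'n^'n) \<Rightarrow> 'n::finite \<Rightarrow> 'n \<Rightarrow> 'n \<Rightarrow> 'n \<Rightarrow> real^'n \<Rightarrow> real" where
  "riemann G l i j k x =
     partial i (christoffel G l j k) x - partial j (christoffel G l i k) x
     + (\<Sum>m\<in>UNIV. christoffel G l i m x * christoffel G m j k x
                  - christoffel G l j m x * christoffel G m i k x)"

definition ricci :: "(real^'n \<Rightarrow> real^'n^'n) \<Rightarrow> real^'n::finite \<Rightarrow> real^'n^'n" where
  "ricci G x = (\<chi> j k. \<Sum>i\<in>UNIV. riemann G i i j k x)"

definition local_scalar :: "(real^'n \<Rightarrow> real^'n^'n) \<Rightarrow> real^'n::finite \<Rightarrow> real" where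
  "local_scalar G x = trace_wrt G x (ricci G x)"

definition einstein :: "(real^'n \<Rightarrow> real^'n^'n) \<Rightarrow> real^'n::finite \<Rightarrow> real^'n^'n" where
  "einstein G x = ricci G x - (1/2 * local_scalar G x) *\<^sub>R G x"

text \<open>The \<open>(i, j)\<close> entry is \<open>\<nabla>\<^sub>i \<theta>\<^sub>j\<close>.\<close>

definition cov_deriv ::
  "(real^'n \<Rightarrow> real^'n^'n) \<Rightarrow> (real^'n \<Rightarrow> real^'n) \<Rightarrow> real^'n::finite \<Rightarrow> real^'n^'n" where
  "cov_deriv G \<theta> x =
     (\<chi> i j. partial i (\<lambda>y. \<theta> y $ j) x - (\<Sum>k\<in>UNIV. christoffel G k i j x * \<theta> x $ k))"

definition differential :: "(real^'n \<Rightarrow> real) \<Rightarrow> real^'n::finite \<Rightarrow> real^'n" where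
  "differential u x = (\<chi> i. partial i u x)"

definition hessian ::
  "(real^'n \<Rightarrow> real^'n^'n) \<Rightarrow> (real^'n \<Rightarrow> real) \<Rightarrow> real^'n::finite \<Rightarrow> real^'n^'n" where
  "hessian G u = cov_deriv G (differential u)"

definition codiff ::
  "(real^'n \<Rightarrow> real^'n^'n) \<Rightarrow> (real^'n \<Rightarrow> real^'n) \<Rightarrow> real^'n::finite \<Rightarrow> real" where
  "codiff G \<theta> x = - trace_wrt G x (cov_deriv G \<theta> x)"

definition delta_star ::
  "(real^'n \<Rightarrow> real^'n^'n) \<Rightarrow> (real^'n \<Rightarrow> real^'n) \<Rightarrow> real^'n::finite \<Rightarrow> real^'n^'n" where
  "delta_star G \<theta> x = (\<chi> i j. 1/2 * (cov_deriv G \<theta> x $ i $ j + cov_deriv G \<theta> x $ j $ i))"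

definition B_star ::
  "(real^'n \<Rightarrow> real^'n^'n) \<Rightarrow> (real^'n \<Rightarrow> real^'n) \<Rightarrow> real^'n::finite \<Rightarrow> real^'n^'n" where
  "B_star G \<theta> x = delta_star G \<theta> x + (1/2 * codiff G \<theta> x) *\<^sub>R G x"


section \<open>Average scalar curvature\<close>

text \<open>The scalar curvature does not depend on the chart used to compute it.\<close>

definition scalar_curvature ::
  "('a, 'n::finite) chart set \<Rightarrow> (('a, 'n) chart \<Rightarrow> real^'n \<Rightarrow> real^'n^'n) \<Rightarrow> 'a \<Rightarrow> real" where
  "scalar_curvature A g p =
     (let c = (SOME c. c \<in> A \<and> p \<in> chart_dom c) in local_scalar (g c) (chart_map c p))"

text \<open>The Riemannian volume measure is the unique Borel measure that is given by the density
  \<open>sqrt (det g)\<close> in every chart.\<close>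

definition is_riemannian_measure ::
  "'a topology \<Rightarrow> ('a, 'n::finite) chart set \<Rightarrow> (('a, 'n) chart \<Rightarrow> real^'n \<Rightarrow> real^'n^'n)
     \<Rightarrow> 'a measure \<Rightarrow> bool" where
  "is_riemannian_measure X A g \<mu> \<longleftrightarrow>
     space \<mu> = topspace X \<and> sets \<mu> = sigma_sets (topspace X) {U. openin X U} \<and>
     (\<forall>c\<in>A. \<forall>B\<in>sets \<mu>. B \<subseteq> chart_dom c \<longrightarrow>
        emeasure \<mu> B = (\<integral>\<^sup>+ x \<in> chart_map c ` B. ennreal (sqrt (det (g c x))) \<partial>lborel))"

definition riemannian_measure ::
  "'a topology \<Rightarrow> ('a, 'n::finite) chart set \<Rightarrow> (('a, 'n) chart \<Rightarrow> real^'n \<Rightarrow> real^'n^'n)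
     \<Rightarrow> 'a measure" where
  "riemannian_measure X A g = (THE \<mu>. is_riemannian_measure X A g \<mu>)"

definition average_scalar_curvature ::
  "'a topology \<Rightarrow> ('a, 'n::finite) chart set \<Rightarrow> (('a, 'n) chart \<Rightarrow> real^'n \<Rightarrow> real^'n^'n) \<Rightarrow> real" where
  "average_scalar_curvature X A g =
     1 / measure (riemannian_measure X A g) (topspace X) *
     (\<integral>p. scalar_curvature A g p \<partial>riemannian_measure X A g)"


section \<open>Gradient Ricci solitons and harmonic critical metrics\<close>

definition compact_gradient_ricci_soliton ::
  "'a topology \<Rightarrow> ('a, 'n::finite) chart set \<Rightarrow> (('a, 'n) chart \<Rightarrow> real^'n \<Rightarrow> real^'n^'n)
     \<Rightarrow> ('a \<Rightarrow> real) \<Rightarrow> real \<Rightarrow> bool" where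
  "compact_gradient_ricci_soliton X A g f lam \<longleftrightarrow>
     compact_riemannian_manifold X A g \<and> smooth_function A f \<and>
     (\<forall>c\<in>A. \<forall>x\<in>chart_img c.
        ricci (g c) x + hessian (g c) (f \<circ> chart_inv c) x = lam *\<^sub>R g c x)"

definition harmonic_critical ::
  "'a topology \<Rightarrow> ('a, 'n::finite) chart set \<Rightarrow> (('a, 'n) chart \<Rightarrow> real^'n \<Rightarrow> real^'n^'n) \<Rightarrow> bool" where
  "harmonic_critical X A g \<longleftrightarrow>
     compact_riemannian_manifold X A g \<and>
     (\<exists>\<theta>. smooth_one_form A \<theta> \<and>
        (\<forall>c\<in>A. \<forall>x\<in>chart_img c.
           einstein (g c) x = B_star (g c) (\<theta> c) x
             - ((real CARD('n) - 2) / (2 * real CARD('n)) * average_scalar_curvature X A g) *\<^sub>R g c x))"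

end

theory Submission
  imports Defs
begin

text \<open>
  Write \<open>\<Delta>f\<close> for the trace of \<open>Hess f\<close>.  The trace of the soliton equation is
  \<open>s = n lam - \<Delta>f\<close>.  For \<open>\<theta> = - df\<close> the symmetry of the Hessian gives
  \<open>B\<^sup>*\<theta> = - Hess f + 1/2 (\<Delta>f) g\<close>, and substituting both into the Einstein tensor yields
  \<open>E = B\<^sup>*\<theta> - (n - 2)/2 lam g\<close> by pure algebra in each chart (\<open>soliton_einstein\<close>).  Everything
  else serves to show that \<open>n lam\<close> is the average of \<open>s\<close>, that is, \<open>\<integral> \<Delta>f dv = 0\<close>.

  In a chart, \<open>sqrt (det g) \<Delta>u\<close> is the divergence of the vector field \<open>sqrt (det g) grad u\<close>
  (\<open>divergence_of_gradient\<close>; this rests on Jacobi's formula for the derivative of a determinant),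
  and a partial derivative of a compactly supported \<open>C\<^sup>1\<close> function has integral zero
  (\<open>integral_partial_eq_0\<close>).  This is Green's identity \<open>\<integral> h \<Delta>u dv = - \<integral> \<langle>dh, du\<rangle> dv\<close> for \<open>h\<close>
  supported inside one chart.  A finite partition of unity \<open>(\<phi>\<^sub>i)\<close> subordinate to charts then gives
  \<open>\<integral> \<Delta>u dv = \<Sum>\<^sub>i \<integral> \<phi>\<^sub>i \<Delta>u dv = - \<integral> \<langle>d (\<Sum>\<^sub>i \<phi>\<^sub>i), du\<rangle> dv = 0\<close>, because the sum is the constant 1
  (\<open>integral_laplacian_eq_0\<close>).

  For these integrals to make sense two facts are needed first.  The Riemannian measure, which is
  specified by its density in every chart, exists and is unique: the measures that the charts define
  agree on overlaps by the change of variables formula (\<open>chart_measure_agree\<close>), and they are glued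
  along a finite partition of the manifold into Borel sets.  Also, the scalar curvature at a point
  is computed in some chart around the point, so its value must not depend on the chart.  Since
  \<open>s = n lam - \<Delta>f\<close> in every chart, it suffices that \<open>\<Delta>f\<close> is invariant, and this follows from
  Green's identity itself (\<open>laplacian_invariant\<close>): the right-hand side only involves first
  derivatives, whose transformation law is the chain rule, and no transformation law for the
  Christoffel symbols has to be computed.
\<close>


section \<open>Partial derivatives\<close>

lemma partial_eqI: "(f has_derivative f') (at x) \<Longrightarrow> partial i f x = f' (axis i 1)"
  unfolding partial_def by (metis frechet_derivative_at)

lemma sum_axis: "(\<Sum>i\<in>UNIV. h $ i *\<^sub>R axis i 1) = (h :: real^'n)"
  by (simp add: vec_eq_iff axis_def if_distrib[of "\<lambda>t. _ * t"] cong: if_cong)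

lemma has_derivative_partials:
  fixes f :: "real^'n \<Rightarrow> 'b::real_normed_vector"
  assumes "f differentiable (at x)"
  shows "(f has_derivative (\<lambda>h. \<Sum>i\<in>UNIV. h $ i *\<^sub>R partial i f x)) (at x)"
proof -
  let ?D = "frechet_derivative f (at x)"
  have D: "(f has_derivative ?D) (at x)"
    using assms frechet_derivative_works by blast
  then have lin: "linear ?D" by (rule has_derivative_linear)
  have "?D h = (\<Sum>i\<in>UNIV. h $ i *\<^sub>R partial i f x)" for h
  proof -
    have "?D h = ?D (\<Sum>i\<in>UNIV. h $ i *\<^sub>R axis i 1)" by (simp only: sum_axis)
    also have "\<dots> = (\<Sum>i\<in>UNIV. h $ i *\<^sub>R partial i f x)"
      by (simp add: linear_sum[OF lin] linear_cmul[OF lin] partial_def)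
    finally show ?thesis .
  qed
  then have "?D = (\<lambda>h. \<Sum>i\<in>UNIV. h $ i *\<^sub>R partial i f x)" by (rule ext)
  with D show ?thesis by simp
qed

lemma has_derivative_differential:
  fixes u :: "real^'n \<Rightarrow> real"
  assumes "u differentiable (at x)"
  shows "(u has_derivative (\<lambda>h. h \<bullet> differential u x)) (at x)"
  using has_derivative_partials[OF assms] by (simp add: inner_vec_def differential_def)

lemma differential_eqI:
  fixes u :: "real^'n \<Rightarrow> real"
  assumes "(u has_derivative (\<lambda>h. h \<bullet> D)) (at x)"
  shows "differential u x = D"
  by (simp add: differential_def vec_eq_iff partial_eqI[OF assms] inner_axis')

lemma partial_eq_differential: "partial i u x = differential u x $ i"
  by (simp add: differential_def)

lemma partial_cong:
  assumes "open S" "x \<in> S" "\<And>y. y \<in> S \<Longrightarrow> f y = g y"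
  shows "partial i f x = partial i g x"
proof -
  have "(f has_derivative f') (at x) \<longleftrightarrow> (g has_derivative f') (at x)" for f'
    using assms has_derivative_transform_within_open[of f f' x UNIV S g]
      has_derivative_transform_within_open[of g f' x UNIV S f] by auto
  then show ?thesis unfolding partial_def frechet_derivative_def by simp
qed

lemma differentiable_cong:
  assumes "open S" "x \<in> S" "\<And>y. y \<in> S \<Longrightarrow> f y = g y" "f differentiable (at x)"
  shows "g differentiable (at x)"
  using assms has_derivative_transform_within_open[of f _ x UNIV S g]
  unfolding differentiable_def by blast

lemma differential_cong:
  assumes "open S" "x \<in> S" "\<And>y. y \<in> S \<Longrightarrow> f y = g y"
  shows "differential f x = differential g x"
  using partial_cong[OF assms] by (simp add: differential_def)

lemma partial_bounded_linear:
  assumes "bounded_linear L" "F differentiable (at x)"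
  shows "partial i (\<lambda>y. L (F y)) x = L (partial i F x)"
proof -
  have "(F has_derivative frechet_derivative F (at x)) (at x)"
    using assms frechet_derivative_works by blast
  from partial_eqI[OF bounded_linear.has_derivative[OF assms(1) this]]
  show ?thesis by (simp only: partial_def)
qed

lemma has_derivative_vec_lambda:
  fixes F :: "'m::finite \<Rightarrow> 'a::real_normed_vector \<Rightarrow> real"
  assumes "\<And>i. (F i has_derivative D i) (at x)"
  shows "((\<lambda>y. \<chi> i. F i y) has_derivative (\<lambda>h. \<chi> i. D i h)) (at x)"
proof -
  have eq: "(\<chi> i. v i) = (\<Sum>i\<in>UNIV. v i *\<^sub>R axis i 1)" for v :: "'m \<Rightarrow> real"
    using sum_axis[of "\<chi> i. v i"] by simp
  show ?thesis
    unfolding eq by (intro derivative_intros assms)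
qed

section \<open>Functions of class \<open>C\<^sup>k\<close> on open sets\<close>

lemma Ck_on_cong:
  fixes f g :: "real^'n \<Rightarrow> 'b::real_normed_vector"
  assumes "open S" "\<And>x. x \<in> S \<Longrightarrow> f x = g x" "Ck_on k S f"
  shows "Ck_on k S g"
  using assms(2,3)
proof (induction k arbitrary: f g)
  case 0
  then show ?case by (simp cong: continuous_on_cong)
next
  case (Suc k)
  have "Ck_on k S (partial i g)" for i
    using Suc.IH[of "partial i f" "partial i g"] partial_cong[OF assms(1), of _ f g] Suc.prems by auto
  then show ?case
    using Suc.prems differentiable_cong[OF assms(1), of _ f g] by auto
qed

lemma Ck_on_continuous: "Ck_on k S f \<Longrightarrow> continuous_on S f"
proof (cases k)
  case (Suc j)
  assume "Ck_on k S f"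
  then have "f differentiable_on S"
    by (simp add: Suc differentiable_on_def differentiable_at_withinI)
  then show ?thesis by (rule differentiable_imp_continuous_on)
qed simp

lemma Ck_on_bounded_linear:
  fixes f :: "real^'n \<Rightarrow> 'b::real_normed_vector" and L :: "'b \<Rightarrow> 'c::real_normed_vector"
  assumes "open S" "bounded_linear L" "Ck_on k S f"
  shows "Ck_on k S (\<lambda>x. L (f x))"
  using assms(3)
proof (induction k arbitrary: f)
  case 0
  then show ?case using bounded_linear.continuous_on[OF assms(2)] by simp
next
  case (Suc k)
  have "Ck_on k S (partial i (\<lambda>x. L (f x)))" for i
    by (rule Ck_on_cong[OF assms(1) _ Suc.IH[of "partial i f"]])
       (use Suc.prems in \<open>simp_all add: partial_bounded_linear[OF assms(2)]\<close>)
  moreover have "(\<lambda>x. L (f x)) differentiable at x" if "x \<in> S" for x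
    using Suc.prems that bounded_linear.has_derivative[OF assms(2)]
    unfolding differentiable_def Ck_on.simps by blast
  ultimately show ?case by auto
qed

lemma Ck_on_vec_lambda:
  fixes F :: "'m::finite \<Rightarrow> real^'n \<Rightarrow> real"
  assumes "open S" "\<And>i. Ck_on k S (F i)"
  shows "Ck_on k S (\<lambda>x. \<chi> i. F i x)"
  using assms(2)
proof (induction k arbitrary: F)
  case 0
  then show ?case by (simp add: continuous_on_vec_lambda)
next
  case (Suc k)
  have der: "((\<lambda>y. \<chi> j. F j y) has_derivative (\<lambda>h. \<chi> j. frechet_derivative (F j) (at x) h)) (at x)"
    if "x \<in> S" for x
    using Suc.prems that by (intro has_derivative_vec_lambda) (simp add: frechet_derivative_works)
  have "Ck_on k S (partial i (\<lambda>x. \<chi> j. F j x))" for i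
    by (rule Ck_on_cong[OF assms(1) _ Suc.IH[of "\<lambda>j. partial i (F j)"]])
       (use Suc.prems in \<open>simp_all add: partial_eqI[OF der] partial_def[symmetric]\<close>)
  then show ?case using der by (auto simp: differentiable_def)
qed

lemma smooth_on_Ck: "smooth_on S f \<Longrightarrow> Ck_on k S f"
  by (simp add: smooth_on_def)

lemma smooth_on_differentiable: "smooth_on S f \<Longrightarrow> x \<in> S \<Longrightarrow> f differentiable (at x)"
  using smooth_on_Ck[of S f 1] by auto

lemma smooth_on_continuous: "smooth_on S f \<Longrightarrow> continuous_on S f"
  using Ck_on_continuous smooth_on_Ck by blast

lemma smooth_on_partial: "smooth_on S f \<Longrightarrow> smooth_on S (partial i f)"
  unfolding smooth_on_def by (metis Ck_on.simps(2))

lemma smooth_on_vec_nth: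
  fixes F :: "real^'n \<Rightarrow> ('b::real_normed_vector)^'m"
  shows "open S \<Longrightarrow> smooth_on S F \<Longrightarrow> smooth_on S (\<lambda>x. F x $ j)"
  unfolding smooth_on_def by (blast intro: Ck_on_bounded_linear[OF _ bounded_linear_vec_nth])

lemma smooth_on_differential:
  fixes u :: "real^'n \<Rightarrow> real"
  assumes "open S" "smooth_on S u"
  shows "smooth_on S (differential u)"
proof -
  have "Ck_on k S (\<lambda>x. \<chi> i. partial i u x)" for k
    by (intro Ck_on_vec_lambda smooth_on_Ck smooth_on_partial assms)
  then show ?thesis by (simp add: smooth_on_def differential_def[abs_def])
qed

lemma smooth_on_minus:
  "open S \<Longrightarrow> smooth_on S f \<Longrightarrow> smooth_on S (\<lambda>x. - f x)"
  using Ck_on_bounded_linear[OF _ bounded_linear_minus[OF bounded_linear_ident]]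
  by (auto simp: smooth_on_def)


text \<open>For scalar functions this is \<open>Ck_on 1\<close>.  Speaking of the differential as one vector-valued
  function makes the closure properties below consequences of the product and chain rules.\<close>

definition C1_on :: "(real^'n::finite) set \<Rightarrow> (real^'n \<Rightarrow> real) \<Rightarrow> bool" where
  "C1_on S u \<longleftrightarrow> (\<forall>x\<in>S. u differentiable (at x)) \<and> continuous_on S (differential u)"

lemma C1_onI:
  assumes "\<And>x. x \<in> S \<Longrightarrow> (u has_derivative (\<lambda>h. h \<bullet> D x)) (at x)" "continuous_on S D"
  shows "C1_on S u"
proof -
  have "\<And>x. x \<in> S \<Longrightarrow> differential u x = D x"
    by (rule differential_eqI) (use assms in blast)
  then show ?thesis
    using assms unfolding C1_on_def differentiable_def by (auto cong: continuous_on_cong)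
qed

lemma C1_on_D:
  assumes "C1_on S u" "x \<in> S"
  shows "(u has_derivative (\<lambda>h. h \<bullet> differential u x)) (at x)"
  using assms has_derivative_differential by (auto simp: C1_on_def)

lemma C1_on_differentiable: "C1_on S u \<Longrightarrow> x \<in> S \<Longrightarrow> u differentiable (at x)"
  by (simp add: C1_on_def)

lemma C1_on_differential: "C1_on S u \<Longrightarrow> continuous_on S (differential u)"
  by (simp add: C1_on_def)

lemma C1_on_partial: "C1_on S u \<Longrightarrow> continuous_on S (partial i u)"
  using C1_on_differential[of S u]
  unfolding partial_eq_differential[abs_def] by (intro continuous_intros)

lemma C1_on_continuous: "C1_on S u \<Longrightarrow> continuous_on S u"
  by (auto intro!: differentiable_imp_continuous_on simp: differentiable_on_def C1_on_def
      differentiable_at_withinI)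

lemma C1_on_subset: "C1_on S u \<Longrightarrow> T \<subseteq> S \<Longrightarrow> C1_on T u"
  unfolding C1_on_def using continuous_on_subset by blast

lemma smooth_on_C1:
  fixes u :: "real^'n \<Rightarrow> real"
  shows "open S \<Longrightarrow> smooth_on S u \<Longrightarrow> C1_on S u"
  unfolding C1_on_def
  using smooth_on_differentiable smooth_on_differential smooth_on_continuous by blast

lemma C1_on_Un: 
  assumes "open S" "open T" "C1_on S u" "C1_on T u" shows "C1_on (S \<union> T) u"
  using assms unfolding C1_on_def by (auto intro!: continuous_on_open_Un)

lemma C1_on_cong:
  assumes "open S" "\<And>x. x \<in> S \<Longrightarrow> u x = v x" "C1_on S u"
  shows "C1_on S v"
proof -
  have "differential u x = differential v x" if "x \<in> S" for x
    using assms(1) that assms(2) by (rule differential_cong)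
  then have "continuous_on S (differential v)"
    using C1_on_differential[OF assms(3)] by (simp cong: continuous_on_cong)
  moreover have "v differentiable (at x)" if "x \<in> S" for x
    using differentiable_cong[OF assms(1) that assms(2) C1_on_differentiable[OF assms(3) that]] .
  ultimately show ?thesis unfolding C1_on_def by blast
qed

lemma C1_on_const: "C1_on S (\<lambda>x. c)"
  by (rule C1_onI[where D="\<lambda>x. 0"]) auto

lemma C1_on_add:
  assumes "C1_on S u" "C1_on S v" shows "C1_on S (\<lambda>x. u x + v x)"
  by (rule C1_onI[where D="\<lambda>x. differential u x + differential v x"])
     (auto intro!: derivative_eq_intros continuous_intros C1_on_D[OF assms(1)] C1_on_D[OF assms(2)]
       C1_on_differential assms simp: inner_add_right)

lemma C1_on_mult:
  assumes "C1_on S u" "C1_on S v" shows "C1_on S (\<lambda>x. u x * v x)"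
  by (rule C1_onI[where D="\<lambda>x. u x *\<^sub>R differential v x + v x *\<^sub>R differential u x"])
     (auto intro!: derivative_eq_intros continuous_intros C1_on_D[OF assms(1)] C1_on_D[OF assms(2)]
       C1_on_differential C1_on_continuous assms simp: inner_add_right)

lemma C1_on_compose_real:
  assumes "C1_on S u"
    and "\<And>x. x \<in> S \<Longrightarrow> (\<phi> has_real_derivative \<phi>' (u x)) (at (u x))"
    and "continuous_on (u ` S) \<phi>'"
  shows "C1_on S (\<lambda>x. \<phi> (u x))"
proof (rule C1_onI[where D="\<lambda>x. \<phi>' (u x) *\<^sub>R differential u x"])
  fix x assume x: "x \<in> S"
  have "(\<phi> has_derivative (\<lambda>t. t * \<phi>' (u x))) (at (u x))"
    using assms(2)[OF x] by (simp add: has_field_derivative_def mult.commute[of _ "\<phi>' _"])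
  from has_derivative_compose[OF C1_on_D[OF assms(1) x] this]
  show "((\<lambda>x. \<phi> (u x)) has_derivative (\<lambda>h. h \<bullet> \<phi>' (u x) *\<^sub>R differential u x)) (at x)"
    by (simp add: mult.commute)
next
  have "continuous_on S (\<lambda>x. \<phi>' (u x))"
    using continuous_on_compose2[OF assms(3) C1_on_continuous[OF assms(1)]] by blast
  then show "continuous_on S (\<lambda>x. \<phi>' (u x) *\<^sub>R differential u x)"
    by (intro continuous_intros C1_on_differential assms)
qed

lemma C1_on_inverse:
  assumes "C1_on S u" "\<And>x. x \<in> S \<Longrightarrow> u x \<noteq> 0"
  shows "C1_on S (\<lambda>x. inverse (u x))"
proof (rule C1_on_compose_real[where \<phi>'="\<lambda>t. - (inverse t ^ Suc (Suc 0))", OF assms(1)])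
  show "continuous_on (u ` S) (\<lambda>t. - (inverse t ^ Suc (Suc 0)))"
    using assms(2) by (intro continuous_intros) auto
qed (use assms(2) in \<open>blast intro: DERIV_inverse\<close>)

lemma C1_on_divide:
  assumes "C1_on S u" "C1_on S v" "\<And>x. x \<in> S \<Longrightarrow> v x \<noteq> 0"
  shows "C1_on S (\<lambda>x. u x / v x)"
  unfolding divide_inverse by (intro C1_on_mult C1_on_inverse assms)

lemma C1_on_sqrt:
  assumes "C1_on S u" "\<And>x. x \<in> S \<Longrightarrow> u x > 0"
  shows "C1_on S (\<lambda>x. sqrt (u x))"
proof (rule C1_on_compose_real[where \<phi>'="\<lambda>t. inverse (sqrt t) / 2", OF assms(1)])
  show "continuous_on (u ` S) (\<lambda>t. inverse (sqrt t) / 2)"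
    using assms(2) by (intro continuous_intros) force+
qed (use assms(2) in \<open>blast intro: DERIV_real_sqrt\<close>)

lemma C1_on_sum:
  assumes "\<And>i. i \<in> I \<Longrightarrow> C1_on S (u i)" shows "C1_on S (\<lambda>x. \<Sum>i\<in>I. u i x)"
  using assms by (induction I rule: infinite_finite_induct) (auto intro: C1_on_add C1_on_const)

lemma C1_on_prod:
  assumes "\<And>i. i \<in> I \<Longrightarrow> C1_on S (u i)" shows "C1_on S (\<lambda>x. \<Prod>i\<in>I. u i x)"
  using assms by (induction I rule: infinite_finite_induct) (auto intro: C1_on_mult C1_on_const)

lemma partial_const: "partial i (\<lambda>x. c) x = 0"
  by (simp add: partial_def)

lemma partial_mult:
  fixes u v :: "real^'n \<Rightarrow> real"
  assumes "u differentiable (at x)" "v differentiable (at x)"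
  shows "partial i (\<lambda>x. u x * v x) x = partial i u x * v x + u x * partial i v x"
proof -
  have "((\<lambda>x. u x * v x) has_derivative
      (\<lambda>h. u x * (h \<bullet> differential v x) + (h \<bullet> differential u x) * v x)) (at x)"
    by (intro has_derivative_mult has_derivative_differential assms)
  from partial_eqI[OF this] show ?thesis by (simp add: inner_axis' differential_def)
qed

lemma partial_sum:
  fixes u :: "'i \<Rightarrow> real^'n \<Rightarrow> real"
  assumes "\<And>j. j \<in> I \<Longrightarrow> u j differentiable (at x)"
  shows "partial i (\<lambda>x. \<Sum>j\<in>I. u j x) x = (\<Sum>j\<in>I. partial i (u j) x)"
proof -
  have "((\<lambda>x. \<Sum>j\<in>I. u j x) has_derivative (\<lambda>h. \<Sum>j\<in>I. h \<bullet> differential (u j) x)) (at x)"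
    by (intro has_derivative_sum has_derivative_differential assms)
  from partial_eqI[OF this] show ?thesis by (simp add: inner_axis' differential_def)
qed

lemma partial_compose_real:
  fixes u :: "real^'n \<Rightarrow> real"
  assumes "u differentiable (at x)" "(\<phi> has_real_derivative d) (at (u x))"
  shows "partial i (\<lambda>x. \<phi> (u x)) x = d * partial i u x"
proof -
  have "(\<phi> has_derivative (\<lambda>t. d * t)) (at (u x))"
    using assms(2) by (simp add: has_field_derivative_def)
  from has_derivative_compose[OF has_derivative_differential[OF assms(1)] this]
  have "((\<lambda>x. \<phi> (u x)) has_derivative (\<lambda>h. d * (h \<bullet> differential u x))) (at x)" .
  from partial_eqI[OF this] show ?thesis by (simp add: inner_axis' differential_def)
qed

text \<open>The second difference of \<open>u\<close> in the directions \<open>i\<close> and \<open>j\<close> is symmetric in \<open>i\<close> and \<open>j\<close>.  Applying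
  the mean value theorem in each direction shows that it is \<open>h\<^sup>2\<close> times a value of either mixed
  derivative near \<open>x\<close>; hence the mixed derivatives coincide when they are continuous.\<close>

lemma mixed_difference:
  fixes u :: "real^'n \<Rightarrow> real"
  assumes "0 < h"
    and diff: "\<And>s t. 0 \<le> s \<Longrightarrow> s \<le> h \<Longrightarrow> 0 \<le> t \<Longrightarrow> t \<le> h \<Longrightarrow>
      u differentiable (at (x + s *\<^sub>R axis i 1 + t *\<^sub>R axis j 1)) \<and>
      partial j u differentiable (at (x + s *\<^sub>R axis i 1 + t *\<^sub>R axis j 1))"
  shows "\<exists>s t. 0 < s \<and> s < h \<and> 0 < t \<and> t < h \<and>
    u (x + h *\<^sub>R axis i 1 + h *\<^sub>R axis j 1) - u (x + h *\<^sub>R axis i 1) - u (x + h *\<^sub>R axis j 1) + u x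
      = h * h * partial i (partial j u) (x + s *\<^sub>R axis i 1 + t *\<^sub>R axis j 1)"
proof -
  let ?p = "\<lambda>s t. x + s *\<^sub>R axis i 1 + t *\<^sub>R axis j 1"
  define F where "F t = u (?p h t) - u (?p 0 t)" for t
  have dj: "((\<lambda>t. u (?p s t)) has_real_derivative partial j u (?p s t)) (at t)"
    if "0 \<le> s" "s \<le> h" "0 \<le> t" "t \<le> h" for s t
  proof -
    have "((\<lambda>t. ?p s t) has_derivative (\<lambda>d. d *\<^sub>R axis j 1)) (at t)"
      by (auto intro!: derivative_eq_intros)
    from has_derivative_compose[OF this has_derivative_differential] diff[OF that]
    show ?thesis
      by (simp add: has_field_derivative_def inner_axis' differential_def
          mult.commute[of _ "partial _ _ _"])
  qed
  have di: "((\<lambda>s. partial j u (?p s t)) has_real_derivative partial i (partial j u) (?p s t)) (at s)"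
    if "0 \<le> s" "s \<le> h" "0 \<le> t" "t \<le> h" for s t
  proof -
    have "((\<lambda>s. ?p s t) has_derivative (\<lambda>d. d *\<^sub>R axis i 1)) (at s)"
      by (auto intro!: derivative_eq_intros)
    from has_derivative_compose[OF this has_derivative_differential] diff[OF that]
    show ?thesis
      by (simp add: has_field_derivative_def inner_axis' differential_def
          mult.commute[of _ "partial _ _ _"])
  qed
  have "\<exists>t. 0 < t \<and> t < h \<and> F h - F 0 = (h - 0) * (partial j u (?p h t) - partial j u (?p 0 t))"
  proof (rule MVT2)
    fix t assume "0 \<le> t" "t \<le> h"
    then show "(F has_real_derivative partial j u (?p h t) - partial j u (?p 0 t)) (at t)"
      unfolding F_def using assms(1) by (intro DERIV_diff dj) auto
  qed (fact assms(1))
  then obtain t where t: "0 < t" "t < h" "F h - F 0 = h * (partial j u (?p h t) - partial j u (?p 0 t))"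
    by auto
  have "\<exists>s. 0 < s \<and> s < h \<and> partial j u (?p h t) - partial j u (?p 0 t)
      = (h - 0) * partial i (partial j u) (?p s t)"
    using t assms(1) by (intro MVT2 di) auto
  then obtain s where s: "0 < s" "s < h"
      "partial j u (?p h t) - partial j u (?p 0 t) = h * partial i (partial j u) (?p s t)"
    by auto
  show ?thesis
    using s t by (intro exI[of _ s] exI[of _ t]) (auto simp: F_def algebra_simps)
qed

theorem Schwarz_mixed_partials:
  fixes u :: "real^'n \<Rightarrow> real"
  assumes "open S" "Ck_on 2 S u" "x \<in> S"
  shows "partial i (partial j u) x = partial j (partial i u) x"
proof (rule ccontr)
  assume neq: "partial i (partial j u) x \<noteq> partial j (partial i u) x"
  define e where "e = dist (partial i (partial j u) x) (partial j (partial i u) x) / 2"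
  have "e > 0" using neq by (simp add: e_def)
  have C: "Ck_on (Suc (Suc 0)) S u" using assms(2) by (simp add: numeral_2_eq_2)
  have cont: "continuous_on S (partial a (partial b u))" for a b
    using C by simp
  from assms(1,3) obtain r where r: "r > 0" "ball x r \<subseteq> S" by (meson openE)
  have near: "\<exists>d>0. \<forall>y\<in>ball x d. y \<in> S \<and> dist (partial a (partial b u) y) (partial a (partial b u) x) < e"
    for a b
  proof -
    have "isCont (partial a (partial b u)) x"
      using cont assms(1,3) continuous_on_eq_continuous_at by blast
    then obtain d where "d > 0" "\<forall>y. dist y x < d \<longrightarrow>
        dist (partial a (partial b u) y) (partial a (partial b u) x) < e"
      using \<open>e > 0\<close> by (auto simp: continuous_at_eps_delta)
    then show ?thesis using r
      by (intro exI[of _ "min d r"]) (auto simp: dist_commute)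
  qed
  obtain d where d: "d > 0" 
    "\<And>y. y \<in> ball x d \<Longrightarrow> y \<in> S \<and> dist (partial i (partial j u) y) (partial i (partial j u) x) < e"
    using near by meson
  obtain d' where d': "d' > 0" 
    "\<And>y. y \<in> ball x d' \<Longrightarrow> y \<in> S \<and> dist (partial j (partial i u) y) (partial j (partial i u) x) < e"
    using near by meson
  define h where "h = min d d' / 3"
  have h: "h > 0" "2 * h < d" "2 * h < d'" using d d' by (auto simp: h_def min_def)
  have in_ball: "x + s *\<^sub>R axis a 1 + t *\<^sub>R axis b 1 \<in> ball x d \<inter> ball x d'"
    if "0 \<le> s" "s \<le> h" "0 \<le> t" "t \<le> h" for s t and a b :: 'n
  proof -
    have "norm (s *\<^sub>R axis a 1 + t *\<^sub>R axis b (1::real)) \<le> s + t"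
      using that norm_triangle_ineq[of "s *\<^sub>R axis a (1::real)" "t *\<^sub>R axis b (1::real)"] by simp
    moreover have "dist x (x + s *\<^sub>R axis a 1 + t *\<^sub>R axis b 1) = norm (s *\<^sub>R axis a 1 + t *\<^sub>R axis b (1::real))"
      unfolding dist_norm add.assoc by (metis add_diff_cancel_left' norm_minus_commute)
    ultimately show ?thesis using that h by simp
  qed
  have dif: "u differentiable (at y)" "partial a u differentiable (at y)" if "y \<in> S" for y a
    using C that by auto
  obtain s t where st: "0 < s" "s < h" "0 < t" "t < h"
    "u (x + h *\<^sub>R axis i 1 + h *\<^sub>R axis j 1) - u (x + h *\<^sub>R axis i 1) - u (x + h *\<^sub>R axis j 1) + u x
      = h * h * partial i (partial j u) (x + s *\<^sub>R axis i 1 + t *\<^sub>R axis j 1)"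
    using mixed_difference[OF h(1), of u x i j] dif in_ball d(2) by blast
  obtain s' t' where st': "0 < s'" "s' < h" "0 < t'" "t' < h"
    "u (x + h *\<^sub>R axis j 1 + h *\<^sub>R axis i 1) - u (x + h *\<^sub>R axis j 1) - u (x + h *\<^sub>R axis i 1) + u x
      = h * h * partial j (partial i u) (x + s' *\<^sub>R axis j 1 + t' *\<^sub>R axis i 1)"
    using mixed_difference[OF h(1), of u x j i] dif in_ball d(2) by blast
  have "h * h * partial i (partial j u) (x + s *\<^sub>R axis i 1 + t *\<^sub>R axis j 1)
     = h * h * partial j (partial i u) (x + s' *\<^sub>R axis j 1 + t' *\<^sub>R axis i 1)"
    using st(5) st'(5) by (simp add: algebra_simps)
  then have eq: "partial i (partial j u) (x + s *\<^sub>R axis i 1 + t *\<^sub>R axis j 1)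
     = partial j (partial i u) (x + s' *\<^sub>R axis j 1 + t' *\<^sub>R axis i 1)"
    using h(1) by simp
  have "dist (partial i (partial j u) (x + s *\<^sub>R axis i 1 + t *\<^sub>R axis j 1)) (partial i (partial j u) x) < e"
    using d(2) in_ball[of s t i j] st by auto
  moreover have "dist (partial j (partial i u) (x + s' *\<^sub>R axis j 1 + t' *\<^sub>R axis i 1)) (partial j (partial i u) x) < e"
    using d'(2) in_ball[of s' t' j i] st' by auto
  ultimately have "dist (partial i (partial j u) x) (partial j (partial i u) x) < 2 * e"
    unfolding eq by (smt (verit) dist_commute dist_triangle)
  then show False by (simp add: e_def)
qed


section \<open>Determinants and inverses of matrix-valued functions\<close>

lemma matrix_mult_nth: "(A ** B) $ i $ k = (\<Sum>j\<in>UNIV. A $ i $ j * B $ j $ k)"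
  by (simp add: matrix_matrix_mult_def)

lemma matrix_inv_both:
  fixes A :: "real^'n^'n"
  assumes "det A \<noteq> 0"
  shows "A ** matrix_inv A = mat 1" "matrix_inv A ** A = mat 1"
proof -
  have "\<exists>A'. A ** A' = mat 1 \<and> A' ** A = mat 1"
    using assms by (simp add: invertible_det_nz[symmetric] invertible_def)
  then have "A ** matrix_inv A = mat 1 \<and> matrix_inv A ** A = mat 1"
    unfolding matrix_inv_def by (rule someI_ex)
  then show "A ** matrix_inv A = mat 1" "matrix_inv A ** A = mat 1" by auto
qed

lemma matrix_inv_eqI:
  fixes A :: "real^'n^'n"
  assumes "A ** B = mat 1"
  shows "matrix_inv A = B"
proof -
  have "det A * det B = 1" using assms by (metis det_I det_mul)
  then have "det A \<noteq> 0" by auto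
  then show ?thesis
    by (metis assms matrix_inv_both(2) matrix_mul_assoc matrix_mul_lid matrix_mul_rid)
qed

lemma matrix_inv_symmetric:
  fixes A :: "real^'n^'n"
  assumes "det A \<noteq> 0" "transpose A = A"
  shows "transpose (matrix_inv A) = matrix_inv A"
  by (rule matrix_inv_eqI[symmetric])
     (metis assms matrix_inv_both(2) matrix_transpose_mul transpose_mat)

lemma matrix_inv_cramer:
  fixes A :: "real^'n^'n"
  assumes "det A \<noteq> 0"
  shows "matrix_inv A $ k $ l = det (\<chi> i j. if j = k then axis l 1 $ i else A $ i $ j) / det A"
proof -
  have "A *v (matrix_inv A *v axis l 1) = axis l 1"
    by (simp add: matrix_vector_mul_assoc matrix_inv_both[OF assms])
  then have "matrix_inv A *v axis l 1 =
      (\<chi> k. det (\<chi> i j. if j = k then axis l 1 $ i else A $ i $ j) / det A)"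
    using cramer[OF assms] by blast
  moreover have "(matrix_inv A *v axis l 1) $ k = matrix_inv A $ k $ l"
    by (simp add: matrix_vector_mult_def axis_def if_distrib[of "\<lambda>t. _ * t"] cong: if_cong)
  ultimately show ?thesis by simp
qed

definition positive_definite :: "real^'n^'n \<Rightarrow> bool" where
  "positive_definite A \<longleftrightarrow> (\<forall>v. v \<noteq> 0 \<longrightarrow> v \<bullet> (A *v v) > 0)"

lemma positive_definite_det_nz: "positive_definite A \<Longrightarrow> det A \<noteq> 0"
proof
  assume pd: "positive_definite A" and "det A = 0"
  then obtain v where "v \<noteq> 0" "A *v v = 0"
    using invertible_det_nz matrix_left_invertible_ker[of A] invertible_left_inverse by metis
  with pd show False unfolding positive_definite_def by force
qed

text \<open>The segment from the identity to \<open>A\<close> consists of positive definite matrices, so the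
  determinant does not change its sign along it.\<close>

lemma positive_definite_det_pos:
  fixes A :: "real^'n^'n"
  assumes "positive_definite A"
  shows "det A > 0"
proof (rule ccontr)
  assume "\<not> det A > 0"
  let ?P = "\<lambda>t::real. (1 - t) *\<^sub>R mat 1 + t *\<^sub>R A"
  have "continuous_on {0..1} (\<lambda>t. det (?P t))"
    unfolding det_def by (intro continuous_intros)
  then have "\<exists>t. 0 \<le> t \<and> t \<le> 1 \<and> det (?P t) = 0"
    using IVT2'[of "\<lambda>t. det (?P t)" 1 0 0] \<open>\<not> det A > 0\<close> by auto
  then obtain t where t: "0 \<le> t" "t \<le> 1" "det (?P t) = 0" by blast
  have "positive_definite (?P t)"
    unfolding positive_definite_def
  proof (intro allI impI)
    fix v :: "real^'n" assume "v \<noteq> 0"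
    have "v \<bullet> (?P t *v v) = (1 - t) * (v \<bullet> v) + t * (v \<bullet> (A *v v))"
      by (simp add: matrix_vector_mult_add_rdistrib scaleR_matrix_vector_assoc[symmetric] inner_add_right)
    moreover have "v \<bullet> v > 0" "v \<bullet> (A *v v) > 0"
      using \<open>v \<noteq> 0\<close> assms by (auto simp: positive_definite_def)
    ultimately show "v \<bullet> (?P t *v v) > 0"
      using t by (cases "t = 0") (auto intro: add_nonneg_pos)
  qed
  then show False using t positive_definite_det_nz by blast
qed

lemma C1_on_det:
  fixes M :: "real^'m \<Rightarrow> real^'n^'n"
  assumes "\<And>i j. C1_on S (\<lambda>x. M x $ i $ j)"
  shows "C1_on S (\<lambda>x. det (M x))"
  unfolding det_def by (intro C1_on_sum C1_on_mult C1_on_const C1_on_prod assms)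

text \<open>By Cramer's rule the entries of the inverse are quotients of determinants.\<close>

lemma C1_on_matrix_inv:
  fixes M :: "real^'m \<Rightarrow> real^'n^'n"
  assumes "open S" "\<And>i j. C1_on S (\<lambda>x. M x $ i $ j)" "\<And>x. x \<in> S \<Longrightarrow> det (M x) \<noteq> 0"
  shows "C1_on S (\<lambda>x. matrix_inv (M x) $ i $ j)"
proof (rule C1_on_cong[OF assms(1)])
  have "C1_on S (\<lambda>x. (\<chi> k l. if l = i then axis j 1 $ k else M x $ k $ l) $ k $ l)" for k l
    by (cases "l = i") (simp_all add: C1_on_const assms(2))
  then show "C1_on S (\<lambda>x. det (\<chi> k l. if l = i then axis j 1 $ k else M x $ k $ l) / det (M x))"
    by (intro C1_on_divide C1_on_det assms)
qed (simp add: matrix_inv_cramer assms(3))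

lemma has_derivative_det:
  fixes M :: "real^'m \<Rightarrow> real^'n^'n"
  assumes "\<And>i j. (\<lambda>y. M y $ i $ j) differentiable (at x)"
  shows "((\<lambda>y. det (M y)) has_derivative (\<lambda>h. \<Sum>p | p permutes UNIV. of_int (sign p) *
      (\<Sum>i\<in>UNIV. (h \<bullet> differential (\<lambda>y. M y $ i $ p i) x) *
        (\<Prod>j\<in>UNIV - {i}. M x $ j $ p j)))) (at x)"
  unfolding det_def
  by (intro has_derivative_sum has_derivative_mult_right has_derivative_prod
      has_derivative_differential assms)

text \<open>In the derivative of the Leibniz expansion every summand keeps all but one of the factors
  \<open>M x $ j $ p j\<close>, which are entries of the identity matrix, so only the identity permutation
  contributes.\<close>

lemma partial_det_at_identity:
  fixes M :: "real^'m \<Rightarrow> real^'n^'n"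
  assumes diff: "\<And>i j. (\<lambda>y. M y $ i $ j) differentiable (at x)" and "M x = mat 1"
  shows "partial a (\<lambda>y. det (M y)) x = (\<Sum>i\<in>UNIV. partial a (\<lambda>y. M y $ i $ i) x)"
proof -
  let ?D = "\<lambda>i j. differential (\<lambda>y. M y $ i $ j) x"
  from partial_eqI[OF has_derivative_det, of M x a, OF diff]
  have "partial a (\<lambda>y. det (M y)) x = (\<Sum>p | p permutes UNIV. of_int (sign p) *
      (\<Sum>i\<in>UNIV. ?D i (p i) $ a * (\<Prod>j\<in>UNIV - {i}. M x $ j $ p j)))"
    by (simp add: inner_axis')
  also have "\<dots> = (\<Sum>p \<in> {id}. of_int (sign p) *
      (\<Sum>i\<in>UNIV. ?D i (p i) $ a * (\<Prod>j\<in>UNIV - {i}. M x $ j $ p j)))"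
  proof (rule sum.mono_neutral_right)
    show "\<forall>p\<in>{p. p permutes UNIV} - {id}. of_int (sign p) *
        (\<Sum>i\<in>UNIV. ?D i (p i) $ a * (\<Prod>j\<in>UNIV - {i}. M x $ j $ p j)) = 0"
    proof
      fix p :: "'n \<Rightarrow> 'n" assume "p \<in> {p. p permutes UNIV} - {id}"
      then have p: "bij p" "p \<noteq> id" by (auto simp: permutes_bij)
      have "(\<Prod>j\<in>UNIV - {i}. M x $ j $ p j) = 0" for i
      proof -
        \<comment> \<open>a permutation other than the identity moves two points, one of which is not \<open>i\<close>\<close>
        obtain k where k: "p k \<noteq> k" using p(2) by fastforce
        then have "p (p k) \<noteq> p k" using p(1) by (metis bij_pointE)
        then obtain j where "j \<noteq> i" "p j \<noteq> j" using k by metis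
        then show ?thesis using assms(2)
          by (intro prod_zero) (auto simp: mat_def intro!: bexI[of _ j])
      qed
      then show "of_int (sign p) *
        (\<Sum>i\<in>UNIV. ?D i (p i) $ a * (\<Prod>j\<in>UNIV - {i}. M x $ j $ p j)) = 0" by (simp only: mult_zero_right sum.neutral_const)
    qed
  qed (auto simp: permutes_id)
  also have "\<dots> = (\<Sum>i\<in>UNIV. partial a (\<lambda>y. M y $ i $ i) x)"
    by (simp add: assms(2) mat_def sign_id partial_eq_differential)
  finally show ?thesis .
qed

text \<open>Jacobi's formula is reduced to the identity matrix by
  \<open>det (M y) = det (M x) det (M x\<inverse> M y)\<close>.\<close>

theorem partial_det:
  fixes M :: "real^'m \<Rightarrow> real^'n^'n"
  assumes diff: "\<And>i j. (\<lambda>y. M y $ i $ j) differentiable (at x)" and nz: "det (M x) \<noteq> 0"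
  shows "partial a (\<lambda>y. det (M y)) x = det (M x) *
    (\<Sum>i\<in>UNIV. \<Sum>j\<in>UNIV. matrix_inv (M x) $ i $ j * partial a (\<lambda>y. M y $ j $ i) x)"
proof -
  let ?N = "\<lambda>y. matrix_inv (M x) ** M y"
  have N: "?N y $ i $ k = (\<Sum>j\<in>UNIV. matrix_inv (M x) $ i $ j * M y $ j $ k)" for y i k
    by (simp add: matrix_matrix_mult_def)
  have cdiff: "(\<lambda>y. c * M y $ j $ k) differentiable (at x)" for c j k
    by (intro differentiable_mult diff differentiable_const)
  have ndiff: "(\<lambda>y. ?N y $ i $ k) differentiable (at x)" for i k
    unfolding N by (intro differentiable_sum cdiff ballI) simp
  have "det (M x) * det (matrix_inv (M x)) = 1"
    unfolding det_mul[symmetric] matrix_inv_both(1)[OF nz] by simp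
  then have "det (M y) = det (M x) * det (?N y)" for y
    by (simp add: det_mul mult.assoc[symmetric])
  then have "partial a (\<lambda>y. det (M y)) x = partial a (\<lambda>y. det (M x) * det (?N y)) x"
    by (intro arg_cong[where f="\<lambda>F. partial a F x"] ext)
  also have "\<dots> = det (M x) * partial a (\<lambda>y. det (?N y)) x"
  proof -
    have "(\<lambda>y. det (?N y)) differentiable (at x)"
      unfolding differentiable_def using has_derivative_det[of ?N x, OF ndiff] by blast
    then show ?thesis by (subst partial_mult) (auto simp: partial_const)
  qed
  also have "partial a (\<lambda>y. det (?N y)) x = (\<Sum>i\<in>UNIV. partial a (\<lambda>y. ?N y $ i $ i) x)"
    by (rule partial_det_at_identity[OF ndiff]) (simp add: matrix_inv_both[OF nz])
  also have "\<dots> = (\<Sum>i\<in>UNIV. \<Sum>j\<in>UNIV. matrix_inv (M x) $ i $ j * partial a (\<lambda>y. M y $ j $ i) x)"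
    unfolding N by (simp add: partial_sum cdiff partial_mult diff partial_const)
  finally show ?thesis .
qed

text \<open>Differentiate \<open>M\<inverse> M = 1\<close> and multiply by \<open>M\<inverse>\<close> from the right.\<close>

theorem partial_matrix_inv:
  fixes M :: "real^'m \<Rightarrow> real^'n^'n"
  assumes S: "open S" "x \<in> S" and M: "\<And>i j. C1_on S (\<lambda>y. M y $ i $ j)"
    and nz: "\<And>y. y \<in> S \<Longrightarrow> det (M y) \<noteq> 0"
  shows "partial a (\<lambda>y. matrix_inv (M y) $ i $ l) x = - (\<Sum>j\<in>UNIV. \<Sum>k\<in>UNIV.
    matrix_inv (M x) $ i $ j * partial a (\<lambda>y. M y $ j $ k) x * matrix_inv (M x) $ k $ l)"
proof -
  let ?H = "\<lambda>y. matrix_inv (M y)"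
  let ?dH = "\<lambda>j. partial a (\<lambda>y. ?H y $ i $ j) x"
  let ?dM = "\<lambda>j k. partial a (\<lambda>y. M y $ j $ k) x"
  have dM: "(\<lambda>y. M y $ j $ k) differentiable (at x)" for j k
    using C1_on_differentiable[OF M S(2)] .
  have dH: "(\<lambda>y. ?H y $ j $ k) differentiable (at x)" for j k
    using C1_on_differentiable[OF C1_on_matrix_inv[OF S(1) M nz] S(2)] .
  have 0: "(\<Sum>j\<in>UNIV. ?dH j * M x $ j $ k) = - (\<Sum>j\<in>UNIV. ?H x $ i $ j * ?dM j k)" for k
  proof -
    have "partial a (\<lambda>y. \<Sum>j\<in>UNIV. ?H y $ i $ j * M y $ j $ k) x = partial a (\<lambda>y. mat 1 $ i $ k) x"
    proof (rule partial_cong[OF S])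
      fix y assume "y \<in> S"
      then have "?H y ** M y = mat 1" by (simp add: matrix_inv_both nz)
      then show "(\<Sum>j\<in>UNIV. ?H y $ i $ j * M y $ j $ k) = mat 1 $ i $ k"
        by (simp only: matrix_mult_nth[symmetric])
    qed
    then show ?thesis
      by (simp add: partial_const partial_sum partial_mult dM dH differentiable_mult sum.distrib
          add_eq_0_iff2 add.commute)
  qed
  have "?dH l = (\<Sum>j\<in>UNIV. ?dH j * mat 1 $ j $ l)"
    by (simp add: mat_def if_distrib[of "\<lambda>t. _ * t"] cong: if_cong)
  also have "\<dots> = (\<Sum>j\<in>UNIV. ?dH j * (\<Sum>k\<in>UNIV. M x $ j $ k * ?H x $ k $ l))"
  proof -
    have "mat 1 $ j $ l = (\<Sum>k\<in>UNIV. M x $ j $ k * ?H x $ k $ l)" for j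
      by (simp only: matrix_mult_nth[symmetric] matrix_inv_both(1)[OF nz[OF S(2)]])
    then show ?thesis by simp
  qed
  also have "\<dots> = (\<Sum>j\<in>UNIV. \<Sum>k\<in>UNIV. ?dH j * M x $ j $ k * ?H x $ k $ l)"
    by (simp add: sum_distrib_left mult.assoc)
  also have "\<dots> = (\<Sum>k\<in>UNIV. (\<Sum>j\<in>UNIV. ?dH j * M x $ j $ k) * ?H x $ k $ l)"
    by (subst sum.swap) (simp add: sum_distrib_right)
  also have "\<dots> = (\<Sum>k\<in>UNIV. - (\<Sum>j\<in>UNIV. ?H x $ i $ j * ?dM j k * ?H x $ k $ l))"
    unfolding 0 by (simp add: sum_distrib_right)
  also have "\<dots> = - (\<Sum>j\<in>UNIV. \<Sum>k\<in>UNIV. ?H x $ i $ j * ?dM j k * ?H x $ k $ l)"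
    by (subst sum.swap) (simp add: sum_negf)
  finally show ?thesis .
qed

section \<open>The Laplacian in a chart\<close>

definition volume_density :: "(real^'n \<Rightarrow> real^'n^'n) \<Rightarrow> real^'n \<Rightarrow> real" where
  "volume_density G x = sqrt (det (G x))"

definition laplacian :: "(real^'n \<Rightarrow> real^'n^'n) \<Rightarrow> (real^'n \<Rightarrow> real) \<Rightarrow> real^'n::finite \<Rightarrow> real" where
  "laplacian G u x = trace_wrt G x (hessian G u x)"

definition gradient :: "(real^'n \<Rightarrow> real^'n^'n) \<Rightarrow> (real^'n \<Rightarrow> real) \<Rightarrow> real^'n::finite \<Rightarrow> real^'n" where
  "gradient G u x = matrix_inv (G x) *v differential u x"

lemma gradient_nth: "gradient G u x $ a = (\<Sum>b\<in>UNIV. matrix_inv (G x) $ a $ b * partial b u x)"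
  by (simp add: gradient_def matrix_vector_mult_def differential_def)

locale local_metric =
  fixes S :: "(real^'n) set" and G :: "real^'n \<Rightarrow> real^'n^'n"
  assumes open_S: "open S" and smooth_G: "smooth_on S G"
    and sym_G: "x \<in> S \<Longrightarrow> transpose (G x) = G x"
    and pos_G: "x \<in> S \<Longrightarrow> positive_definite (G x)"
begin

lemma det_pos: "x \<in> S \<Longrightarrow> det (G x) > 0"
  using positive_definite_det_pos pos_G by blast

lemma det_nz: "x \<in> S \<Longrightarrow> det (G x) \<noteq> 0"
  using det_pos by force

lemma density_pos: "x \<in> S \<Longrightarrow> volume_density G x > 0"
  by (simp add: volume_density_def det_pos)

lemma G_sym: "x \<in> S \<Longrightarrow> G x $ i $ j = G x $ j $ i"
  using arg_cong[OF sym_G[of x], of "\<lambda>A. A $ j $ i"] by (simp add: transpose_def)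

lemma inv_sym: "x \<in> S \<Longrightarrow> matrix_inv (G x) $ i $ j = matrix_inv (G x) $ j $ i"
  using arg_cong[OF matrix_inv_symmetric[OF det_nz sym_G, of x], of "\<lambda>A. A $ j $ i"]
  by (simp add: transpose_def)

lemma C1_G: "C1_on S (\<lambda>x. G x $ i $ j)"
  by (intro smooth_on_C1 smooth_on_vec_nth open_S smooth_G)

lemma C1_inv: "C1_on S (\<lambda>x. matrix_inv (G x) $ i $ j)"
  by (rule C1_on_matrix_inv[OF open_S C1_G det_nz])

lemma C1_density: "C1_on S (volume_density G)"
  unfolding volume_density_def[abs_def] by (intro C1_on_sqrt C1_on_det C1_G det_pos)

lemma dG_sym: "x \<in> S \<Longrightarrow> partial a (\<lambda>y. G y $ i $ j) x = partial a (\<lambda>y. G y $ j $ i) x"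
  by (rule partial_cong[OF open_S _ G_sym])

lemma christoffel_sym: "x \<in> S \<Longrightarrow> christoffel G k i j x = christoffel G k j i x"
  unfolding christoffel_def by (simp add: dG_sym[of x _ i j] add.commute)

lemma continuous_christoffel: "continuous_on S (christoffel G k i j)"
  unfolding christoffel_def[abs_def]
  by (intro continuous_intros C1_on_continuous[OF C1_inv] C1_on_partial[OF C1_G])

lemma hessian_nth:
  "hessian G u x $ i $ j = partial i (partial j u) x - (\<Sum>k\<in>UNIV. christoffel G k i j x * partial k u x)"
  by (simp add: hessian_def cov_deriv_def differential_def)

lemma hessian_sym:
  assumes "smooth_on S u" "x \<in> S"
  shows "hessian G u x $ i $ j = hessian G u x $ j $ i"
  unfolding hessian_nth
  using Schwarz_mixed_partials[OF open_S smooth_on_Ck[OF assms(1)] assms(2)] christoffel_sym[OF assms(2)]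
  by simp

lemma continuous_laplacian:
  assumes "smooth_on S u"
  shows "continuous_on S (laplacian G u)"
  unfolding laplacian_def[abs_def] trace_wrt_def hessian_nth
  by (intro continuous_intros C1_on_continuous[OF C1_inv] continuous_christoffel
      smooth_on_continuous smooth_on_partial assms)

lemma partial_density:
  assumes "x \<in> S"
  shows "partial a (volume_density G) x = volume_density G x *
    (\<Sum>i\<in>UNIV. \<Sum>j\<in>UNIV. 1/2 * (matrix_inv (G x) $ i $ j * partial a (\<lambda>y. G y $ i $ j) x))"
proof -
  let ?t = "\<Sum>i\<in>UNIV. \<Sum>j\<in>UNIV. matrix_inv (G x) $ i $ j * partial a (\<lambda>y. G y $ i $ j) x"
  have "(sqrt has_real_derivative inverse (sqrt (det (G x))) / 2) (at (det (G x)))"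
    using DERIV_real_sqrt det_pos assms by blast
  then have "partial a (volume_density G) x =
      inverse (sqrt (det (G x))) / 2 * partial a (\<lambda>y. det (G y)) x"
    using partial_compose_real[OF C1_on_differentiable[OF C1_on_det[OF C1_G] assms]]
    by (simp add: volume_density_def[abs_def])
  also have "partial a (\<lambda>y. det (G y)) x = det (G x) * ?t"
    using partial_det[OF C1_on_differentiable[OF C1_G assms] det_nz[OF assms], of a] dG_sym[OF assms]
    by simp
  also have "inverse (sqrt (det (G x))) / 2 * (det (G x) * ?t) = sqrt (det (G x)) * (1/2 * ?t)"
    using det_pos[OF assms] by (simp add: field_simps)
  finally show ?thesis by (simp only: volume_density_def[abs_def] sum_distrib_left)
qed

lemma C1_gradient:
  assumes "smooth_on S u"
  shows "C1_on S (\<lambda>y. volume_density G y * gradient G u y $ a)"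
  unfolding gradient_nth
  by (intro C1_on_mult C1_density C1_on_sum C1_inv smooth_on_C1 smooth_on_partial open_S assms)

text \<open>The derivative of \<open>sqrt (det G)\<close> is given by Jacobi's formula and that of the inverse metric \<open>H\<close>
  by the formula above.  The terms with first derivatives of \<open>u\<close> that arise are the contraction
  \<open>H i j * christoffel G k i j\<close>: its two summands with the derivative index in the contracted pair
  \<open>i j\<close> coincide (\<open>B'\<close>) and come from differentiating \<open>H\<close>, and the third one comes from the density.\<close>

theorem divergence_of_gradient:
  assumes u: "smooth_on S u" and x: "x \<in> S"
  shows "(\<Sum>a\<in>UNIV. partial a (\<lambda>y. volume_density G y * gradient G u y $ a) x)
    = volume_density G x * laplacian G u x"
proof -
  define H where "H i j = matrix_inv (G x) $ i $ j" for i j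
  define D where "D a i j = partial a (\<lambda>y. G y $ i $ j) x" for a i j
  define w where "w i = partial i u x" for i
  define v where "v i j = partial i (partial j u) x" for i j
  have Hs: "H i j = H j i" for i j unfolding H_def using inv_sym x by blast
  have dden: "volume_density G differentiable (at x)"
    using C1_on_differentiable[OF C1_density x] .
  have dinv: "(\<lambda>y. matrix_inv (G y) $ i $ j) differentiable (at x)" for i j
    using C1_on_differentiable[OF C1_inv x] .
  have dw: "partial i u differentiable (at x)" for i
    using smooth_on_differentiable[OF smooth_on_partial[OF u] x] .
  have summand: "partial a (\<lambda>y. volume_density G y * gradient G u y $ a) x = volume_density G x *
      ((\<Sum>i\<in>UNIV. \<Sum>j\<in>UNIV. 1/2 * (H i j * D a i j)) * (\<Sum>b\<in>UNIV. H a b * w b)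
       + (\<Sum>b\<in>UNIV. - (\<Sum>j\<in>UNIV. \<Sum>k\<in>UNIV. H a j * D a j k * H k b) * w b + H a b * v a b))" for a
  proof -
    have "partial a (\<lambda>y. volume_density G y * gradient G u y $ a) x
      = partial a (volume_density G) x * (\<Sum>b\<in>UNIV. H a b * w b)
        + volume_density G x * (\<Sum>b\<in>UNIV. partial a (\<lambda>y. matrix_inv (G y) $ a $ b) x * w b + H a b * v a b)"
      unfolding gradient_nth
      by (simp add: partial_mult partial_sum dden dinv dw differentiable_mult differentiable_sum
          H_def w_def v_def)
    also have "partial a (volume_density G) x
        = volume_density G x * (\<Sum>i\<in>UNIV. \<Sum>j\<in>UNIV. 1/2 * (H i j * D a i j))"
      using partial_density[OF x] by (simp add: H_def D_def)
    also have "(\<lambda>b. partial a (\<lambda>y. matrix_inv (G y) $ a $ b) x)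
        = (\<lambda>b. - (\<Sum>j\<in>UNIV. \<Sum>k\<in>UNIV. H a j * D a j k * H k b))"
      using partial_matrix_inv[OF open_S x C1_G det_nz] by (simp add: H_def D_def)
    finally show ?thesis by (simp only: distrib_left mult.assoc)
  qed
  have A: "(\<Sum>a\<in>UNIV. (\<Sum>i\<in>UNIV. \<Sum>j\<in>UNIV. 1/2 * (H i j * D a i j)) * (\<Sum>b\<in>UNIV. H a b * w b))
    = (\<Sum>i\<in>UNIV. \<Sum>j\<in>UNIV. \<Sum>k\<in>UNIV. \<Sum>l\<in>UNIV. 1/2 * H i j * H k l * D l i j * w k)"
  proof -
    have "(\<Sum>a\<in>UNIV. (\<Sum>i\<in>UNIV. \<Sum>j\<in>UNIV. 1/2 * (H i j * D a i j)) * (\<Sum>b\<in>UNIV. H a b * w b))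
      = (\<Sum>a\<in>UNIV. \<Sum>b\<in>UNIV. \<Sum>i\<in>UNIV. \<Sum>j\<in>UNIV. 1/2 * H i j * H b a * D a i j * w b)"
      unfolding sum_distrib_left unfolding sum_distrib_right by (simp add: Hs mult_ac)
    also have "\<dots> = (\<Sum>(a,b,i,j)\<in>UNIV. 1/2 * H i j * H b a * D a i j * w b)"
      by (simp add: sum.cartesian_product UNIV_Times_UNIV[symmetric] del: UNIV_Times_UNIV)
    also have "\<dots> = (\<Sum>(i,j,k,l)\<in>UNIV. 1/2 * H i j * H k l * D l i j * w k)"
      by (rule sum.reindex_bij_witness[of _ "\<lambda>(i,j,k,l). (l,k,i,j)" "\<lambda>(a,b,i,j). (i,j,b,a)"]) auto
    also have "\<dots> = (\<Sum>i\<in>UNIV. \<Sum>j\<in>UNIV. \<Sum>k\<in>UNIV. \<Sum>l\<in>UNIV. 1/2 * H i j * H k l * D l i j * w k)"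
      by (simp add: sum.cartesian_product UNIV_Times_UNIV[symmetric] del: UNIV_Times_UNIV)
    finally show ?thesis .
  qed
  have B: "(\<Sum>a\<in>UNIV. \<Sum>b\<in>UNIV. (\<Sum>j\<in>UNIV. \<Sum>k\<in>UNIV. H a j * D a j k * H k b) * w b)
    = (\<Sum>i\<in>UNIV. \<Sum>j\<in>UNIV. \<Sum>k\<in>UNIV. \<Sum>l\<in>UNIV. H i j * H k l * D i j l * w k)"
  proof -
    have "(\<Sum>a\<in>UNIV. \<Sum>b\<in>UNIV. (\<Sum>j\<in>UNIV. \<Sum>k\<in>UNIV. H a j * D a j k * H k b) * w b)
      = (\<Sum>(a,b,j,k)\<in>UNIV. H a j * D a j k * H k b * w b)"
      unfolding sum_distrib_right
      by (simp add: sum.cartesian_product UNIV_Times_UNIV[symmetric] del: UNIV_Times_UNIV)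
    also have "\<dots> = (\<Sum>(i,j,k,l)\<in>UNIV. H i j * H k l * D i j l * w k)"
      by (rule sum.reindex_bij_witness[of _ "\<lambda>(i,j,k,l). (i,k,j,l)" "\<lambda>(a,b,j,k). (a,j,b,k)"])
         (auto simp: Hs mult_ac)
    also have "\<dots> = (\<Sum>i\<in>UNIV. \<Sum>j\<in>UNIV. \<Sum>k\<in>UNIV. \<Sum>l\<in>UNIV. H i j * H k l * D i j l * w k)"
      by (simp add: sum.cartesian_product UNIV_Times_UNIV[symmetric] del: UNIV_Times_UNIV)
    finally show ?thesis .
  qed
  have B': "(\<Sum>i\<in>UNIV. \<Sum>j\<in>UNIV. \<Sum>k\<in>UNIV. \<Sum>l\<in>UNIV. H i j * H k l * D i j l * w k)
     = (\<Sum>i\<in>UNIV. \<Sum>j\<in>UNIV. \<Sum>k\<in>UNIV. \<Sum>l\<in>UNIV. H i j * H k l * D j i l * w k)"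
    by (subst sum.swap) (simp add: Hs)
  have "(\<Sum>i\<in>UNIV. \<Sum>j\<in>UNIV. H i j * (\<Sum>k\<in>UNIV. christoffel G k i j x * w k))
    = (\<Sum>i\<in>UNIV. \<Sum>j\<in>UNIV. \<Sum>k\<in>UNIV. \<Sum>l\<in>UNIV.
        1/2 * (H i j * H k l * D i j l * w k) + 1/2 * (H i j * H k l * D j i l * w k)
        - 1/2 * H i j * H k l * D l i j * w k)"
    by (simp add: christoffel_def H_def[symmetric] D_def[symmetric] sum_distrib_left sum_distrib_right
        algebra_simps)
  also have "\<dots> = (\<Sum>i\<in>UNIV. \<Sum>j\<in>UNIV. \<Sum>k\<in>UNIV. \<Sum>l\<in>UNIV. H i j * H k l * D i j l * w k)
      - (\<Sum>i\<in>UNIV. \<Sum>j\<in>UNIV. \<Sum>k\<in>UNIV. \<Sum>l\<in>UNIV. 1/2 * H i j * H k l * D l i j * w k)"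
    using B' by (simp add: sum.distrib sum_subtractf flip: sum_distrib_left sum_divide_distrib)
  finally have C: "(\<Sum>i\<in>UNIV. \<Sum>j\<in>UNIV. H i j * (\<Sum>k\<in>UNIV. christoffel G k i j x * w k)) = \<dots>" .
  have "laplacian G u x = (\<Sum>i\<in>UNIV. \<Sum>j\<in>UNIV. H i j * v i j)
      - (\<Sum>i\<in>UNIV. \<Sum>j\<in>UNIV. H i j * (\<Sum>k\<in>UNIV. christoffel G k i j x * w k))"
    by (simp add: laplacian_def trace_wrt_def hessian_nth H_def v_def w_def right_diff_distrib sum_subtractf)
  also have "\<dots> = (\<Sum>a\<in>UNIV. (\<Sum>i\<in>UNIV. \<Sum>j\<in>UNIV. 1/2 * (H i j * D a i j)) * (\<Sum>b\<in>UNIV. H a b * w b)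
       + (\<Sum>b\<in>UNIV. - (\<Sum>j\<in>UNIV. \<Sum>k\<in>UNIV. H a j * D a j k * H k b) * w b + H a b * v a b))"
    unfolding C A[symmetric] B[symmetric] by (simp add: sum.distrib sum_subtractf sum_negf)
  finally show ?thesis
    unfolding summand by (simp add: sum_distrib_left)
qed

end


section \<open>Integration by parts in a chart\<close>

lemma integral_translate_lborel:
  fixes w :: "real^'n \<Rightarrow> real"
  assumes "w \<in> borel_measurable borel"
  shows "(\<integral>x. w (c + x) \<partial>lborel) = (\<integral>x. w x \<partial>lborel)"
proof -
  have "(\<integral>x. w x \<partial>lborel) = (\<integral>x. w x \<partial>distr lborel borel ((+) c))"
    by (simp add: lborel_distr_plus)
  also have "\<dots> = (\<integral>x. w (c + x) \<partial>lborel)"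
    using assms by (intro integral_distr) auto
  finally show ?thesis by simp
qed

lemma integrable_translate_lborel:
  fixes w :: "real^'n \<Rightarrow> real"
  assumes "integrable lborel w"
  shows "integrable lborel (\<lambda>x. w (c + x))"
  using integrable_distr[of "(+) c" lborel borel w] assms by (simp add: lborel_distr_plus)

lemma set_integrable_compact_support:
  fixes h :: "real^'n \<Rightarrow> real"
  assumes "compact K" "K \<subseteq> S" "continuous_on S h" "\<And>x. x \<in> S - K \<Longrightarrow> h x = 0"
  shows "set_integrable lborel S h"
proof -
  have "integrable lborel (\<lambda>x. indicator K x *\<^sub>R h x)"
    using assms by (intro borel_integrable_compact continuous_on_subset[OF assms(3)]) auto
  moreover have "(\<lambda>x. indicator K x *\<^sub>R h x) = (\<lambda>x. indicator S x *\<^sub>R h x)"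
    using assms(2,4) by (auto simp: fun_eq_iff indicator_def)
  ultimately show ?thesis by (simp add: set_integrable_def)
qed

text \<open>By translation invariance the difference quotients of a compactly supported function have
  integral zero; they converge to the partial derivative under an integrable bound.\<close>

theorem integral_partial_eq_0:
  fixes w :: "real^'n \<Rightarrow> real"
  assumes w: "C1_on UNIV w" and K: "compact K" and supp: "\<And>x. x \<notin> K \<Longrightarrow> w x = 0"
  shows "integrable lborel (partial a w)" "(\<integral>x. partial a w x \<partial>lborel) = 0"
proof -
  let ?e = "axis a 1 :: real^'n"
  have cw: "continuous_on UNIV w" using C1_on_continuous[OF w] .
  have cp: "continuous_on UNIV (partial a w)" using C1_on_partial[OF w] .
  have p0: "partial a w x = 0" if "x \<notin> K" for x
    using partial_cong[of "- K" x w "\<lambda>x. 0"] that supp K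
    by (auto simp: partial_const compact_imp_closed open_Compl)
  have integ: "integrable lborel h" if "continuous_on UNIV h" "\<And>x. x \<notin> K \<Longrightarrow> h x = 0"
    for h :: "real^'n \<Rightarrow> real"
    using set_integrable_compact_support[OF K, of UNIV h] that by (simp add: set_integrable_def)
  show "integrable lborel (partial a w)" using integ cp p0 by blast
  have wi: "integrable lborel w" using integ cw supp by blast
  have "bounded (partial a w ` K)"
    using K cp by (metis compact_continuous_image compact_imp_bounded continuous_on_subset top_greatest)
  then obtain M where M: "\<And>x. x \<in> K \<Longrightarrow> \<bar>partial a w x\<bar> \<le> M"
    by (auto simp: bounded_iff)
  define M' where "M' = max M 0"
  have M': "\<bar>partial a w x\<bar> \<le> M'" for x
    using M[of x] p0[of x] by (cases "x \<in> K") (auto simp: M'_def)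
  obtain R where R: "\<And>x. x \<in> K \<Longrightarrow> norm x \<le> R"
    using compact_imp_bounded[OF K] by (auto simp: bounded_iff)
  define t where "t n = 1 / real (Suc n)" for n
  have t: "0 < t n" "t n \<le> 1" for n by (auto simp: t_def)
  define q where "q n x = (w (t n *\<^sub>R ?e + x) - w x) / t n" for n x
  have line: "((\<lambda>s. w (s *\<^sub>R ?e + x)) has_real_derivative partial a w (s *\<^sub>R ?e + x)) (at s)" for x s
  proof -
    have "((\<lambda>s. s *\<^sub>R ?e + x) has_derivative (\<lambda>d. d *\<^sub>R ?e)) (at s)"
      by (auto intro!: derivative_eq_intros)
    from has_derivative_compose[OF this C1_on_D[OF w]]
    show ?thesis
      by (simp add: has_field_derivative_def inner_axis' differential_def
          mult.commute[of _ "partial _ _ _"])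
  qed
  have q0: "(\<integral>x. q n x \<partial>lborel) = 0" for n
    unfolding q_def
    using wi integrable_translate_lborel[OF wi] integral_translate_lborel[OF borel_measurable_continuous_onI[OF cw]]
    by simp
  have "(\<lambda>n. \<integral>x. q n x \<partial>lborel) \<longlonglongrightarrow> (\<integral>x. partial a w x \<partial>lborel)"
  proof (rule integral_dominated_convergence[where w="\<lambda>x. M' * indicator (cball 0 (R + 1)) x"])
    show "partial a w \<in> borel_measurable lborel"
      using borel_measurable_continuous_onI[OF cp] by simp
    show "q n \<in> borel_measurable lborel" for n
      unfolding q_def[abs_def]
      by (simp, intro borel_measurable_continuous_onI continuous_intros
          continuous_on_compose2[OF cw] subset_UNIV) (use t in \<open>auto simp: less_imp_neq[symmetric]\<close>)
    show "integrable lborel (\<lambda>x. M' * indicator (cball 0 (R + 1)) (x :: real^'n))"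
      by (intro integrable_mult_right integrable_real_indicator)
         (simp_all add: emeasure_lborel_cball_finite[unfolded infinity_ennreal_def])
    show "AE x in lborel. (\<lambda>n. q n x) \<longlonglongrightarrow> partial a w x"
    proof (intro AE_I2)
      fix x
      have "((\<lambda>h. (w ((0 + h) *\<^sub>R ?e + x) - w (0 *\<^sub>R ?e + x)) / h) \<longlongrightarrow> partial a w x) (at 0)"
        using line[of x 0] unfolding DERIV_def by simp
      moreover have "filterlim t (at 0) sequentially"
        unfolding filterlim_at using t LIMSEQ_inverse_real_of_nat
        by (auto simp: t_def[abs_def] inverse_eq_divide)
      ultimately show "(\<lambda>n. q n x) \<longlonglongrightarrow> partial a w x"
        unfolding q_def by (auto dest: filterlim_compose)
    qed
    show "AE x in lborel. norm (q n x) \<le> M' * indicator (cball 0 (R + 1)) x" for n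
    proof (intro AE_I2)
      fix x
      show "norm (q n x) \<le> M' * indicator (cball 0 (R + 1)) x"
      proof (cases "x \<in> cball 0 (R + 1)")
        case True
        obtain s where "w (t n *\<^sub>R ?e + x) - w (0 *\<^sub>R ?e + x) = (t n - 0) * partial a w (s *\<^sub>R ?e + x)"
          using MVT2[OF t(1)[of n] line] by blast
        then have "q n x = partial a w (s *\<^sub>R ?e + x)" using t(1)[of n] by (simp add: q_def)
        then show ?thesis using True M' by simp
      next
        case False
        then have nx: "norm x > R + 1" by simp
        have "norm x \<le> norm (t n *\<^sub>R ?e + x) + norm (t n *\<^sub>R ?e)"
          by (metis add_diff_cancel_left' norm_triangle_ineq4 add.commute)
        moreover have "norm (t n *\<^sub>R ?e) \<le> 1" using t[of n] by simp
        ultimately have "norm (t n *\<^sub>R ?e + x) > R" using nx by linarith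
        then have "w (t n *\<^sub>R ?e + x) = 0" "w x = 0"
          using R nx supp by (meson not_le, smt (verit) R supp)
        then show ?thesis using False by (simp add: q_def)
      qed
    qed
  qed
  then have "(\<lambda>n. 0) \<longlonglongrightarrow> (\<integral>x. partial a w x \<partial>lborel)" using q0 by simp
  then show "(\<integral>x. partial a w x \<partial>lborel) = 0" by (simp add: LIMSEQ_const_iff)
qed

text \<open>The open sets \<open>S\<close> and \<open>- K\<close> cover the whole space, and the extension is zero on the second.\<close>

lemma C1_on_extend_zero:
  fixes h :: "real^'n \<Rightarrow> real"
  assumes "open S" "compact K" "K \<subseteq> S" "C1_on S h" "\<And>x. x \<in> S - K \<Longrightarrow> h x = 0"
  shows "C1_on UNIV (\<lambda>x. if x \<in> S then h x else 0)" (is "C1_on UNIV ?h")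
proof -
  have oK: "open (- K)" using assms(2) by (simp add: compact_imp_closed open_Compl)
  have "C1_on S ?h" by (rule C1_on_cong[OF assms(1) _ assms(4)]) simp
  moreover have "C1_on (- K) ?h"
    by (rule C1_on_cong[OF oK _ C1_on_const[where c=0]]) (use assms(5) in auto)
  moreover have "S \<union> - K = UNIV" using assms(3) by auto
  ultimately show ?thesis using C1_on_Un[OF assms(1) oK] by metis
qed

context local_metric
begin

lemma continuous_inner_gradient:
  assumes "smooth_on S u" "C1_on S h"
  shows "continuous_on S (\<lambda>x. differential h x \<bullet> gradient G u x)"
  unfolding inner_vec_def gradient_nth inner_real_def
  by (intro continuous_intros C1_on_differential[OF assms(2)] C1_on_continuous[OF C1_inv]
      smooth_on_continuous smooth_on_partial assms(1))

text \<open>The vector field \<open>h * sqrt (det G) * grad u\<close>, extended by zero, has compact support, so the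
  integral of its divergence vanishes.\<close>

theorem Green_identity_local:
  assumes u: "smooth_on S u" and h: "C1_on S h"
    and K: "compact K" "K \<subseteq> S" and supp: "\<And>x. x \<in> S - K \<Longrightarrow> h x = 0"
  shows "(LINT x:S|lborel. h x * laplacian G u x * volume_density G x)
      = - (LINT x:S|lborel. (differential h x \<bullet> gradient G u x) * volume_density G x)"
proof -
  let ?V = "\<lambda>a y. volume_density G y * gradient G u y $ a"
  let ?w = "\<lambda>a x. if x \<in> S then h x * ?V a x else 0"
  have w: "C1_on UNIV (?w a)" for a
    by (rule C1_on_extend_zero[OF open_S K]) (simp_all add: C1_on_mult[OF h C1_gradient[OF u]] supp)
  have w0: "?w a x = 0" if "x \<notin> K" for a x using that supp by auto
  have dh0: "differential h x = 0" if "x \<in> S - K" for x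
  proof -
    have "open (S - K)" using K open_S by (simp add: compact_imp_closed open_Diff)
    then have "differential h x = differential (\<lambda>x. 0) x"
      using that supp by (intro differential_cong[of "S - K"]) auto
    then show ?thesis by (simp add: differential_def partial_const vec_eq_iff)
  qed
  have pw: "partial a (?w a) x = h x * partial a (?V a) x + differential h x $ a * ?V a x" if "x \<in> S" for a x
  proof -
    have "partial a (?w a) x = partial a (\<lambda>x. h x * ?V a x) x"
      by (rule partial_cong[OF open_S that]) simp
    also have "\<dots> = partial a h x * ?V a x + h x * partial a (?V a) x"
      by (rule partial_mult) (use C1_on_differentiable[OF _ that] h C1_gradient[OF u] in blast)+
    finally show ?thesis by (simp add: partial_eq_differential)
  qed
  have pw0: "partial a (?w a) x = 0" if "x \<notin> S" for a x
  proof -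
    have "partial a (?w a) x = partial a (\<lambda>x. 0) x"
      by (rule partial_cong[of "- K"]) (use that K supp in \<open>auto simp: compact_imp_closed open_Compl\<close>)
    then show ?thesis by (simp add: partial_const)
  qed
  have sum: "(\<Sum>a\<in>UNIV. partial a (?w a) x) = indicator S x *\<^sub>R (h x * laplacian G u x * volume_density G x)
      + indicator S x *\<^sub>R ((differential h x \<bullet> gradient G u x) * volume_density G x)" for x
  proof (cases "x \<in> S")
    case True
    have "(\<Sum>a\<in>UNIV. partial a (?w a) x) = h x * (\<Sum>a\<in>UNIV. partial a (?V a) x)
        + (\<Sum>a\<in>UNIV. differential h x $ a * gradient G u x $ a) * volume_density G x"
      by (simp add: pw[OF True] sum.distrib sum_distrib_left sum_distrib_right mult_ac)
    then show ?thesis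
      by (simp add: True divergence_of_gradient[OF u True] inner_vec_def mult_ac)
  qed (simp add: pw0)
  have i1: "set_integrable lborel S (\<lambda>x. h x * laplacian G u x * volume_density G x)"
    by (rule set_integrable_compact_support[OF K])
       (auto intro!: continuous_intros C1_on_continuous[OF h] continuous_laplacian u
         C1_on_continuous[OF C1_density] simp: supp)
  have "continuous_on S (\<lambda>x. (differential h x \<bullet> gradient G u x) * volume_density G x)"
    by (intro continuous_intros continuous_inner_gradient C1_on_continuous[OF C1_density] u h)
  then have i2: "set_integrable lborel S (\<lambda>x. (differential h x \<bullet> gradient G u x) * volume_density G x)"
    by (rule set_integrable_compact_support[OF K]) (simp add: dh0)
  have "0 = (\<Sum>a\<in>UNIV. \<integral>x. partial a (?w a) x \<partial>lborel)"
    using integral_partial_eq_0(2)[OF w K(1) w0] by simp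
  also have "\<dots> = (\<integral>x. (\<Sum>a\<in>UNIV. partial a (?w a) x) \<partial>lborel)"
    by (rule Bochner_Integration.integral_sum[symmetric]) (rule integral_partial_eq_0(1)[OF w K(1) w0])
  also have "\<dots> = (LINT x:S|lborel. h x * laplacian G u x * volume_density G x)
      + (LINT x:S|lborel. (differential h x \<bullet> gradient G u x) * volume_density G x)"
    unfolding sum set_lebesgue_integral_def
    using i1 i2 by (intro Bochner_Integration.integral_add) (simp_all add: set_integrable_def)
  finally show ?thesis by linarith
qed

end


section \<open>Change of variables\<close>

text \<open>The change of variables formula is known for coordinates that are indexed by a well-ordered
  finite type.  The indices here come from an arbitrary finite type, so the coordinates are
  renamed by a bijection onto a copy of that type with an order pulled back from the natural numbers.\<close>

typedef 'n ordered_index = "UNIV :: 'n set" morphisms of_index to_index ..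

definition index_number :: "'n::finite \<Rightarrow> nat" where
  "index_number = (SOME f. inj f)"

lemma inj_index_number: "inj (index_number :: 'n::finite \<Rightarrow> nat)"
proof -
  have "\<exists>f :: 'n \<Rightarrow> nat. inj f"
    using finite_imp_inj_to_nat_seg[of "UNIV :: 'n set"] by auto
  then show ?thesis unfolding index_number_def by (rule someI_ex)
qed

instance ordered_index :: (finite) finite
proof
  have "(UNIV :: 'a ordered_index set) = range to_index"
    by (metis of_index_inverse surjI)
  then show "finite (UNIV :: 'a ordered_index set)"
    by (metis finite finite_imageI)
qed

instantiation ordered_index :: (finite) wellorder
begin

definition "x \<le> y \<longleftrightarrow> index_number (of_index x) \<le> index_number (of_index y)"
definition "x < y \<longleftrightarrow> index_number (of_index x) < index_number (of_index y)"

instance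
proof
  fix x y :: "'a ordered_index"
  assume "x \<le> y" "y \<le> x"
  then show "x = y"
    by (simp add: less_eq_ordered_index_def inj_eq[OF inj_index_number] of_index_inject)
next
  fix P :: "'a ordered_index \<Rightarrow> bool" and a :: "'a ordered_index"
  assume step: "\<And>x. (\<And>y. y < x \<Longrightarrow> P y) \<Longrightarrow> P x"
  show "P a"
  proof (induction a rule: measure_induct_rule[where f="\<lambda>x. index_number (of_index x)"])
    case (less x)
    show ?case by (rule step, rule less.IH) (simp add: less_ordered_index_def)
  qed
qed (auto simp: less_eq_ordered_index_def less_ordered_index_def)

end

lemma bij_of_index: "bij of_index"
  by (metis bijI' of_index_inject to_index_inverse UNIV_I)

definition reindex_vec :: "real^'n \<Rightarrow> real^('n::finite ordered_index)" where
  "reindex_vec x = (\<chi> i. x $ of_index i)"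

definition unindex_vec :: "real^('n::finite ordered_index) \<Rightarrow> real^'n" where
  "unindex_vec y = (\<chi> i. y $ to_index i)"

lemma unindex_reindex [simp]: "unindex_vec (reindex_vec x) = x"
  by (simp add: unindex_vec_def reindex_vec_def to_index_inverse)

lemma reindex_unindex [simp]: "reindex_vec (unindex_vec y) = y"
  by (simp add: unindex_vec_def reindex_vec_def of_index_inverse)

lemma bounded_linear_reindex: "bounded_linear reindex_vec"
  unfolding linear_conv_bounded_linear[symmetric]
  by (intro linearI) (simp_all add: reindex_vec_def vec_eq_iff)

lemma bounded_linear_unindex: "bounded_linear unindex_vec"
  unfolding linear_conv_bounded_linear[symmetric]
  by (intro linearI) (simp_all add: unindex_vec_def vec_eq_iff)

lemma measurable_reindex [measurable]: "reindex_vec \<in> borel_measurable borel"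
  by (intro borel_measurable_continuous_onI linear_continuous_on bounded_linear_reindex)

lemma measurable_unindex [measurable]: "unindex_vec \<in> borel_measurable borel"
  by (intro borel_measurable_continuous_onI linear_continuous_on bounded_linear_unindex)

lemma reindex_image: "reindex_vec ` B = unindex_vec -` B"
  by (auto simp: image_iff) (metis reindex_unindex)

lemma Basis_vec_range: "(Basis :: (real^'n) set) = range (\<lambda>i. axis i 1)"
  by (auto simp: Basis_vec_def)

lemma Basis_vecE: "b \<in> (Basis :: (real^'n) set) \<Longrightarrow> (\<And>i. b = axis i 1 \<Longrightarrow> P) \<Longrightarrow> P"
  by (auto simp: Basis_vec_range)

lemma prod_Basis_vec: "(\<Prod>b\<in>(Basis :: (real^'n) set). h b) = (\<Prod>i\<in>UNIV. h (axis i 1))"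
  unfolding Basis_vec_range by (subst prod.reindex) (auto simp: inj_on_def axis_eq_axis)

lemma lborel_distr_reindex: "distr lborel borel reindex_vec = (lborel :: (real^('n::finite ordered_index)) measure)"
proof (rule lborel_eqI[symmetric])
  fix l u :: "real^('n ordered_index)"
  assume le: "\<And>b. b \<in> Basis \<Longrightarrow> l \<bullet> b \<le> u \<bullet> b"
  then have le': "l $ i \<le> u $ i" for i
    using le[of "axis i 1"] by (simp add: inner_axis)
  have *: "reindex_vec -` box l u = box (unindex_vec l) (unindex_vec u)"
    by (auto simp: mem_box_cart reindex_vec_def unindex_vec_def)
       (metis of_index_inverse to_index_inverse UNIV_I)+
  have "emeasure (distr lborel borel reindex_vec) (box l u) = emeasure lborel (box (unindex_vec l) (unindex_vec u))"
    by (simp add: emeasure_distr * space_borel)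
  also have "\<dots> = (\<Prod>i\<in>UNIV. (u - l) $ to_index i)"
    using le' by (subst emeasure_lborel_box) (auto simp: prod_Basis_vec inner_axis unindex_vec_def
        elim!: Basis_vecE)
  also have "\<dots> = (\<Prod>j\<in>UNIV. (u - l) $ j)"
    using prod.reindex_bij_betw[OF bij_of_index, of "\<lambda>i. (u - l) $ to_index i"]
    by (simp add: of_index_inverse)
  also have "\<dots> = (\<Prod>b\<in>Basis. (u - l) \<bullet> b)"
    by (simp add: prod_Basis_vec inner_axis)
  finally show "emeasure (distr lborel borel reindex_vec) (box l u) = (\<Prod>b\<in>Basis. (u - l) \<bullet> b)" .
qed simp

text \<open>Conjugation turns transpositions into transpositions, so it preserves the number of
  transpositions in a factorisation.\<close>

lemma sign_conjugate:
  fixes \<tau> :: "'m::finite \<Rightarrow> 'n::finite"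
  assumes "bij \<tau>" "p permutes UNIV"
  shows "sign (inv \<tau> \<circ> p \<circ> \<tau>) = sign p \<and> permutation (inv \<tau> \<circ> p \<circ> \<tau>)"
  using assms(2) finite_class.finite_UNIV
proof (induction p rule: permutes_induct)
  case id
  then show ?case using assms(1) by (simp add: bij_is_inj permutation_id sign_id)
next
  case (swap a b p)
  have tr: "inv \<tau> \<circ> (Transposition.transpose a b \<circ> p) \<circ> \<tau>
      = Transposition.transpose (inv \<tau> a) (inv \<tau> b) \<circ> (inv \<tau> \<circ> p \<circ> \<tau>)"
    using assms(1)
    by (auto simp: fun_eq_iff Transposition.transpose_def bij_is_surj surj_f_inv_f bij_is_inj inv_f_f
        dest: arg_cong[where f=\<tau>])
  have ne: "inv \<tau> a \<noteq> inv \<tau> b" using swap.hyps assms(1)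
    by (metis bij_inv_eq_iff)
  have "permutation p" using swap.hyps by (simp add: permutation_permutes) (use finite_class.finite_UNIV in blast)
  define q where "q = inv \<tau> \<circ> p \<circ> \<tau>"
  have q: "sign q = sign p" "permutation q" using swap.IH unfolding q_def by blast+
  have "sign (Transposition.transpose (inv \<tau> a) (inv \<tau> b) \<circ> q) = sign (Transposition.transpose a b \<circ> p)"
    unfolding sign_compose[OF permutation_swap_id q(2)] sign_compose[OF permutation_swap_id \<open>permutation p\<close>]
    by (simp only: sign_swap_id ne swap.hyps q(1) if_False)
  then show ?case
    unfolding tr q_def[symmetric] using permutation_compose[OF permutation_swap_id q(2)] by blast
qed

lemma det_reindex:
  fixes A :: "real^'n^'n"
  shows "det (\<chi> i j. A $ of_index i $ of_index j) = det A"
proof -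
  let ?c = "\<lambda>p. inv of_index \<circ> p \<circ> of_index"
  have inv: "inv of_index x = to_index x" for x :: 'n
    by (metis bij_inv_eq_iff bij_of_index to_index_inverse UNIV_I)
  have "det A = (\<Sum>p | p permutes UNIV. of_int (sign p) * (\<Prod>i\<in>UNIV. A $ i $ p i))"
    by (simp add: det_def)
  also have "\<dots> = (\<Sum>p | p permutes (UNIV :: 'n ordered_index set). of_int (sign p) *
      (\<Prod>i\<in>UNIV. A $ of_index i $ of_index (p i)))"
  proof (rule sum.reindex_bij_witness[where i="\<lambda>q. of_index \<circ> q \<circ> inv of_index" and j="?c"])
    fix p :: "'n \<Rightarrow> 'n" assume "p \<in> {p. p permutes UNIV}"
    then have p: "p permutes UNIV" by simp
    show "of_index \<circ> ?c p \<circ> inv of_index = p"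
      by (simp add: fun_eq_iff inv to_index_inverse)
    have "bij (?c p)" using p bij_of_index by (intro bij_comp bij_imp_bij_inv) (auto simp: permutes_bij)
    then show "?c p \<in> {p. p permutes UNIV}" by (auto intro: bij_imp_permutes)
    have "(\<Prod>i\<in>UNIV. A $ of_index i $ of_index (?c p i)) = (\<Prod>i\<in>UNIV. A $ i $ p i)"
      using prod.reindex_bij_betw[OF bij_of_index, of "\<lambda>i. A $ i $ p i"]
      by (simp add: inv to_index_inverse)
    then show "of_int (sign (?c p)) * (\<Prod>i\<in>UNIV. A $ of_index i $ of_index (?c p i))
        = of_int (sign p) * (\<Prod>i\<in>UNIV. A $ i $ p i)"
      using sign_conjugate[OF bij_of_index p] by simp
  next
    fix q :: "'n ordered_index \<Rightarrow> 'n ordered_index" assume "q \<in> {p. p permutes UNIV}"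
    then have q: "q permutes UNIV" by simp
    show "?c (of_index \<circ> q \<circ> inv of_index) = q"
      by (simp add: fun_eq_iff inv of_index_inverse)
    have "bij (of_index \<circ> q \<circ> inv of_index)"
      using q bij_of_index by (intro bij_comp bij_imp_bij_inv) (auto simp: permutes_bij)
    then show "of_index \<circ> q \<circ> inv of_index \<in> {p. p permutes UNIV}" by (auto intro: bij_imp_permutes)
  qed
  finally show ?thesis by (simp add: det_def)
qed

text \<open>The formula for the Lebesgue measure of an image concerns images of finite measure.  If
  \<open>\<bar>det g'\<bar>\<close> is not integrable on \<open>S\<close>, the image has infinite measure, and the right-hand side is
  infinite as well.\<close>

lemma emeasure_image_wellorder:
  fixes g :: "real^'n::{finite,wellorder} \<Rightarrow> real^'n::_"
  assumes S: "S \<in> sets borel" and gS: "g ` S \<in> sets borel" and inj: "inj_on g S"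
    and der: "\<And>x. x \<in> S \<Longrightarrow> (g has_derivative g' x) (at x)"
    and meas: "(\<lambda>x. indicator S x * \<bar>det (matrix (g' x))\<bar>) \<in> borel_measurable borel"
  shows "emeasure lborel (g ` S) = (\<integral>\<^sup>+x\<in>S. ennreal \<bar>det (matrix (g' x))\<bar> \<partial>lborel)"
proof -
  let ?D = "\<lambda>x. \<bar>det (matrix (g' x))\<bar>"
  have Sl: "S \<in> sets lebesgue" using S by auto
  have der': "\<And>x. x \<in> S \<Longrightarrow> (g has_derivative g' x) (at x within S)"
    using der has_derivative_at_withinI by blast
  have em: "emeasure lborel (g ` S) = emeasure lebesgue (g ` S)"
    using gS by simp
  show ?thesis
  proof (cases "?D integrable_on S")
    case True
    then obtain m where m: "(?D has_integral m) S" by (auto simp: integrable_on_def)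
    then have "g ` S \<in> lmeasurable \<and> measure lebesgue (g ` S) = m"
      using has_measure_differentiable_image[OF Sl der' inj] by blast
    then have "emeasure lebesgue (g ` S) = ennreal m"
      by (metis emeasure_eq_measure2)
    moreover have "(\<integral>\<^sup>+x\<in>S. ennreal (?D x) \<partial>lborel) = ennreal m"
      by (rule nn_integral_has_integral_lebesgue'[OF _ m]) simp
    ultimately show ?thesis using em by simp
  next
    case False
    have "g ` S \<notin> lmeasurable"
      using False measurable_differentiable_image_eq[OF Sl der' inj] by blast
    then have "emeasure lebesgue (g ` S) = \<infinity>"
      using gS by (metis fmeasurableI infinity_ennreal_def less_top lborelD sets_completionI_sets sets_lborel)
    moreover have "(\<integral>\<^sup>+x\<in>S. ennreal (?D x) \<partial>lborel) = \<infinity>"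
    proof (rule ccontr)
      assume "\<not> ?thesis"
      moreover have "(\<integral>\<^sup>+x\<in>S. ennreal (?D x) \<partial>lborel) = (\<integral>\<^sup>+x. ennreal (indicator S x * ?D x) \<partial>lborel)"
        by (intro nn_integral_cong) (auto simp: indicator_def)
      ultimately have "(\<lambda>x. indicator S x * ?D x) integrable_on UNIV"
        by (intro nn_integral_integrable_on meas) (auto simp: less_top)
      moreover have "(\<lambda>x. indicator S x * ?D x) = (\<lambda>x. if x \<in> S then ?D x else 0)"
        by (auto simp: fun_eq_iff indicator_def)
      ultimately show False using False integrable_restrict_UNIV[of S ?D] by simp
    qed
    ultimately show ?thesis using em by simp
  qed
qed


lemma emeasure_reindex_image:
  assumes "B \<in> sets borel"
  shows "emeasure lborel (reindex_vec ` B) = emeasure lborel B"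
proof -
  have m: "unindex_vec -` B \<in> sets borel"
    using measurable_sets[OF measurable_unindex assms] by simp
  have "emeasure lborel (reindex_vec ` B) = emeasure (distr lborel borel reindex_vec) (unindex_vec -` B)"
    by (simp add: lborel_distr_reindex reindex_image)
  also have "\<dots> = emeasure lborel (reindex_vec -` (unindex_vec -` B))"
    using m by (simp add: emeasure_distr)
  also have "reindex_vec -` (unindex_vec -` B) = B" by (simp add: vimage_def)
  finally show ?thesis .
qed

theorem emeasure_differentiable_image:
  fixes g :: "real^'n \<Rightarrow> real^'n"
  assumes S: "S \<in> sets borel" and gS: "g ` S \<in> sets borel" and inj: "inj_on g S"
    and der: "\<And>x. x \<in> S \<Longrightarrow> (g has_derivative g' x) (at x)"
    and meas: "(\<lambda>x. indicator S x * \<bar>det (matrix (g' x))\<bar>) \<in> borel_measurable borel"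
  shows "emeasure lborel (g ` S) = (\<integral>\<^sup>+x\<in>S. ennreal \<bar>det (matrix (g' x))\<bar> \<partial>lborel)"
proof -
  define h where "h = reindex_vec \<circ> g \<circ> unindex_vec"
  define h' where "h' y = reindex_vec \<circ> g' (unindex_vec y) \<circ> unindex_vec" for y
  have mem: "y \<in> reindex_vec ` S \<longleftrightarrow> unindex_vec y \<in> S" for y by (simp add: reindex_image)
  have det: "det (matrix (h' y)) = det (matrix (g' (unindex_vec y)))" for y
  proof -
    have "unindex_vec (axis j 1) = axis (of_index j) (1::real)" for j :: "'n ordered_index"
      by (auto simp: unindex_vec_def vec_eq_iff axis_def of_index_inverse to_index_inverse)
    then have "matrix (h' y) = (\<chi> i j. matrix (g' (unindex_vec y)) $ of_index i $ of_index j)"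
      by (simp add: matrix_def h'_def reindex_vec_def)
    then show ?thesis by (simp add: det_reindex)
  qed
  have img: "h ` (reindex_vec ` S) = reindex_vec ` (g ` S)"
    by (simp add: h_def image_comp comp_def)
  have "emeasure lborel (g ` S) = emeasure lborel (h ` (reindex_vec ` S))"
    unfolding img by (rule emeasure_reindex_image[OF gS, symmetric])
  also have "\<dots> = (\<integral>\<^sup>+y\<in>reindex_vec ` S. ennreal \<bar>det (matrix (h' y))\<bar> \<partial>lborel)"
  proof (rule emeasure_image_wellorder)
    show "reindex_vec ` S \<in> sets borel"
      using measurable_sets[OF measurable_unindex S] by (simp add: reindex_image)
    show "h ` (reindex_vec ` S) \<in> sets borel"
      unfolding img reindex_image[of "g ` S"] using measurable_sets[OF measurable_unindex gS] by simp
    show "inj_on h (reindex_vec ` S)"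
    proof (rule inj_onI)
      fix x y assume "x \<in> reindex_vec ` S" "y \<in> reindex_vec ` S" "h x = h y"
      then have "unindex_vec x = unindex_vec y"
        using inj_onD[OF inj] mem unfolding h_def comp_def by (metis unindex_reindex)
      then show "x = y" by (metis reindex_unindex)
    qed
    fix y assume "y \<in> reindex_vec ` S"
    then have 1: "(g has_derivative g' (unindex_vec y)) (at (unindex_vec y))"
      using der mem by blast
    have 2: "(unindex_vec has_derivative unindex_vec) (at y)"
      by (rule bounded_linear_imp_has_derivative[OF bounded_linear_unindex])
    show "(h has_derivative h' y) (at y)"
      using bounded_linear.has_derivative[OF bounded_linear_reindex has_derivative_compose[OF 2 1]]
      by (simp only: h_def h'_def comp_def)
  next
    have "(\<lambda>y. indicator S (unindex_vec y) * \<bar>det (matrix (g' (unindex_vec y)))\<bar>) \<in> borel_measurable borel"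
      using measurable_compose[OF measurable_unindex meas] .
    then show "(\<lambda>x. indicator (reindex_vec ` S) x * \<bar>det (matrix (h' x))\<bar>) \<in> borel_measurable borel"
      unfolding det by (simp add: indicator_def mem)
  qed
  also have "\<dots> = (\<integral>\<^sup>+y. (ennreal (indicator S (unindex_vec y) * \<bar>det (matrix (g' (unindex_vec y)))\<bar>))
      \<partial>distr lborel borel reindex_vec)"
    unfolding det lborel_distr_reindex by (intro nn_integral_cong) (auto simp: indicator_def mem)
  also have "\<dots> = (\<integral>\<^sup>+x. (ennreal (indicator S x * \<bar>det (matrix (g' x))\<bar>)) \<partial>lborel)"
    using measurable_compose[OF measurable_unindex meas] by (subst nn_integral_distr) auto
  also have "\<dots> = (\<integral>\<^sup>+x\<in>S. ennreal \<bar>det (matrix (g' x))\<bar> \<partial>lborel)"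
    by (intro nn_integral_cong) (auto simp: indicator_def)
  finally show ?thesis .
qed

text \<open>The measure of images of Borel subsets of \<open>U\<close> identifies Lebesgue measure on \<open>g ` U\<close> with the
  image under \<open>g\<close> of the measure with density \<open>\<bar>det g'\<bar>\<close> on \<open>U\<close>; integrals of arbitrary functions
  follow.\<close>

theorem nn_integral_change_of_variables:
  fixes g :: "real^'n \<Rightarrow> real^'n"
  assumes U: "open U" "open (g ` U)" and inj: "inj_on g U"
    and der: "\<And>x. x \<in> U \<Longrightarrow> (g has_derivative g' x) (at x)"
    and meas: "(\<lambda>x. indicator U x * \<bar>det (matrix (g' x))\<bar>) \<in> borel_measurable borel"
    and h: "h \<in> borel_measurable borel"
  shows "(\<integral>\<^sup>+y\<in>g ` U. h y \<partial>lborel) = (\<integral>\<^sup>+x\<in>U. ennreal \<bar>det (matrix (g' x))\<bar> * h (g x) \<partial>lborel)"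
proof -
  let ?D = "\<lambda>x. ennreal (indicator U x * \<bar>det (matrix (g' x))\<bar>)"
  \<comment> \<open>\<open>g\<close> may fail to be measurable outside \<open>U\<close>\<close>
  define G where "G x = (if x \<in> U then g x else 0)" for x
  have contg: "continuous_on U g"
    using der by (meson continuous_at_imp_continuous_on has_derivative_continuous)
  have G: "G \<in> borel_measurable borel"
    unfolding G_def[abs_def]
    by (rule borel_measurable_continuous_on_if[OF _ contg]) (use U in auto)
  have "density lborel (indicator (g ` U)) = distr (density lborel ?D) borel G"
  proof (rule measure_eqI)
    fix A assume "A \<in> sets (density lborel (indicator (g ` U)))"
    then have A: "A \<in> sets borel" by simp
    let ?B = "U \<inter> G -` A"
    have B: "?B \<in> sets borel" using U measurable_sets[OF G A] by auto
    have img: "g ` ?B = A \<inter> g ` U" by (auto simp: G_def)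
    have "emeasure (density lborel (indicator (g ` U))) A = emeasure lborel (g ` ?B)"
      using A U by (subst emeasure_density) (auto simp: img indicator_inter_arith[symmetric] Int_commute)
    also have "\<dots> = (\<integral>\<^sup>+x\<in>?B. ennreal \<bar>det (matrix (g' x))\<bar> \<partial>lborel)"
    proof (rule emeasure_differentiable_image[OF B])
      show "g ` ?B \<in> sets borel" unfolding img using A U by auto
      show "inj_on g ?B" using inj by (rule inj_on_subset) auto
      have "(\<lambda>x. indicator ?B x * \<bar>det (matrix (g' x))\<bar>)
          = (\<lambda>x. indicator (G -` A) x * (indicator U x * \<bar>det (matrix (g' x))\<bar>))"
        by (auto simp: indicator_def)
      then show "(\<lambda>x. indicator ?B x * \<bar>det (matrix (g' x))\<bar>) \<in> borel_measurable borel"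
        using measurable_sets[OF G A] by (simp add: borel_measurable_times borel_measurable_indicator meas)
    qed (use der in auto)
    also have "\<dots> = (\<integral>\<^sup>+x. ?D x * indicator (G -` A) x \<partial>lborel)"
      by (intro nn_integral_cong) (auto simp: indicator_def)
    also have "\<dots> = emeasure (distr (density lborel ?D) borel G) A"
      using A measurable_sets[OF G A] meas G by (simp add: emeasure_distr emeasure_density)
    finally show "emeasure (density lborel (indicator (g ` U))) A = emeasure (distr (density lborel ?D) borel G) A" .
  qed simp
  then have "(\<integral>\<^sup>+y. h y \<partial>density lborel (indicator (g ` U))) = (\<integral>\<^sup>+y. h y \<partial>distr (density lborel ?D) borel G)"
    by simp
  also have "\<dots> = (\<integral>\<^sup>+x. ?D x * h (G x) \<partial>lborel)"
    using meas G h by (simp add: nn_integral_distr nn_integral_density)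
  also have "\<dots> = (\<integral>\<^sup>+x\<in>U. ennreal \<bar>det (matrix (g' x))\<bar> * h (g x) \<partial>lborel)"
    by (intro nn_integral_cong) (auto simp: indicator_def G_def)
  also have "(\<integral>\<^sup>+y. h y \<partial>density lborel (indicator (g ` U))) = (\<integral>\<^sup>+y\<in>g ` U. h y \<partial>lborel)"
    using U h by (subst nn_integral_density) (auto simp: mult.commute)
  finally show ?thesis by simp
qed


section \<open>Charts and transition maps\<close>

lemma C1_on_compose_smooth:
  fixes \<tau> :: "real^'n \<Rightarrow> real^'m" and u :: "real^'m \<Rightarrow> real"
  assumes u: "C1_on T u" and \<tau>: "Ck_on 1 U \<tau>" and sub: "\<tau> ` U \<subseteq> T"
  shows "C1_on U (\<lambda>x. u (\<tau> x))"
proof (rule C1_onI[where D="\<lambda>x. \<chi> i. partial i \<tau> x \<bullet> differential u (\<tau> x)"])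
  fix x assume x: "x \<in> U"
  have d: "(\<tau> has_derivative (\<lambda>h. \<Sum>i\<in>UNIV. h $ i *\<^sub>R partial i \<tau> x)) (at x)"
    using \<tau> x by (intro has_derivative_partials) auto
  have "(u has_derivative (\<lambda>h. h \<bullet> differential u (\<tau> x))) (at (\<tau> x))"
    using C1_on_D[OF u] x sub by blast
  from has_derivative_compose[OF d this]
  show "((\<lambda>x. u (\<tau> x)) has_derivative (\<lambda>h. h \<bullet> (\<chi> i. partial i \<tau> x \<bullet> differential u (\<tau> x)))) (at x)"
    by (simp add: inner_sum_left inner_vec_def[of _ "vec_lambda _"])
next
  have "continuous_on U \<tau>" "\<And>i. continuous_on U (partial i \<tau>)"
    using Ck_on_continuous[OF \<tau>] \<tau> by auto
  then show "continuous_on U (\<lambda>x. \<chi> i. partial i \<tau> x \<bullet> differential u (\<tau> x))"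
    by (intro continuous_on_vec_lambda continuous_on_inner
        continuous_on_compose2[OF C1_on_differential[OF u]] sub)
qed

lemma matrix_inv_cancel:
  fixes M :: "real^'n^'n"
  shows "det M \<noteq> 0 \<Longrightarrow> matrix_inv M *v (M *v v) = v"
  by (simp add: matrix_vector_mul_assoc matrix_inv_both)

text \<open>The algebra behind the invariance of the inner product of two covectors: under a change of
  coordinates with Jacobian \<open>J\<close> covectors are multiplied by the transpose of \<open>J\<close>, and the matrix \<open>D\<close> of
  the metric becomes \<open>transpose J ** D ** J\<close>.  The vector \<open>y\<close> in the proof is the gradient in the new
  coordinates, and \<open>J *v y\<close> is the gradient in the old ones.\<close>

lemma inner_matrix_inv_congruence:
  fixes J D :: "real^'n^'n"
  assumes J: "det J \<noteq> 0" and D: "det D \<noteq> 0"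
  shows "(transpose J *v a) \<bullet> (matrix_inv (transpose J ** D ** J) *v (transpose J *v b))
    = a \<bullet> (matrix_inv D *v b)"
proof -
  let ?G = "transpose J ** D ** J"
  define y where "y = matrix_inv ?G *v (transpose J *v b)"
  have "det ?G \<noteq> 0" using J D by (simp add: det_mul det_transpose)
  then have "?G *v y = transpose J *v b"
    by (simp add: y_def matrix_vector_mul_assoc matrix_inv_both)
  then have "transpose J *v (D *v (J *v y)) = transpose J *v b"
    by (simp add: matrix_vector_mul_assoc matrix_mul_assoc)
  from arg_cong[OF this, of "\<lambda>v. matrix_inv (transpose J) *v v"] have "D *v (J *v y) = b"
    using J by (simp only: matrix_inv_cancel det_transpose not_False_eq_True)
  from arg_cong[OF this, of "\<lambda>v. matrix_inv D *v v"] have Jy: "J *v y = matrix_inv D *v b"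
    using D by (simp only: matrix_inv_cancel not_False_eq_True)
  have "(transpose J *v a) \<bullet> y = a \<bullet> (J *v y)"
    by (metis dot_lmul_matrix transpose_matrix_vector)
  then show ?thesis unfolding y_def[symmetric] Jy .
qed

locale compact_riemannian =
  fixes X :: "'a topology" and A :: "('a, 'n::finite) chart set"
    and g :: "('a, 'n) chart \<Rightarrow> real^'n \<Rightarrow> real^'n^'n"
  assumes compact_riemannian: "compact_riemannian_manifold X A g"
begin

lemma manifold: "smooth_manifold X A" and compact_X: "compact_space X"
  and metric: "riemannian_metric A g"
  using compact_riemannian by (auto simp: compact_riemannian_manifold_def)

lemma Hausdorff_X: "Hausdorff_space X"
  using manifold by (simp add: smooth_manifold_def)

lemma covered: "p \<in> topspace X \<Longrightarrow> \<exists>c\<in>A. p \<in> chart_dom c"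
  using manifold unfolding smooth_manifold_def by blast

lemma local_metric: "c \<in> A \<Longrightarrow> local_metric (chart_img c) (g c)"
  using metric manifold
  unfolding local_metric_def riemannian_metric_def smooth_two_tensor_def smooth_manifold_def
    is_chart_def positive_definite_def by blast

context
  fixes c assumes c: "c \<in> A"
begin

lemma chart: "is_chart X c"
  using manifold c by (simp add: smooth_manifold_def)

lemma openin_dom: "openin X (chart_dom c)" and open_img: "open (chart_img c)"
  and homeo: "homeomorphic_map (subtopology X (chart_dom c)) (top_of_set (chart_img c)) (chart_map c)"
  using chart by (auto simp: is_chart_def)

lemma dom_topspace: "p \<in> chart_dom c \<Longrightarrow> p \<in> topspace X"
  using openin_dom openin_subset by blast

lemma inj_chart: "inj_on (chart_map c) (chart_dom c)"
  using homeo dom_topspace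
  by (auto simp: homeomorphic_eq_everything_map topspace_subtopology inf_absorb2 subset_iff inj_on_def)

lemma chart_inv_map: "p \<in> chart_dom c \<Longrightarrow> chart_inv c (chart_map c p) = p"
  unfolding chart_inv_def by (rule inv_into_f_f[OF inj_chart])

lemma chart_map_img: "p \<in> chart_dom c \<Longrightarrow> chart_map c p \<in> chart_img c"
  by (simp add: chart_img_def)

lemma chart_map_inv: "x \<in> chart_img c \<Longrightarrow> chart_map c (chart_inv c x) = x"
  unfolding chart_inv_def chart_img_def by (rule f_inv_into_f)

lemma chart_inv_dom: "x \<in> chart_img c \<Longrightarrow> chart_inv c x \<in> chart_dom c"
  unfolding chart_inv_def chart_img_def by (rule inv_into_into)

lemma image_chart_map: "B \<subseteq> chart_dom c \<Longrightarrow> chart_map c ` B = {x \<in> chart_img c. chart_inv c x \<in> B}"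
  using chart_inv_map chart_map_img chart_map_inv chart_inv_dom by (force simp: image_iff)

lemma image_chart_inv: "V \<subseteq> chart_img c \<Longrightarrow> chart_inv c ` V = {p \<in> chart_dom c. chart_map c p \<in> V}"
  using chart_inv_map chart_map_img chart_map_inv chart_inv_dom by (force simp: image_iff)

lemma open_chart_image:
  assumes "openin X W"
  shows "open (chart_map c ` (W \<inter> chart_dom c))"
proof -
  have "openin (subtopology X (chart_dom c)) (W \<inter> chart_dom c)"
    using assms by (auto simp: openin_subtopology)
  then have "openin (top_of_set (chart_img c)) (chart_map c ` (W \<inter> chart_dom c))"
    using homeo by (auto simp: homeomorphic_eq_everything_map open_map_def)
  then show ?thesis using open_img openin_open_eq by blast
qed

lemma openin_chart_inv_image:
  assumes "open V" "V \<subseteq> chart_img c"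
  shows "openin X (chart_inv c ` V)"
proof -
  have "continuous_map (subtopology X (chart_dom c)) (top_of_set (chart_img c)) (chart_map c)"
    using homeo homeomorphic_imp_continuous_map by blast
  moreover have "openin (top_of_set (chart_img c)) V"
    using assms open_img openin_open_eq by blast
  ultimately have "openin (subtopology X (chart_dom c))
      {p \<in> topspace (subtopology X (chart_dom c)). chart_map c p \<in> V}"
    by (rule openin_continuous_map_preimage)
  moreover have "{p \<in> topspace (subtopology X (chart_dom c)). chart_map c p \<in> V} = chart_inv c ` V"
    using dom_topspace by (auto simp: image_chart_inv[OF assms(2)])
  ultimately show ?thesis using openin_trans_full[OF _ openin_dom] by simp
qed

lemma continuous_chart_inv:
  "continuous_map (top_of_set (chart_img c)) X (chart_inv c)"
  unfolding continuous_map_def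
proof safe
  fix W assume "openin X W"
  then have "open (chart_map c ` (W \<inter> chart_dom c))" by (rule open_chart_image)
  moreover have "chart_map c ` (W \<inter> chart_dom c)
      = {x \<in> topspace (top_of_set (chart_img c)). chart_inv c x \<in> W}"
    using chart_inv_dom by (subst image_chart_map) auto
  ultimately show "openin (top_of_set (chart_img c)) {x \<in> topspace (top_of_set (chart_img c)). chart_inv c x \<in> W}"
    using openin_open_eq[OF open_img] by auto
qed (use chart_inv_dom dom_topspace in auto)

lemma closedin_chart_inv_image:
  assumes "compact K" "K \<subseteq> chart_img c"
  shows "closedin X (chart_inv c ` K)"
proof -
  have "compactin (top_of_set (chart_img c)) K"
    using assms by (simp add: compactin_subtopology)
  then have "compactin X (chart_inv c ` K)"
    using image_compactin continuous_chart_inv by blast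
  then show ?thesis using Hausdorff_X compactin_imp_closedin by blast
qed

end

definition overlap :: "('a, 'n) chart \<Rightarrow> ('a, 'n) chart \<Rightarrow> (real^'n) set" where
  "overlap c d = chart_map c ` (chart_dom c \<inter> chart_dom d)"

context
  fixes c d assumes c: "c \<in> A" and d: "d \<in> A"
begin

lemma open_overlap: "open (overlap c d)"
  unfolding overlap_def using open_chart_image[OF c openin_dom[OF d]] by (simp add: Int_commute)

lemma overlap_img: "overlap c d \<subseteq> chart_img c"
  by (auto simp: overlap_def chart_img_def)

lemma mem_overlap: "p \<in> chart_dom c \<Longrightarrow> p \<in> chart_dom d \<Longrightarrow> chart_map c p \<in> overlap c d"
  by (auto simp: overlap_def)

lemma transition_map: "p \<in> chart_dom c \<Longrightarrow> transition c d (chart_map c p) = chart_map d p"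
  by (simp add: transition_def chart_inv_map[OF c])

lemma overlapE:
  assumes "x \<in> overlap c d"
  obtains p where "p \<in> chart_dom c" "p \<in> chart_dom d" "x = chart_map c p"
    "chart_inv c x = p" "transition c d x = chart_map d p" "transition c d x \<in> overlap d c"
  using assms chart_inv_map[OF c] transition_map by (auto simp: overlap_def)

lemma transition_image: "transition c d ` overlap c d = overlap d c"
  unfolding overlap_def by (force simp: transition_map image_iff)

lemma smooth_transition: "smooth_on (overlap c d) (transition c d)"
  using manifold c d by (simp add: smooth_manifold_def overlap_def)

lemma inj_transition: "inj_on (transition c d) (overlap c d)"
  by (rule inj_onI) (metis overlapE chart_inv_map[OF d])

lemma transition_has_derivative:
  assumes "x \<in> overlap c d"
  shows "(transition c d has_derivative (\<lambda>h. jacobian (transition c d) (at x) *v h)) (at x)"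
  using smooth_on_differentiable[OF smooth_transition assms] jacobian_works by blast

lemma inv_eq_transition:
  assumes "x \<in> overlap c d"
  shows "h (chart_inv c x) = (h \<circ> chart_inv d) (transition c d x)"
  using assms by (metis overlapE chart_inv_map[OF d] comp_apply)

lemma metric_transition:
  assumes "x \<in> overlap c d"
  shows "g c x = transpose (jacobian (transition c d) (at x)) ** g d (transition c d x)
      ** jacobian (transition c d) (at x)"
proof -
  obtain p where p: "p \<in> chart_dom c \<inter> chart_dom d" "x = chart_map c p"
    "transition c d x = chart_map d p" using assms by (auto elim: overlapE)
  have "smooth_two_tensor A g" using metric by (simp add: riemannian_metric_def)
  then show ?thesis using p c d unfolding smooth_two_tensor_def Let_def by metis
qed

lemma det_jacobian_nz:
  assumes "x \<in> overlap c d"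
  shows "det (jacobian (transition c d) (at x)) \<noteq> 0"
proof
  assume "det (jacobian (transition c d) (at x)) = 0"
  then have "det (g c x) = 0" using metric_transition[OF assms] by (simp add: det_mul)
  then show False
    using local_metric.det_nz[OF local_metric[OF c]] assms overlap_img by blast
qed

lemma density_transition:
  assumes "x \<in> overlap c d"
  shows "volume_density (g c) x = \<bar>det (jacobian (transition c d) (at x))\<bar> *
    volume_density (g d) (transition c d x)"
  unfolding volume_density_def metric_transition[OF assms]
  by (simp add: det_mul det_transpose real_sqrt_mult)

lemma differential_transition:
  fixes h :: "'a \<Rightarrow> real"
  assumes h: "(h \<circ> chart_inv d) differentiable (at (transition c d x))" and x: "x \<in> overlap c d"
  shows "differential (h \<circ> chart_inv c) x
    = transpose (jacobian (transition c d) (at x)) *v differential (h \<circ> chart_inv d) (transition c d x)"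
proof -
  let ?J = "jacobian (transition c d) (at x)" and ?w = "differential (h \<circ> chart_inv d) (transition c d x)"
  have "((\<lambda>y. (h \<circ> chart_inv d) (transition c d y)) has_derivative (\<lambda>v. (?J *v v) \<bullet> ?w)) (at x)"
    using has_derivative_compose[OF transition_has_derivative[OF x] has_derivative_differential[OF h]] .
  moreover have "(?J *v v) \<bullet> ?w = v \<bullet> (transpose ?J *v ?w)" for v
    by (metis dot_lmul_matrix inner_commute transpose_matrix_vector)
  ultimately have "differential (\<lambda>y. (h \<circ> chart_inv d) (transition c d y)) x = transpose ?J *v ?w"
    by (intro differential_eqI) simp
  moreover have "differential (h \<circ> chart_inv c) x = differential (\<lambda>y. (h \<circ> chart_inv d) (transition c d y)) x"
    by (rule differential_cong[OF open_overlap x]) (simp add: inv_eq_transition)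
  ultimately show ?thesis by simp
qed

end

text \<open>This is \<open>g\<inverse>(dh, du)\<close>, the integrand of the Dirichlet form.\<close>

definition inner_differentials :: "('a, 'n) chart \<Rightarrow> ('a \<Rightarrow> real) \<Rightarrow> ('a \<Rightarrow> real) \<Rightarrow> real^'n \<Rightarrow> real" where
  "inner_differentials c h u x =
     differential (h \<circ> chart_inv c) x \<bullet> gradient (g c) (u \<circ> chart_inv c) x"

lemma inner_differentials_transition:
  assumes c: "c \<in> A" and d: "d \<in> A" and x: "x \<in> overlap c d"
    and h: "(h \<circ> chart_inv d) differentiable (at (transition c d x))"
    and u: "(u \<circ> chart_inv d) differentiable (at (transition c d x))"
  shows "inner_differentials c h u x = inner_differentials d h u (transition c d x)"
proof -
  have "transition c d x \<in> chart_img d"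
    using transition_image[OF c d] overlap_img[OF d c] x by blast
  then have "det (g d (transition c d x)) \<noteq> 0"
    using local_metric.det_nz[OF local_metric[OF d]] by blast
  then show ?thesis
    unfolding inner_differentials_def gradient_def metric_transition[OF c d x]
      differential_transition[OF c d h x] differential_transition[OF c d u x]
    by (rule inner_matrix_inv_congruence[OF det_jacobian_nz[OF c d x]])
qed

text \<open>Partitions of unity enter only through their first derivatives, so \<open>C\<^sup>1\<close> regularity suffices
  for them, and it allows bump functions that are given by an explicit formula.\<close>

definition C1_function :: "('a \<Rightarrow> real) \<Rightarrow> bool" where
  "C1_function h \<longleftrightarrow> (\<forall>c\<in>A. C1_on (chart_img c) (h \<circ> chart_inv c))"

lemma smooth_function_C1: "smooth_function A h \<Longrightarrow> C1_function h"
  unfolding smooth_function_def C1_function_def using smooth_on_C1 open_img by blast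

lemma C1_function_differentiable:
  "C1_function h \<Longrightarrow> c \<in> A \<Longrightarrow> x \<in> chart_img c \<Longrightarrow> (h \<circ> chart_inv c) differentiable (at x)"
  unfolding C1_function_def using C1_on_differentiable by blast

end


section \<open>The Riemannian measure\<close>

context compact_riemannian
begin

text \<open>The Borel sets of \<open>X\<close>, which is a topology on a subset of a type rather than an instance of the
  class of topological spaces.\<close>

definition borel_X :: "'a measure" where
  "borel_X = sigma (topspace X) {U. openin X U}"

lemma opens_Pow: "{U. openin X U} \<subseteq> Pow (topspace X)"
  using openin_subset by auto

lemma space_borel_X [simp]: "space borel_X = topspace X"
  by (simp add: borel_X_def space_measure_of[OF opens_Pow])

lemma sets_borel_X: "sets borel_X = sigma_sets (topspace X) {U. openin X U}"
  by (simp add: borel_X_def sets_measure_of[OF opens_Pow])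

lemma openin_sets: "openin X U \<Longrightarrow> U \<in> sets borel_X"
  by (simp add: sets_borel_X)

lemma dom_sets: "c \<in> A \<Longrightarrow> chart_dom c \<in> sets borel_X"
  using openin_sets openin_dom by blast

lemma img_sets: "c \<in> A \<Longrightarrow> chart_img c \<in> sets borel"
  using open_img by (simp add: borel_open)

lemma measurable_chart_inv:
  assumes c: "c \<in> A"
  shows "chart_inv c \<in> restrict_space lborel (chart_img c) \<rightarrow>\<^sub>M borel_X"
  unfolding borel_X_def
proof (rule measurable_measure_of[OF opens_Pow])
  show "chart_inv c \<in> space (restrict_space lborel (chart_img c)) \<rightarrow> topspace X"
    using chart_inv_dom[OF c] dom_topspace[OF c] by (auto simp: space_restrict_space)
  fix W assume "W \<in> {U. openin X U}"
  then have "open (chart_map c ` (W \<inter> chart_dom c))" using open_chart_image[OF c] by simp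
  moreover have "chart_map c ` (W \<inter> chart_dom c) = chart_inv c -` W \<inter> chart_img c"
    using chart_inv_dom[OF c] by (subst image_chart_map[OF c]) auto
  ultimately show "chart_inv c -` W \<inter> space (restrict_space lborel (chart_img c))
      \<in> sets (restrict_space lborel (chart_img c))"
    using img_sets[OF c] by (simp add: space_restrict_space sets_restrict_space_iff borel_open)
qed

lemma chart_image_sets:
  assumes c: "c \<in> A" and B: "B \<in> sets borel_X"
  shows "chart_map c ` (B \<inter> chart_dom c) \<in> sets borel"
proof -
  have "chart_map c ` (B \<inter> chart_dom c) = chart_inv c -` B \<inter> space (restrict_space lborel (chart_img c))"
    using chart_inv_dom[OF c] by (subst image_chart_map[OF c]) (auto simp: space_restrict_space)
  also have "\<dots> \<in> sets (restrict_space lborel (chart_img c))"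
    using measurable_sets[OF measurable_chart_inv[OF c] B] .
  finally show ?thesis using img_sets[OF c] by (simp add: sets_restrict_space_iff)
qed

lemma measurable_continuous_chart:
  fixes F :: "real^'n \<Rightarrow> 'b::topological_space"
  assumes "continuous_on (chart_img c) F"
  shows "F \<in> borel_measurable (restrict_space lborel (chart_img c))"
  using borel_measurable_continuous_on_restrict[OF assms]
  by (simp cong: measurable_cong_sets sets_restrict_space_cong)

lemma continuous_density: "c \<in> A \<Longrightarrow> continuous_on (chart_img c) (volume_density (g c))"
  using C1_on_continuous local_metric.C1_density[OF local_metric] by blast

lemma measurable_density:
  "c \<in> A \<Longrightarrow> (\<lambda>x. ennreal (volume_density (g c) x)) \<in> borel_measurable (restrict_space lborel (chart_img c))"
  using measurable_continuous_chart[OF continuous_density] by measurable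

lemma density_pos: "c \<in> A \<Longrightarrow> x \<in> chart_img c \<Longrightarrow> volume_density (g c) x > 0"
  using local_metric.density_pos[OF local_metric] .

text \<open>The measure that the density of the metric induces on the domain of one chart, extended to all
  Borel sets of \<open>X\<close> by zero outside the domain.\<close>

definition chart_measure :: "('a, 'n) chart \<Rightarrow> 'a measure" where
  "chart_measure c = distr (density (restrict_space lborel (chart_img c))
      (\<lambda>x. ennreal (volume_density (g c) x))) borel_X (chart_inv c)"

lemma sets_chart_measure [simp]: "sets (chart_measure c) = sets borel_X"
  by (simp add: chart_measure_def)

lemma emeasure_chart_measure:
  assumes c: "c \<in> A" and B: "B \<in> sets borel_X"
  shows "emeasure (chart_measure c) B
    = (\<integral>\<^sup>+x\<in>chart_map c ` (B \<inter> chart_dom c). ennreal (volume_density (g c) x) \<partial>lborel)"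
proof -
  let ?R = "restrict_space lborel (chart_img c)" and ?d = "\<lambda>x. ennreal (volume_density (g c) x)"
  have mem: "x \<in> chart_map c ` (B \<inter> chart_dom c) \<longleftrightarrow> x \<in> chart_img c \<and> chart_inv c x \<in> B" for x
    using chart_inv_dom[OF c] by (subst image_chart_map[OF c]) auto
  have m: "chart_inv c -` B \<inter> space ?R \<in> sets ?R"
    using measurable_sets[OF measurable_chart_inv[OF c] B] .
  have m': "chart_inv c \<in> density ?R ?d \<rightarrow>\<^sub>M borel_X"
    using measurable_chart_inv[OF c] by simp
  have "emeasure (chart_measure c) B = emeasure (density ?R ?d) (chart_inv c -` B \<inter> space ?R)"
    unfolding chart_measure_def by (subst emeasure_distr[OF m' B]) simp
  also have "\<dots> = (\<integral>\<^sup>+x. ?d x * indicator (chart_inv c -` B \<inter> space ?R) x \<partial>?R)"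
    by (rule emeasure_density[OF measurable_density[OF c] m])
  also have "\<dots> = (\<integral>\<^sup>+x. ?d x * indicator (chart_inv c -` B \<inter> space ?R) x * indicator (chart_img c) x \<partial>lborel)"
    using img_sets[OF c] by (subst nn_integral_restrict_space) auto
  also have "\<dots> = (\<integral>\<^sup>+x\<in>chart_map c ` (B \<inter> chart_dom c). ?d x \<partial>lborel)"
    by (intro nn_integral_cong) (auto simp: mem indicator_def space_restrict_space)
  finally show ?thesis .
qed

text \<open>By the change of variables formula, and because \<open>sqrt (det g)\<close> picks up the factor
  \<open>\<bar>det J\<bar>\<close> under a transition map with Jacobian \<open>J\<close>.\<close>

lemma chart_measure_agree:
  assumes c: "c \<in> A" and d: "d \<in> A" and B: "B \<in> sets borel_X" "B \<subseteq> chart_dom c \<inter> chart_dom d"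
  shows "emeasure (chart_measure c) B = emeasure (chart_measure d) B"
proof -
  let ?\<tau> = "transition c d" and ?U = "overlap c d"
  let ?J = "\<lambda>x h. jacobian ?\<tau> (at x) *v h"
  define h where "h y = ennreal (indicator (chart_img d) y *\<^sub>R volume_density (g d) y) *
      indicator (chart_map d ` (B \<inter> chart_dom d)) y" for y
  have h: "h \<in> borel_measurable borel"
  proof -
    have "(\<lambda>y. indicator (chart_img d) y *\<^sub>R volume_density (g d) y) \<in> borel_measurable borel"
      by (rule borel_measurable_continuous_on_indicator[OF img_sets[OF d] continuous_density[OF d]])
    then show ?thesis unfolding h_def[abs_def]
      using chart_image_sets[OF d B(1)] by measurable
  qed
  have detJ: "det (matrix (?J x)) = det (jacobian ?\<tau> (at x))" for x
    by simp
  have entry: "jacobian ?\<tau> (at x) $ i $ j = partial j ?\<tau> x $ i" for x i j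
    by (simp add: jacobian_def matrix_def partial_def)
  have "continuous_on ?U (\<lambda>x. \<bar>det (jacobian ?\<tau> (at x))\<bar>)"
    unfolding det_def entry
    by (intro continuous_intros smooth_on_continuous smooth_on_partial smooth_transition[OF c d])
  then have "(\<lambda>x. indicator ?U x *\<^sub>R \<bar>det (jacobian ?\<tau> (at x))\<bar>) \<in> borel_measurable borel"
    using open_overlap[OF c d] by (intro borel_measurable_continuous_on_indicator) auto
  then have Jm: "(\<lambda>x. indicator ?U x * \<bar>det (matrix (?J x))\<bar>) \<in> borel_measurable borel"
    by (simp add: detJ)
  have in_d: "x \<in> chart_map d ` (B \<inter> chart_dom d) \<longleftrightarrow> x \<in> overlap d c \<and> chart_inv d x \<in> B" for x
    using B(2) chart_inv_map[OF d] by (force simp: overlap_def image_iff)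
  have in_c: "x \<in> chart_map c ` (B \<inter> chart_dom c) \<longleftrightarrow> x \<in> ?U \<and> chart_inv c x \<in> B" for x
    using B(2) chart_inv_map[OF c] by (force simp: overlap_def image_iff)
  have "emeasure (chart_measure d) B = (\<integral>\<^sup>+y\<in>?\<tau> ` ?U. h y \<partial>lborel)"
    unfolding emeasure_chart_measure[OF d B(1)] transition_image[OF c d]
    using overlap_img[OF d c]
    by (intro nn_integral_cong) (auto simp: h_def indicator_def in_d)
  also have "\<dots> = (\<integral>\<^sup>+x\<in>?U. ennreal \<bar>det (matrix (?J x))\<bar> * h (?\<tau> x) \<partial>lborel)"
    by (rule nn_integral_change_of_variables[OF open_overlap[OF c d] _ inj_transition[OF c d] _ Jm h])
       (use transition_has_derivative[OF c d] in \<open>auto simp: transition_image[OF c d] open_overlap[OF d c]\<close>)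
  also have "\<dots> = (\<integral>\<^sup>+x\<in>chart_map c ` (B \<inter> chart_dom c). ennreal (volume_density (g c) x) \<partial>lborel)"
  proof (rule nn_integral_cong)
    fix x
    show "ennreal \<bar>det (matrix (?J x))\<bar> * h (?\<tau> x) * indicator ?U x
      = ennreal (volume_density (g c) x) * indicator (chart_map c ` (B \<inter> chart_dom c)) x"
    proof (cases "x \<in> ?U")
      case True
      then have \<tau>x: "?\<tau> x \<in> overlap d c" "?\<tau> x \<in> chart_img d"
        using transition_image[OF c d] overlap_img[OF d c] by blast+
      have "chart_inv d (?\<tau> x) = chart_inv c x"
        using inv_eq_transition[OF c d True, of "\<lambda>p. p"] by simp
      then have "?\<tau> x \<in> chart_map d ` (B \<inter> chart_dom d) \<longleftrightarrow> x \<in> chart_map c ` (B \<inter> chart_dom c)"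
        using True \<tau>x in_d in_c by auto
      then show ?thesis
        using True \<tau>x density_transition[OF c d True]
        by (simp add: h_def detJ indicator_def ennreal_mult'[symmetric])
    qed (auto simp: in_c)
  qed
  also have "\<dots> = emeasure (chart_measure c) B" by (rule emeasure_chart_measure[OF c B(1), symmetric])
  finally show ?thesis ..
qed

lemma finite_atlas: "\<exists>F\<subseteq>A. finite F \<and> topspace X \<subseteq> \<Union> (chart_dom ` F)"
proof -
  have "\<forall>U\<in>chart_dom ` A. openin X U" using openin_dom by blast
  moreover have "topspace X \<subseteq> \<Union> (chart_dom ` A)" using covered by blast
  ultimately obtain \<F> where "finite \<F>" "\<F> \<subseteq> chart_dom ` A" "topspace X \<subseteq> \<Union> \<F>"
    using compact_X unfolding compact_space_alt by metis
  then show ?thesis by (metis finite_subset_image)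
qed

text \<open>Every point is assigned to the first chart of a finite atlas that contains it.  Any two
  measures that are known on subsets of chart domains can be compared, and compatible ones glued,
  piece by piece.\<close>

lemma Borel_pieces:
  obtains m :: nat and e :: "nat \<Rightarrow> ('a, 'n) chart" and D :: "nat \<Rightarrow> 'a set" where
    "\<And>i. i < m \<Longrightarrow> e i \<in> A" "\<And>i. i < m \<Longrightarrow> D i \<in> sets borel_X" "\<And>i. i < m \<Longrightarrow> D i \<subseteq> chart_dom (e i)"
    "disjoint_family_on D {..<m}" "(\<Union>i<m. D i) = topspace X"
proof -
  obtain F where F: "F \<subseteq> A" "finite F" "topspace X \<subseteq> \<Union> (chart_dom ` F)"
    using finite_atlas by blast
  obtain e where e: "bij_betw e {..<card F} F"
    using ex_bij_betw_nat_finite[OF F(2)] by (auto simp: atLeast0LessThan)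
  define D where "D i = chart_dom (e i) - (\<Union>j<i. chart_dom (e j))" for i
  have eA: "e i \<in> A" if "i < card F" for i
    using e F(1) that by (auto simp: bij_betw_def)
  have D1: "D i \<in> sets borel_X" if "i < card F" for i
  proof -
    have "chart_dom (e j) \<in> sets borel_X" if "j \<le> i" for j
      using dom_sets[OF eA] that \<open>i < card F\<close> by auto
    then show ?thesis unfolding D_def by (intro sets.Diff sets.finite_UN) auto
  qed
  have dis: "disjoint_family_on D {..<card F}"
    unfolding disjoint_family_on_def D_def by (auto simp: neq_iff)
  have "(\<Union>i<card F. D i) = topspace X"
  proof
    show "(\<Union>i<card F. D i) \<subseteq> topspace X"
      using dom_topspace eA unfolding D_def by blast
    show "topspace X \<subseteq> (\<Union>i<card F. D i)"
    proof
      fix p assume "p \<in> topspace X"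
      then obtain c where "c \<in> F" "p \<in> chart_dom c" using F(3) by blast
      then have ex: "\<exists>i. i < card F \<and> p \<in> chart_dom (e i)"
        using e unfolding bij_betw_def by (metis imageE lessThan_iff)
      define i where "i = (LEAST i. i < card F \<and> p \<in> chart_dom (e i))"
      have i: "i < card F" "p \<in> chart_dom (e i)" using LeastI_ex[OF ex] by (auto simp: i_def)
      have "p \<notin> chart_dom (e j)" if "j < i" for j
        using not_less_Least[of j "\<lambda>i. i < card F \<and> p \<in> chart_dom (e i)"] that i(1)
        by (auto simp: i_def)
      then show "p \<in> (\<Union>i<card F. D i)" using i unfolding D_def by auto
    qed
  qed
  then show ?thesis using that[of "card F" e D] eA D1 dis unfolding D_def by blast
qed

lemma is_riemannian_measure_iff:
  "is_riemannian_measure X A g \<mu> \<longleftrightarrow> sets \<mu> = sets borel_X \<and>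
    (\<forall>c\<in>A. \<forall>B\<in>sets borel_X. B \<subseteq> chart_dom c \<longrightarrow> emeasure \<mu> B = emeasure (chart_measure c) B)"
proof -
  have sp: "sets \<mu> = sets borel_X \<Longrightarrow> space \<mu> = topspace X"
    using sets_eq_imp_space_eq space_borel_X by metis
  have "emeasure (chart_measure c) B
      = (\<integral>\<^sup>+ x \<in> chart_map c ` B. ennreal (sqrt (det (g c x))) \<partial>lborel)"
    if "c \<in> A" "B \<in> sets borel_X" "B \<subseteq> chart_dom c" for c B
    using emeasure_chart_measure[OF that(1,2)] that(3) by (simp add: volume_density_def inf_absorb1)
  then show ?thesis
    unfolding is_riemannian_measure_def sets_borel_X[symmetric] using sp by auto
qed

lemma disjoint_family_on_Int: "disjoint_family_on D I \<Longrightarrow> disjoint_family_on (\<lambda>i. B \<inter> D i) I"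
  unfolding disjoint_family_on_def by blast

text \<open>Each piece is measured in the chart to which it is assigned; on subsets of the domain of another
  chart, that other chart gives the same measure of every piece.\<close>

lemma riemannian_measure_exists: "\<exists>\<mu>. is_riemannian_measure X A g \<mu>"
proof -
  obtain m e and D :: "nat \<Rightarrow> 'a set" where D:
    "\<And>i. i < m \<Longrightarrow> e i \<in> A" "\<And>i. i < m \<Longrightarrow> D i \<in> sets borel_X" "\<And>i. i < m \<Longrightarrow> D i \<subseteq> chart_dom (e i)"
    "disjoint_family_on D {..<m}" "(\<Union>i<m. D i) = topspace X"
    using Borel_pieces by blast
  define \<nu> where "\<nu> B = (\<Sum>i<m. emeasure (chart_measure (e i)) (B \<inter> D i))" for B
  define \<mu> where "\<mu> = measure_of (topspace X) (sets borel_X) \<nu>"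
  have sets: "sets \<mu> = sets borel_X"
    unfolding \<mu>_def by (metis sets.sets_measure_of_eq space_borel_X)
  have em: "emeasure \<mu> B = \<nu> B" if "B \<in> sets borel_X" for B
    unfolding \<mu>_def
  proof (rule emeasure_measure_of_sigma)
    show "sigma_algebra (topspace X) (sets borel_X)"
      by (metis sets.sigma_algebra_axioms space_borel_X)
    show "positive (sets borel_X) \<nu>" by (simp add: positive_def \<nu>_def)
    show "countably_additive (sets borel_X) \<nu>"
      unfolding countably_additive_def
    proof safe
      fix B :: "nat \<Rightarrow> 'a set"
      assume B: "range B \<subseteq> sets borel_X" "disjoint_family B" "\<Union> (range B) \<in> sets borel_X"
      have "(\<Sum>n. \<nu> (B n)) = (\<Sum>i<m. \<Sum>n. emeasure (chart_measure (e i)) (B n \<inter> D i))"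
        unfolding \<nu>_def by (rule suminf_sum) auto
      also have "\<dots> = (\<Sum>i<m. emeasure (chart_measure (e i)) (\<Union>n. B n \<inter> D i))"
        using B D(2) by (intro sum.cong suminf_emeasure) (auto simp: disjoint_family_on_def)
      also have "\<dots> = \<nu> (\<Union> (range B))" unfolding \<nu>_def by (simp add: Int_commute UN_simps)
      finally show "(\<Sum>n. \<nu> (B n)) = \<nu> (\<Union> (range B))" .
    qed
  qed (fact that)
  have "emeasure \<mu> B = emeasure (chart_measure c) B"
    if c: "c \<in> A" and B: "B \<in> sets borel_X" "B \<subseteq> chart_dom c" for c B
  proof -
    have "emeasure \<mu> B = (\<Sum>i<m. emeasure (chart_measure c) (B \<inter> D i))"
      unfolding em[OF B(1)] \<nu>_def
    proof (intro sum.cong chart_measure_agree c)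
      fix i assume "i \<in> {..<m}"
      then show "e i \<in> A" "B \<inter> D i \<in> sets borel_X" "B \<inter> D i \<subseteq> chart_dom (e i) \<inter> chart_dom c"
        using B D(1-3)[of i] by auto
    qed simp
    also have "\<dots> = emeasure (chart_measure c) (\<Union>i<m. B \<inter> D i)"
      using B(1) D(2) by (intro sum_emeasure disjoint_family_on_Int D(4)) auto
    also have "(\<Union>i<m. B \<inter> D i) = B"
      using D(5) sets.sets_into_space[OF B(1)] by auto
    finally show ?thesis .
  qed
  then show ?thesis using is_riemannian_measure_iff sets by blast
qed

lemma riemannian_measure_unique:
  assumes "is_riemannian_measure X A g \<mu>" "is_riemannian_measure X A g \<mu>'"
  shows "\<mu> = \<mu>'"
proof (rule measure_eqI)
  show "sets \<mu> = sets \<mu>'" using assms by (simp add: is_riemannian_measure_iff)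
  fix B assume "B \<in> sets \<mu>"
  then have B: "B \<in> sets borel_X" using assms(1) by (simp add: is_riemannian_measure_iff)
  obtain m e and D :: "nat \<Rightarrow> 'a set" where D:
    "\<And>i. i < m \<Longrightarrow> e i \<in> A" "\<And>i. i < m \<Longrightarrow> D i \<in> sets borel_X" "\<And>i. i < m \<Longrightarrow> D i \<subseteq> chart_dom (e i)"
    "disjoint_family_on D {..<m}" "(\<Union>i<m. D i) = topspace X"
    using Borel_pieces by blast
  have "emeasure \<rho> B = (\<Sum>i<m. emeasure (chart_measure (e i)) (B \<inter> D i))"
    if \<rho>: "is_riemannian_measure X A g \<rho>" for \<rho>
  proof -
    have "emeasure \<rho> B = emeasure \<rho> (\<Union>i<m. B \<inter> D i)"
      using D(5) sets.sets_into_space[OF B] by (intro arg_cong[where f="emeasure \<rho>"]) auto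
    also have "\<dots> = (\<Sum>i<m. emeasure \<rho> (B \<inter> D i))"
      using B D(2) \<rho> by (intro sum_emeasure[symmetric] disjoint_family_on_Int D(4))
        (auto simp: is_riemannian_measure_iff)
    also have "\<dots> = (\<Sum>i<m. emeasure (chart_measure (e i)) (B \<inter> D i))"
    proof (intro sum.cong)
      fix i assume "i \<in> {..<m}"
      then have "e i \<in> A" "B \<inter> D i \<in> sets borel_X" "B \<inter> D i \<subseteq> chart_dom (e i)"
        using B D(1-3)[of i] by auto
      then show "emeasure \<rho> (B \<inter> D i) = emeasure (chart_measure (e i)) (B \<inter> D i)"
        using \<rho> unfolding is_riemannian_measure_iff by blast
    qed simp
    finally show ?thesis .
  qed
  then show "emeasure \<mu> B = emeasure \<mu>' B" using assms by simp
qed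

abbreviation vol :: "'a measure" where "vol \<equiv> riemannian_measure X A g"

lemma is_riemannian_measure_vol: "is_riemannian_measure X A g vol"
  unfolding riemannian_measure_def
  using riemannian_measure_exists riemannian_measure_unique by (metis theI)

lemma sets_vol [simp]: "sets vol = sets borel_X"
  and emeasure_vol: "c \<in> A \<Longrightarrow> B \<in> sets borel_X \<Longrightarrow> B \<subseteq> chart_dom c \<Longrightarrow>
    emeasure vol B = emeasure (chart_measure c) B"
  using is_riemannian_measure_vol by (auto simp: is_riemannian_measure_iff)

lemma space_vol [simp]: "space vol = topspace X"
  using sets_eq_imp_space_eq[OF sets_vol] by simp

lemma emeasure_vol_open_pos:
  assumes "openin X W" "W \<noteq> {}"
  shows "emeasure vol W \<noteq> 0"
proof
  assume "emeasure vol W = 0"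
  obtain p where p: "p \<in> W" "p \<in> topspace X" using assms openin_subset by blast
  then obtain c where c: "c \<in> A" "p \<in> chart_dom c" using covered by blast
  let ?V = "chart_map c ` (W \<inter> chart_dom c)"
  have WW: "W \<inter> chart_dom c \<in> sets borel_X"
    using openin_sets assms(1) dom_sets[OF c(1)] by blast
  have V: "open ?V" "?V \<noteq> {}" "?V \<subseteq> chart_img c"
    using open_chart_image[OF c(1) assms(1)] p c by (auto simp: chart_img_def)
  have "emeasure vol (W \<inter> chart_dom c) = 0"
    using emeasure_mono[of "W \<inter> chart_dom c" W vol] openin_sets[OF assms(1)] \<open>emeasure vol W = 0\<close> by simp
  then have "(\<integral>\<^sup>+x\<in>?V. ennreal (volume_density (g c) x) \<partial>lborel) = 0"
    using emeasure_vol[OF c(1) WW] emeasure_chart_measure[OF c(1) WW] by (simp add: Int_assoc)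
  moreover have "(\<lambda>x. ennreal (indicator ?V x *\<^sub>R volume_density (g c) x)) \<in> borel_measurable lborel"
    using borel_measurable_continuous_on_indicator[OF _ continuous_on_subset[OF continuous_density[OF c(1)] V(3)]] V(1)
    by (simp add: borel_open)
  moreover have "(\<lambda>x. ennreal (volume_density (g c) x) * indicator ?V x)
      = (\<lambda>x. ennreal (indicator ?V x *\<^sub>R volume_density (g c) x))"
    by (auto simp: indicator_def)
  ultimately have "AE x in lborel. ennreal (indicator ?V x *\<^sub>R volume_density (g c) x) = 0"
    by (simp add: nn_integral_0_iff_AE)
  then have "AE x in lborel. x \<notin> ?V"
  proof (rule AE_mp, intro AE_I2 impI)
    fix x assume "ennreal (indicator ?V x *\<^sub>R volume_density (g c) x) = 0"
    then show "x \<notin> ?V" using density_pos[OF c(1), of x] V(3) by (auto simp: indicator_def ennreal_eq_0_iff)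
  qed
  then have "?V \<in> null_sets lborel"
    using V(1) by (subst AE_iff_null_sets) (auto simp: borel_open)
  then have "negligible ?V" using negligible_iff_null_sets null_sets_completionI by blast
  then show False using open_not_negligible V by blast
qed

section \<open>Integration in charts\<close>

text \<open>Extension by zero of a function of the coordinates, so that expressions that are only defined
  in a chart can be integrated over the manifold.\<close>

definition chart_fun :: "('a, 'n) chart \<Rightarrow> (real^'n \<Rightarrow> real) \<Rightarrow> 'a \<Rightarrow> real" where
  "chart_fun c F p = (if p \<in> chart_dom c then F (chart_map c p) else 0)"

lemma measurable_chart_fun:
  assumes c: "c \<in> A" and F: "continuous_on (chart_img c) F"
  shows "chart_fun c F \<in> borel_measurable vol"
proof (rule borel_measurableI)
  fix T :: "real set" assume T: "open T"
  let ?V = "{x \<in> chart_img c. F x \<in> T}"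
  have "open ?V" using continuous_open_preimage[OF F open_img[OF c] T] by (simp add: vimage_def Int_def)
  then have "openin X (chart_inv c ` ?V)" by (intro openin_chart_inv_image[OF c]) auto
  then have s: "chart_inv c ` ?V \<in> sets borel_X" by (rule openin_sets)
  have "chart_inv c ` ?V = {p \<in> chart_dom c. F (chart_map c p) \<in> T}"
    using chart_map_img[OF c] by (subst image_chart_inv[OF c]) auto
  then have "chart_fun c F -` T \<inter> space vol
      = chart_inv c ` ?V \<union> (if 0 \<in> T then topspace X - chart_dom c else {})"
    using dom_topspace[OF c] by (auto simp: chart_fun_def split: if_splits)
  then show "chart_fun c F -` T \<inter> space vol \<in> sets vol"
    using s dom_sets[OF c] sets.compl_sets[of "chart_dom c" borel_X] by auto
qed

text \<open>Restricted to the domain of the chart, the Riemannian measure is the image under \<open>chart_inv c\<close> of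
  Lebesgue measure with the density of the metric.\<close>

lemma integral_chart_fun:
  assumes c: "c \<in> A" and F: "continuous_on (chart_img c) F"
  shows "(\<integral>p. chart_fun c F p \<partial>vol) = (LINT x:chart_img c|lborel. F x * volume_density (g c) x)"
    and "integrable vol (chart_fun c F) \<longleftrightarrow>
      set_integrable lborel (chart_img c) (\<lambda>x. F x * volume_density (g c) x)"
proof -
  let ?R = "restrict_space lborel (chart_img c)" and ?d = "volume_density (g c)"
  have eq: "density vol (\<lambda>p. ennreal (indicator (chart_dom c) p)) = chart_measure c"
  proof (rule measure_eqI)
    fix B assume "B \<in> sets (density vol (\<lambda>p. ennreal (indicator (chart_dom c) p)))"
    then have B: "B \<in> sets borel_X" by simp
    then have BB: "B \<inter> chart_dom c \<in> sets borel_X" using dom_sets[OF c] by blast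
    have "emeasure (density vol (\<lambda>p. ennreal (indicator (chart_dom c) p))) B = emeasure vol (B \<inter> chart_dom c)"
      using B dom_sets[OF c] BB
      by (subst emeasure_density)
        (auto intro!: borel_measurable_indicator simp: indicator_inter_arith[symmetric] ennreal_indicator Int_commute)
    also have "\<dots> = emeasure (chart_measure c) B"
      unfolding emeasure_vol[OF c BB Int_lower2] emeasure_chart_measure[OF c BB] emeasure_chart_measure[OF c B]
      by (simp add: Int_assoc)
    finally show "emeasure (density vol (\<lambda>p. ennreal (indicator (chart_dom c) p))) B = emeasure (chart_measure c) B" .
  qed simp
  have mF: "chart_fun c F \<in> borel_measurable vol" by (rule measurable_chart_fun[OF c F])
  have mF': "chart_fun c F \<in> borel_measurable borel_X" using mF by (simp cong: measurable_cong_sets)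
  have ind: "indicator (chart_dom c) p * chart_fun c F p = chart_fun c F p" for p
    by (simp add: chart_fun_def indicator_def)
  have mdom: "(indicator (chart_dom c) :: 'a \<Rightarrow> real) \<in> borel_measurable vol"
    using dom_sets[OF c] by (intro borel_measurable_indicator) simp
  have md: "?d \<in> borel_measurable ?R" by (rule measurable_continuous_chart[OF continuous_density[OF c]])
  have mi: "chart_inv c \<in> density ?R (\<lambda>x. ennreal (?d x)) \<rightarrow>\<^sub>M borel_X"
    using measurable_chart_inv[OF c] by simp
  have mFi: "(\<lambda>x. chart_fun c F (chart_inv c x)) \<in> borel_measurable ?R"
    by (rule measurable_compose[OF measurable_chart_inv[OF c] mF'])
  have nn: "AE x in ?R. 0 \<le> ?d x"
    using density_pos[OF c] by (intro AE_I2) (auto simp: space_restrict_space less_imp_le)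
  have val: "indicator (chart_img c) x *\<^sub>R (?d x *\<^sub>R chart_fun c F (chart_inv c x))
      = indicator (chart_img c) x *\<^sub>R (F x * ?d x)" for x
    using chart_inv_dom[OF c, of x] chart_map_inv[OF c, of x] by (simp add: chart_fun_def indicator_def)
  have "(\<integral>p. chart_fun c F p \<partial>vol) = (\<integral>p. chart_fun c F p \<partial>chart_measure c)"
    unfolding eq[symmetric] using mF mdom
    by (subst integral_density) (auto simp: ind)
  also have "\<dots> = (\<integral>x. ?d x *\<^sub>R chart_fun c F (chart_inv c x) \<partial>?R)"
    unfolding chart_measure_def integral_distr[OF mi mF']
    by (rule integral_density[OF mFi md nn])
  also have "\<dots> = (LINT x:chart_img c|lborel. F x * ?d x)"
    unfolding set_lebesgue_integral_def val[symmetric]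
    using img_sets[OF c] by (subst integral_restrict_space) simp_all
  finally show "(\<integral>p. chart_fun c F p \<partial>vol) = (LINT x:chart_img c|lborel. F x * ?d x)" .
  have "integrable vol (chart_fun c F) \<longleftrightarrow> integrable (chart_measure c) (chart_fun c F)"
    unfolding eq[symmetric] using mF mdom
    by (subst integrable_density) (auto simp: ind)
  also have "\<dots> \<longleftrightarrow> integrable ?R (\<lambda>x. ?d x *\<^sub>R chart_fun c F (chart_inv c x))"
    unfolding chart_measure_def integrable_distr_eq[OF mi mF']
    by (rule integrable_density[OF mFi md nn])
  also have "\<dots> \<longleftrightarrow> set_integrable lborel (chart_img c) (\<lambda>x. F x * ?d x)"
    unfolding set_integrable_def val[symmetric]
    using img_sets[OF c] by (subst integrable_restrict_space) simp_all
  finally show "integrable vol (chart_fun c F) \<longleftrightarrow> set_integrable lborel (chart_img c) (\<lambda>x. F x * ?d x)" .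
qed

end


section \<open>Bump functions and partitions of unity\<close>

lemma DERIV_square_positive_part:
  "((\<lambda>t::real. (max 0 t)\<^sup>2) has_real_derivative 2 * max 0 t) (at t)"
proof -
  consider "t > 0" | "t < 0" | "t = 0" by linarith
  then show ?thesis
  proof cases
    case 1
    have "((\<lambda>t. t\<^sup>2) has_real_derivative 2 * max 0 t) (at t)"
      using 1 by (auto intro!: derivative_eq_intros)
    then show ?thesis
      by (rule has_field_derivative_transform_within_open[of _ _ _ "{0<..}"]) (use 1 in auto)
  next
    case 2
    have "((\<lambda>t. 0) has_real_derivative 2 * max 0 t) (at t)"
      using 2 by simp
    then show ?thesis
      by (rule has_field_derivative_transform_within_open[of _ _ _ "{..<0}"]) (use 2 in auto)
  next
    case 3
    have "((\<lambda>h::real. max 0 h) \<longlongrightarrow> max 0 0) (at 0)"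
      by (intro tendsto_intros)
    moreover have "(\<lambda>h::real. ((max 0 (0 + h))\<^sup>2 - (max 0 0)\<^sup>2) / h) = (\<lambda>h. max 0 h)"
      by (auto simp: fun_eq_iff max_def power2_eq_square)
    ultimately show ?thesis unfolding 3 DERIV_def by simp
  qed
qed

text \<open>The square of the positive part of a real number is a \<open>C\<^sup>1\<close> function of it; this is as much
  regularity as one integration by parts uses.\<close>

definition bump :: "real^'n \<Rightarrow> real \<Rightarrow> real^'n \<Rightarrow> real" where
  "bump a r x = (max 0 (r\<^sup>2 - (x - a) \<bullet> (x - a)))\<^sup>2"

lemma C1_on_bump: "C1_on S (bump a r)"
proof -
  have "C1_on UNIV (\<lambda>x. r\<^sup>2 - (x - a) \<bullet> (x - a))"
    by (rule C1_onI[where D="\<lambda>x. - 2 *\<^sub>R (x - a)"])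
       (auto intro!: derivative_eq_intros continuous_intros simp: inner_commute)
  then have "C1_on UNIV (bump a r)"
    unfolding bump_def[abs_def]
    by (rule C1_on_compose_real[where \<phi>="\<lambda>t. (max 0 t)\<^sup>2" and \<phi>'="\<lambda>t. 2 * max 0 t"])
       (auto intro!: DERIV_square_positive_part continuous_intros)
  then show ?thesis by (rule C1_on_subset) simp
qed

lemma bump_nonneg: "bump a r x \<ge> 0"
  by (simp add: bump_def)

lemma bump_pos: "x \<in> ball a r \<Longrightarrow> bump a r x > 0"
proof -
  assume x: "x \<in> ball a r"
  then have "norm (x - a) < r" by (simp add: dist_norm norm_minus_commute)
  then have "(norm (x - a))\<^sup>2 < r\<^sup>2" by (intro power_strict_mono) auto
  then show ?thesis by (simp add: bump_def dot_square_norm max_def)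
qed

lemma bump_zero: "0 < r \<Longrightarrow> x \<notin> cball a r \<Longrightarrow> bump a r x = 0"
proof -
  assume r: "0 < r" and x: "x \<notin> cball a r"
  then have "r < norm (x - a)" by (simp add: dist_norm norm_minus_commute)
  then have "r\<^sup>2 < (norm (x - a))\<^sup>2" using r by (intro power_strict_mono) auto
  then show ?thesis by (simp add: bump_def dot_square_norm max_def)
qed

context compact_riemannian
begin

text \<open>The compact set is given in coordinates, and only points of the manifold count, as \<open>X\<close> need not
  exhaust the type of points.\<close>

definition supported_in :: "('a, 'n) chart \<Rightarrow> (real^'n) set \<Rightarrow> ('a \<Rightarrow> real) \<Rightarrow> bool" where
  "supported_in c K h \<longleftrightarrow> compact K \<and> K \<subseteq> chart_img c \<and>
     (\<forall>p\<in>topspace X. p \<notin> chart_inv c ` K \<longrightarrow> h p = 0)"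

lemma supported_in_zero:
  assumes "supported_in c K h" "c \<in> A" "p \<in> chart_dom c" "chart_map c p \<notin> K"
  shows "h p = 0"
proof -
  have "p \<notin> chart_inv c ` K"
  proof
    assume "p \<in> chart_inv c ` K"
    then obtain x where "x \<in> K" "p = chart_inv c x" by blast
    then show False
      using assms(1,4) chart_map_inv[OF assms(2)] by (auto simp: supported_in_def)
  qed
  then show ?thesis using assms(1) dom_topspace[OF assms(2,3)] by (simp add: supported_in_def)
qed

lemma supported_in_chart_fun:
  assumes "c \<in> A" "compact K" "K \<subseteq> chart_img c" "\<And>x. x \<in> chart_img c - K \<Longrightarrow> F x = 0"
  shows "supported_in c K (chart_fun c F)"
  unfolding supported_in_def
proof (intro conjI ballI impI)
  fix p assume "p \<notin> chart_inv c ` K"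
  then have "p \<in> chart_dom c \<Longrightarrow> chart_map c p \<notin> K"
    using chart_inv_map[OF assms(1)] by (metis image_eqI)
  then show "chart_fun c F p = 0"
    using assms(4) chart_map_img[OF assms(1)] by (simp add: chart_fun_def)
qed (fact assms)+

text \<open>The image of \<open>K\<close> is closed because the manifold is Hausdorff, hence the points outside of it
  form an open set in every other chart \<open>d\<close>.\<close>

lemma supported_in_vanish:
  assumes c: "c \<in> A" and d: "d \<in> A" and h: "supported_in c K h"
  defines "V \<equiv> {x \<in> chart_img d. chart_inv d x \<notin> chart_inv c ` K}"
  shows "open V" and "\<And>x. x \<in> V \<Longrightarrow> (h \<circ> chart_inv d) x = 0"
proof -
  have "closedin X (chart_inv c ` K)"
    using h c by (intro closedin_chart_inv_image) (auto simp: supported_in_def)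
  then have "open (chart_map d ` ((topspace X - chart_inv c ` K) \<inter> chart_dom d))"
    using open_chart_image[OF d] by (simp add: closedin_def)
  also have "chart_map d ` ((topspace X - chart_inv c ` K) \<inter> chart_dom d) = V"
    using chart_inv_dom[OF d] dom_topspace[OF d] unfolding V_def by (subst image_chart_map[OF d]) auto
  finally show "open V" .
  show "(h \<circ> chart_inv d) x = 0" if "x \<in> V" for x
    using that h chart_inv_dom[OF d] dom_topspace[OF d] by (auto simp: supported_in_def V_def)
qed

text \<open>Another chart \<open>d\<close> is covered by two open sets: on the overlap the function is \<open>F\<close> composed with a
  transition map, and off the image of \<open>K\<close> it is zero.\<close>

lemma C1_chart_fun:
  assumes c: "c \<in> A" and F: "C1_on (chart_img c) F"
    and K: "compact K" "K \<subseteq> chart_img c" and supp: "\<And>x. x \<in> chart_img c - K \<Longrightarrow> F x = 0"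
  shows "C1_function (chart_fun c F)"
  unfolding C1_function_def
proof
  fix d assume d: "d \<in> A"
  let ?h = "chart_fun c F \<circ> chart_inv d"
  define V where "V = {x \<in> chart_img d. chart_inv d x \<notin> chart_inv c ` K}"
  have V: "open V" "\<And>x. x \<in> V \<Longrightarrow> ?h x = 0"
    using supported_in_vanish[OF c d supported_in_chart_fun[OF c K supp]] by (simp_all add: V_def)
  have "C1_on (overlap d c) ?h"
  proof (rule C1_on_cong[OF open_overlap[OF d c]])
    show "C1_on (overlap d c) (\<lambda>x. F (transition d c x))"
      using transition_image[OF d c] overlap_img[OF c d]
      by (intro C1_on_compose_smooth[OF F] smooth_on_Ck smooth_transition d c) auto
    show "F (transition d c x) = ?h x" if "x \<in> overlap d c" for x
      using that by (auto elim!: overlapE[OF d c] simp: chart_fun_def)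
  qed
  moreover have "C1_on V ?h"
    by (rule C1_on_cong[OF V(1) _ C1_on_const[where c=0]]) (simp only: V(2))
  moreover have "chart_img d = overlap d c \<union> V"
  proof -
    have "x \<in> overlap d c" if "x \<in> chart_img d" "chart_inv d x \<in> chart_inv c ` K" for x
    proof -
      have "chart_inv d x \<in> chart_dom c" using that(2) K(2) chart_inv_dom[OF c] by auto
      then show ?thesis
        using mem_overlap[OF d c, of "chart_inv d x"] that(1) chart_inv_dom[OF d] chart_map_inv[OF d] by simp
    qed
    then show ?thesis using overlap_img[OF d c] by (auto simp: V_def)
  qed
  ultimately show "C1_on (chart_img d) ?h"
    using C1_on_Un[OF open_overlap[OF d c] V(1)] by simp
qed

text \<open>Finitely many bump functions are jointly positive by compactness; they are divided by their sum.\<close>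

lemma partition_of_unity:
  obtains I :: "'a set" and e :: "'a \<Rightarrow> ('a, 'n) chart" and K :: "'a \<Rightarrow> (real^'n) set"
    and \<phi> :: "'a \<Rightarrow> 'a \<Rightarrow> real" where
    "finite I" "\<And>i. i \<in> I \<Longrightarrow> e i \<in> A" "\<And>i. i \<in> I \<Longrightarrow> supported_in (e i) (K i) (\<phi> i)"
    "\<And>i. i \<in> I \<Longrightarrow> C1_function (\<phi> i)" "\<And>p. p \<in> topspace X \<Longrightarrow> (\<Sum>i\<in>I. \<phi> i p) = 1"
proof -
  have "\<forall>p\<in>topspace X. \<exists>cr. fst cr \<in> A \<and> p \<in> chart_dom (fst cr) \<and> 0 < snd cr \<and>
      cball (chart_map (fst cr) p) (snd cr) \<subseteq> chart_img (fst cr)"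
  proof
    fix p assume "p \<in> topspace X"
    then obtain c where c: "c \<in> A" "p \<in> chart_dom c" using covered by blast
    then obtain r where "r > 0" "cball (chart_map c p) r \<subseteq> chart_img c"
      using open_contains_cball[THEN iffD1, OF open_img[OF c(1)]] chart_map_img[OF c] by blast
    then show "\<exists>cr. fst cr \<in> A \<and> p \<in> chart_dom (fst cr) \<and> 0 < snd cr \<and>
      cball (chart_map (fst cr) p) (snd cr) \<subseteq> chart_img (fst cr)"
      using c by (intro exI[of _ "(c, r)"]) simp
  qed
  then obtain cr where cr: "\<And>p. p \<in> topspace X \<Longrightarrow> fst (cr p) \<in> A \<and> p \<in> chart_dom (fst (cr p)) \<and>
      0 < snd (cr p) \<and> cball (chart_map (fst (cr p)) p) (snd (cr p)) \<subseteq> chart_img (fst (cr p))"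
    unfolding bchoice_iff by blast
  define e where "e p = fst (cr p)" for p
  define r where "r p = snd (cr p)" for p
  define a where "a p = chart_map (e p) p" for p
  have e: "e p \<in> A" "p \<in> chart_dom (e p)" "0 < r p" "cball (a p) (r p) \<subseteq> chart_img (e p)"
    if "p \<in> topspace X" for p using cr[OF that] by (auto simp: e_def r_def a_def)
  define U where "U p = chart_inv (e p) ` ball (a p) (r p)" for p
  have sub: "ball (a p) (r p) \<subseteq> chart_img (e p)" if "p \<in> topspace X" for p
    using e(4)[OF that] ball_subset_cball by blast
  have U: "openin X (U p)" "p \<in> U p" if "p \<in> topspace X" for p
    using e[OF that] sub[OF that]
    by (auto simp: U_def a_def image_iff chart_inv_map intro!: openin_chart_inv_image bexI[of _ "a p"])
  have "\<forall>V\<in>U ` topspace X. openin X V" "topspace X \<subseteq> \<Union> (U ` topspace X)" using U by auto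
  then obtain \<F> where "finite \<F>" "\<F> \<subseteq> U ` topspace X" "topspace X \<subseteq> \<Union> \<F>"
    using compact_X unfolding compact_space_alt by metis
  then obtain I where I: "I \<subseteq> topspace X" "finite I" "topspace X \<subseteq> \<Union> (U ` I)"
    by (metis finite_subset_image)
  define \<beta> where "\<beta> i = chart_fun (e i) (bump (a i) (r i))" for i
  define s where "s q = (\<Sum>i\<in>I. \<beta> i q)" for q
  define \<phi> where "\<phi> i q = \<beta> i q / s q" for i q
  have \<beta>C1: "C1_function (\<beta> i)" if "i \<in> I" for i
    unfolding \<beta>_def using e[OF subsetD[OF I(1) that]]
    by (intro C1_chart_fun[where K="cball (a i) (r i)"] C1_on_bump) (simp_all add: bump_zero)
  have \<beta>supp: "supported_in (e i) (cball (a i) (r i)) (\<beta> i)" if "i \<in> I" for i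
    unfolding \<beta>_def using e[OF subsetD[OF I(1) that]]
    by (intro supported_in_chart_fun) (simp_all add: bump_zero)
  have s_pos: "s q > 0" if qX: "q \<in> topspace X" for q
  proof -
    obtain i where i: "i \<in> I" "q \<in> U i" using I(3) qX by blast
    then have iX: "i \<in> topspace X" using I(1) by blast
    have "q \<in> chart_dom (e i)" "chart_map (e i) q \<in> ball (a i) (r i)"
      using i(2) unfolding U_def image_chart_inv[OF e(1)[OF iX] sub[OF iX]] by auto
    then have "\<beta> i q > 0" by (simp add: \<beta>_def chart_fun_def bump_pos)
    moreover have "\<beta> j q \<ge> 0" for j by (simp add: \<beta>_def chart_fun_def bump_nonneg)
    ultimately show ?thesis unfolding s_def using i(1) I(2) by (intro sum_pos2) auto
  qed
  have "C1_function (\<phi> i)" if "i \<in> I" for i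
    unfolding C1_function_def
  proof
    fix d assume d: "d \<in> A"
    have \<beta>d: "C1_on (chart_img d) (\<lambda>x. \<beta> j (chart_inv d x))" if "j \<in> I" for j
      using \<beta>C1[OF that] d unfolding C1_function_def comp_def by blast
    have "s (chart_inv d x) \<noteq> 0" if "x \<in> chart_img d" for x
      using s_pos[of "chart_inv d x"] chart_inv_dom[OF d that] dom_topspace[OF d] by fastforce
    then show "C1_on (chart_img d) (\<phi> i \<circ> chart_inv d)"
      unfolding \<phi>_def s_def comp_def by (intro C1_on_divide C1_on_sum \<beta>d that)
  qed
  moreover have "supported_in (e i) (cball (a i) (r i)) (\<phi> i)" if "i \<in> I" for i
    using \<beta>supp[OF that] by (auto simp: supported_in_def \<phi>_def)
  moreover have "(\<Sum>i\<in>I. \<phi> i q) = 1" if "q \<in> topspace X" for q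
    using s_pos[OF that] by (simp add: \<phi>_def sum_divide_distrib[symmetric] s_def[symmetric])
  ultimately show ?thesis using that[of I e "\<lambda>i. cball (a i) (r i)" \<phi>] I e(1) by blast
qed

section \<open>Green's identity and the invariance of the Laplacian\<close>

abbreviation lap :: "('a, 'n) chart \<Rightarrow> ('a \<Rightarrow> real) \<Rightarrow> real^'n \<Rightarrow> real" where
  "lap c u \<equiv> laplacian (g c) (u \<circ> chart_inv c)"

text \<open>Both sides are zero off the domain of \<open>c\<close>, since \<open>h\<close> vanishes near such points.  Thus the Dirichlet
  integrand of \<open>h\<close> may be moved from the chart that contains the support to any other chart.\<close>

lemma chart_fun_inner_differentials:
  assumes c: "c \<in> A" and d: "d \<in> A" and q: "q \<in> chart_dom d"
    and h: "C1_function h" "supported_in c K h" and u: "C1_function u"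
  shows "chart_fun c (inner_differentials c h u) q = inner_differentials d h u (chart_map d q)"
proof (cases "q \<in> chart_dom c")
  case True
  have x: "chart_map c q \<in> overlap c d" by (rule mem_overlap[OF c d True q])
  have "transition c d (chart_map c q) = chart_map d q" by (rule transition_map[OF c d True])
  then show ?thesis
    using inner_differentials_transition[OF c d x, of h u] True
      C1_function_differentiable[OF h(1) d chart_map_img[OF d q]]
      C1_function_differentiable[OF u d chart_map_img[OF d q]]
    by (simp add: chart_fun_def)
next
  case False
  define V where "V = {x \<in> chart_img d. chart_inv d x \<notin> chart_inv c ` K}"
  have V: "open V" "\<And>x. x \<in> V \<Longrightarrow> (h \<circ> chart_inv d) x = 0"
    using supported_in_vanish[OF c d h(2)] by (simp_all add: V_def)
  have "q \<notin> chart_inv c ` K"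
    using False h(2) chart_inv_dom[OF c] unfolding supported_in_def by blast
  then have "chart_map d q \<in> V"
    using chart_map_img[OF d q] chart_inv_map[OF d q] by (simp add: V_def)
  then have "differential (h \<circ> chart_inv d) (chart_map d q) = differential (\<lambda>x. 0) (chart_map d q)"
    by (rule differential_cong[OF V(1)]) (rule V(2))
  also have "\<dots> = 0" by (simp add: differential_def partial_const vec_eq_iff)
  finally show ?thesis using False by (simp add: chart_fun_def inner_differentials_def)
qed

theorem Green_identity:
  assumes c: "c \<in> A" and h: "C1_function h" "supported_in c K h" and u: "smooth_function A u"
  shows "integrable vol (chart_fun c (\<lambda>x. h (chart_inv c x) * lap c u x))"
    and "integrable vol (chart_fun c (inner_differentials c h u))"
    and "(\<integral>p. chart_fun c (\<lambda>x. h (chart_inv c x) * lap c u x) p \<partial>vol)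
      = - (\<integral>p. chart_fun c (inner_differentials c h u) p \<partial>vol)"
proof -
  interpret L: local_metric "chart_img c" "g c" by (rule local_metric[OF c])
  let ?h = "h \<circ> chart_inv c" and ?u = "u \<circ> chart_inv c"
  have K: "compact K" "K \<subseteq> chart_img c" using h(2) by (auto simp: supported_in_def)
  have su: "smooth_on (chart_img c) ?u" using u c by (simp add: smooth_function_def)
  have C1h: "C1_on (chart_img c) ?h" using h(1) c by (simp add: C1_function_def)
  have h0: "?h x = 0" if "x \<in> chart_img c - K" for x
    using supported_in_zero[OF h(2) c, of "chart_inv c x"] that chart_inv_dom[OF c] chart_map_inv[OF c] by simp
  have dh0: "differential ?h x = 0" if "x \<in> chart_img c - K" for x
  proof -
    have "open (chart_img c - K)" using K open_img[OF c] by (simp add: compact_imp_closed open_Diff)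
    then have "differential ?h x = differential (\<lambda>x. 0) x"
      using that by (rule differential_cong) (rule h0)
    then show ?thesis by (simp add: differential_def partial_const vec_eq_iff)
  qed
  have c1: "continuous_on (chart_img c) (\<lambda>x. h (chart_inv c x) * lap c u x)"
    using C1_on_continuous[OF C1h] by (intro continuous_intros L.continuous_laplacian su) (simp add: comp_def)
  have c2: "continuous_on (chart_img c) (inner_differentials c h u)"
    unfolding inner_differentials_def[abs_def] by (rule L.continuous_inner_gradient[OF su C1h])
  show "integrable vol (chart_fun c (\<lambda>x. h (chart_inv c x) * lap c u x))"
    unfolding integral_chart_fun(2)[OF c c1]
    by (rule set_integrable_compact_support[OF K])
       (use h0 in \<open>auto intro!: continuous_intros c1 continuous_density c\<close>)
  show "integrable vol (chart_fun c (inner_differentials c h u))"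
    unfolding integral_chart_fun(2)[OF c c2]
  proof (rule set_integrable_compact_support[OF K])
    show "continuous_on (chart_img c) (\<lambda>x. inner_differentials c h u x * volume_density (g c) x)"
      by (intro continuous_intros c2 continuous_density c)
  qed (simp add: inner_differentials_def dh0)
  show "(\<integral>p. chart_fun c (\<lambda>x. h (chart_inv c x) * lap c u x) p \<partial>vol)
      = - (\<integral>p. chart_fun c (inner_differentials c h u) p \<partial>vol)"
    unfolding integral_chart_fun(1)[OF c c1] integral_chart_fun(1)[OF c c2]
    unfolding inner_differentials_def
    using L.Green_identity_local[of "u \<circ> chart_inv c" "h \<circ> chart_inv c", OF su C1h K h0]
    by (simp only: comp_apply)
qed

text \<open>Two charts give the same Laplacian because Green's identity determines it weakly: a bump
  function supported where one local expression exceeds the other would have different integrals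
  against the two, although both integrals are minus the same Dirichlet integral.\<close>

lemma laplacian_not_greater:
  assumes c: "c \<in> A" and d: "d \<in> A" and p: "p \<in> chart_dom c" "p \<in> chart_dom d"
    and u: "smooth_function A u"
  shows "lap c u (chart_map c p) \<le> lap d u (chart_map d p)"
proof (rule ccontr)
  assume "\<not> ?thesis"
  then have gt: "lap c u (chart_map c p) > lap d u (chart_map d p)" by simp
  let ?\<tau> = "transition c d"
  have uC1: "C1_function u" using smooth_function_C1[OF u] .
  have contL: "continuous_on (chart_img b) (lap b u)" if "b \<in> A" for b
    using local_metric.continuous_laplacian[OF local_metric[OF that]] u that by (simp add: smooth_function_def)
  have cont\<tau>: "continuous_on (overlap c d) ?\<tau>"
    using smooth_on_continuous[OF smooth_transition[OF c d]] .
  define W where "W = {x \<in> overlap c d. lap c u x - lap d u (?\<tau> x) > 0}"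
  have "continuous_on (overlap c d) (\<lambda>x. lap c u x - lap d u (?\<tau> x))"
    using transition_image[OF c d] overlap_img[OF c d] overlap_img[OF d c]
    by (intro continuous_intros continuous_on_subset[OF contL[OF c]]
        continuous_on_compose2[OF contL[OF d] cont\<tau>]) auto
  from continuous_open_preimage[OF this open_overlap[OF c d], of "{0<..}"]
  have "open W" by (simp add: W_def vimage_def Int_def)
  define a where "a = chart_map c p"
  have "a \<in> W" using mem_overlap[OF c d p] gt transition_map[OF c d p(1)] by (simp add: W_def a_def)
  then obtain r where r: "r > 0" "cball a r \<subseteq> W" using \<open>open W\<close> open_contains_cball by blast
  let ?K = "cball a r"
  have K: "?K \<subseteq> overlap c d" "?K \<subseteq> chart_img c" using r(2) overlap_img[OF c d] by (auto simp: W_def)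
  define h where "h = chart_fun c (bump a r)"
  have hC1: "C1_function h" unfolding h_def
    by (rule C1_chart_fun[OF c C1_on_bump compact_cball K(2)]) (use r bump_zero in auto)
  have hc: "supported_in c ?K h" unfolding h_def
    by (rule supported_in_chart_fun[OF c compact_cball K(2)]) (use r bump_zero in auto)
  have inv_eq: "chart_inv d (?\<tau> x) = chart_inv c x" if "x \<in> overlap c d" for x
    using inv_eq_transition[OF c d that, of "\<lambda>p. p"] by simp
  have hd: "supported_in d (?\<tau> ` ?K) h"
    unfolding supported_in_def
  proof (intro conjI)
    show "compact (?\<tau> ` ?K)"
      using continuous_on_subset[OF cont\<tau> K(1)] by (intro compact_continuous_image) auto
    show "?\<tau> ` ?K \<subseteq> chart_img d"
      using K(1) transition_image[OF c d] overlap_img[OF d c] by blast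
    have "chart_inv d ` (?\<tau> ` ?K) = chart_inv c ` ?K"
      unfolding image_image by (rule image_cong) (use inv_eq K(1) in auto)
    then show "\<forall>p\<in>topspace X. p \<notin> chart_inv d ` (?\<tau> ` ?K) \<longrightarrow> h p = 0"
      using hc by (simp add: supported_in_def)
  qed
  let ?kc = "chart_fun c (\<lambda>x. h (chart_inv c x) * lap c u x)"
  let ?kd = "chart_fun d (\<lambda>x. h (chart_inv d x) * lap d u x)"
  note Gc = Green_identity[OF c hC1 hc u] and Gd = Green_identity[OF d hC1 hd u]
  have "(\<integral>q. chart_fun c (inner_differentials c h u) q \<partial>vol) = (\<integral>q. chart_fun d (inner_differentials d h u) q \<partial>vol)"
  proof (rule Bochner_Integration.integral_cong[OF refl])
    fix q assume "q \<in> space vol"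
    then have "q \<in> topspace X" by simp
    then obtain b where b: "b \<in> A" "q \<in> chart_dom b" using covered by blast
    show "chart_fun c (inner_differentials c h u) q = chart_fun d (inner_differentials d h u) q"
      using chart_fun_inner_differentials[OF c b hC1 hc uC1] chart_fun_inner_differentials[OF d b hC1 hd uC1]
      by simp
  qed
  then have zero: "(\<integral>q. ?kc q - ?kd q \<partial>vol) = 0"
    using Gc Gd by simp
  have difference: "?kc q - ?kd q = bump a r x * (lap c u x - lap d u (?\<tau> x))"
    if "x \<in> ?K" "q = chart_inv c x" for q x
  proof -
    have x: "x \<in> overlap c d" using K(1) that(1) by blast
    obtain p' where p': "p' \<in> chart_dom c" "p' \<in> chart_dom d" "x = chart_map c p'" "chart_inv c x = p'"
        "?\<tau> x = chart_map d p'" "?\<tau> x \<in> overlap d c"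
      using overlapE[OF c d x] by blast
    have "h p' = bump a r x" using p' by (simp add: h_def chart_fun_def)
    then show ?thesis
      using p' that(2) chart_inv_map[OF d] by (simp add: chart_fun_def algebra_simps)
  qed
  have outside: "?kc q - ?kd q = 0" if "q \<in> topspace X" "q \<notin> chart_inv c ` ?K" for q
  proof -
    have "h q = 0" using hc that by (simp add: supported_in_def)
    then show ?thesis
      by (auto simp: chart_fun_def chart_inv_map[OF c] chart_inv_map[OF d])
  qed
  have "?kc q - ?kd q \<ge> 0" if "q \<in> topspace X" for q
  proof (cases "q \<in> chart_inv c ` ?K")
    case True
    then obtain x where "x \<in> ?K" "q = chart_inv c x" by blast
    then show ?thesis using difference[of x q] r(2) bump_nonneg[of a r x] by (force simp: W_def)
  qed (use outside that in simp)
  then have "AE q in vol. ?kc q - ?kd q \<ge> 0" by (intro AE_I2) simp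
  then have ae: "AE q in vol. ?kc q - ?kd q = 0"
    using integral_nonneg_eq_0_iff_AE[of vol "\<lambda>q. ?kc q - ?kd q"] Gc(1) Gd(1) zero by simp
  define B where "B = chart_inv c ` ball a r"
  have "ball a r \<subseteq> chart_img c" using K(2) ball_subset_cball by blast
  then have B: "openin X B" unfolding B_def by (intro openin_chart_inv_image[OF c]) auto
  have "AE q in vol. q \<notin> B"
    using ae
  proof (rule AE_mp, intro AE_I2 impI notI)
    fix q assume "?kc q - ?kd q = 0" "q \<in> B"
    then obtain x where x: "x \<in> ball a r" "q = chart_inv c x" by (auto simp: B_def)
    then have "x \<in> ?K" using ball_subset_cball by blast
    moreover from this have "x \<in> W" using r(2) by blast
    ultimately have "?kc q - ?kd q > 0"
      using difference[of x q] x bump_pos[OF x(1)] by (simp add: W_def)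
    then show False using \<open>?kc q - ?kd q = 0\<close> by simp
  qed
  then have "B \<in> null_sets vol"
    using openin_sets[OF B] by (subst AE_iff_null_sets) auto
  moreover have "B \<noteq> {}" using r(1) by (auto simp: B_def)
  ultimately show False using emeasure_vol_open_pos[OF B] by auto
qed

theorem laplacian_invariant:
  assumes "c \<in> A" "d \<in> A" "p \<in> chart_dom c" "p \<in> chart_dom d" "smooth_function A u"
  shows "lap c u (chart_map c p) = lap d u (chart_map d p)"
  by (intro antisym laplacian_not_greater assms)

text \<open>The constant 1 is a finite sum of functions with compact support in charts, each of which is
  integrable.\<close>

lemma finite_vol: "finite_measure vol"
proof -
  obtain I :: "'a set" and e :: "'a \<Rightarrow> ('a, 'n) chart" and K and \<phi> :: "'a \<Rightarrow> 'a \<Rightarrow> real" where P: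
    "finite I" "\<And>i. i \<in> I \<Longrightarrow> e i \<in> A" "\<And>i. i \<in> I \<Longrightarrow> supported_in (e i) (K i) (\<phi> i)"
    "\<And>i. i \<in> I \<Longrightarrow> C1_function (\<phi> i)" "\<And>p. p \<in> topspace X \<Longrightarrow> (\<Sum>i\<in>I. \<phi> i p) = 1"
    using partition_of_unity by blast
  have "integrable vol (\<phi> i)" if i: "i \<in> I" for i
  proof -
    let ?F = "\<phi> i \<circ> chart_inv (e i)"
    have K: "compact (K i)" "K i \<subseteq> chart_img (e i)" using P(3)[OF i] by (auto simp: supported_in_def)
    have cF: "continuous_on (chart_img (e i)) ?F"
      using P(2,4)[OF i] C1_on_continuous unfolding C1_function_def by blast
    have "integrable vol (chart_fun (e i) ?F)"
      unfolding integral_chart_fun(2)[OF P(2)[OF i] cF]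
    proof (rule set_integrable_compact_support[OF K])
      show "continuous_on (chart_img (e i)) (\<lambda>x. ?F x * volume_density (g (e i)) x)"
        by (intro continuous_intros cF continuous_density P(2)[OF i])
      fix x assume x: "x \<in> chart_img (e i) - K i"
      then have "?F x = 0"
        using supported_in_zero[OF P(3)[OF i] P(2)[OF i], of "chart_inv (e i) x"]
          chart_inv_dom[OF P(2)[OF i]] chart_map_inv[OF P(2)[OF i]] by simp
      then show "?F x * volume_density (g (e i)) x = 0" by simp
    qed
    moreover have "chart_fun (e i) ?F p = \<phi> i p" if "p \<in> space vol" for p
    proof -
      have "p \<in> chart_inv (e i) ` K i \<Longrightarrow> p \<in> chart_dom (e i)"
        using K(2) chart_inv_dom[OF P(2)[OF i]] by auto
      then show ?thesis
        using P(3)[OF i] that by (auto simp: chart_fun_def chart_inv_map[OF P(2)[OF i]] supported_in_def)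
    qed
    ultimately show ?thesis
      by (rule Bochner_Integration.integrable_cong[OF refl, THEN iffD1, rotated])
  qed
  then have "integrable vol (\<lambda>p. \<Sum>i\<in>I. \<phi> i p)" by (rule Bochner_Integration.integrable_sum)
  then have "integrable vol (\<lambda>p. 1 :: real)"
    by (rule Bochner_Integration.integrable_cong[OF refl, THEN iffD1, rotated]) (simp add: P(5))
  then show ?thesis by (intro finite_measureI) (simp add: integrable_iff_bounded)
qed

lemma measure_vol_pos: "measure vol (topspace X) > 0"
proof -
  have "topspace X \<noteq> {}" using manifold by (simp add: smooth_manifold_def)
  then have "emeasure vol (topspace X) \<noteq> 0" by (intro emeasure_vol_open_pos) auto
  then show ?thesis
    using finite_measure.emeasure_eq_measure[OF finite_vol, of "topspace X"]
    by (simp add: zero_less_measure_iff)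
qed

theorem integral_laplacian_eq_0:
  assumes u: "smooth_function A u"
    and L: "\<And>c p. c \<in> A \<Longrightarrow> p \<in> chart_dom c \<Longrightarrow> L p = lap c u (chart_map c p)"
  shows "integrable vol L" "(\<integral>p. L p \<partial>vol) = 0"
proof -
  have uC1: "C1_function u" using smooth_function_C1[OF u] .
  obtain I :: "'a set" and e :: "'a \<Rightarrow> ('a, 'n) chart" and K and \<phi> :: "'a \<Rightarrow> 'a \<Rightarrow> real" where P:
    "finite I" "\<And>i. i \<in> I \<Longrightarrow> e i \<in> A" "\<And>i. i \<in> I \<Longrightarrow> supported_in (e i) (K i) (\<phi> i)"
    "\<And>i. i \<in> I \<Longrightarrow> C1_function (\<phi> i)" "\<And>p. p \<in> topspace X \<Longrightarrow> (\<Sum>i\<in>I. \<phi> i p) = 1"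
    using partition_of_unity by blast
  let ?k = "\<lambda>i. chart_fun (e i) (\<lambda>x. \<phi> i (chart_inv (e i) x) * lap (e i) u x)"
  let ?G = "\<lambda>i. chart_fun (e i) (inner_differentials (e i) (\<phi> i) u)"
  note G = Green_identity[OF P(2) P(4) P(3) u]
  have sum: "L p = (\<Sum>i\<in>I. ?k i p)" if p: "p \<in> space vol" for p
  proof -
    have "?k i p = \<phi> i p * L p" if i: "i \<in> I" for i
    proof (cases "p \<in> chart_dom (e i)")
      case True
      then show ?thesis using L[OF P(2)[OF i]] by (simp add: chart_fun_def chart_inv_map[OF P(2)[OF i]])
    next
      case False
      have "chart_inv (e i) ` K i \<subseteq> chart_dom (e i)"
        using P(3)[OF i] chart_inv_dom[OF P(2)[OF i]] by (auto simp: supported_in_def)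
      then have "p \<notin> chart_inv (e i) ` K i" using False by blast
      then have "\<phi> i p = 0" using P(3)[OF i] p by (simp add: supported_in_def)
      then show ?thesis using False by (simp add: chart_fun_def)
    qed
    then show ?thesis using P(5) p by (simp add: sum_distrib_right[symmetric])
  qed
  have Gsum: "(\<Sum>i\<in>I. ?G i p) = 0" if "p \<in> space vol" for p
  proof -
    have "p \<in> topspace X" using that by simp
    then obtain d where d: "d \<in> A" "p \<in> chart_dom d" using covered by blast
    let ?x = "chart_map d p"
    have x: "?x \<in> chart_img d" by (rule chart_map_img[OF d])
    have "(\<Sum>i\<in>I. ?G i p) = (\<Sum>i\<in>I. inner_differentials d (\<phi> i) u ?x)"
      using chart_fun_inner_differentials[OF P(2) d P(4) P(3) uC1] by (intro sum.cong) auto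
    also have "\<dots> = (\<Sum>i\<in>I. differential (\<phi> i \<circ> chart_inv d) ?x) \<bullet> gradient (g d) (u \<circ> chart_inv d) ?x"
      by (simp add: inner_differentials_def inner_sum_left)
    also have "(\<Sum>i\<in>I. differential (\<phi> i \<circ> chart_inv d) ?x) = 0"
    proof -
      have "(\<Sum>i\<in>I. partial a (\<phi> i \<circ> chart_inv d) ?x) = partial a (\<lambda>x. \<Sum>i\<in>I. (\<phi> i \<circ> chart_inv d) x) ?x" for a
        using C1_function_differentiable[OF P(4) d(1) x] by (subst partial_sum) auto
      also have "partial a (\<lambda>x. \<Sum>i\<in>I. (\<phi> i \<circ> chart_inv d) x) ?x = partial a (\<lambda>x. 1) ?x" for a
        by (rule partial_cong[OF open_img[OF d(1)] x])
           (use P(5) chart_inv_dom[OF d(1)] dom_topspace[OF d(1)] in auto)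
      finally show ?thesis by (simp add: vec_eq_iff differential_def partial_const)
    qed
    finally show ?thesis by simp
  qed
  have "integrable vol (\<lambda>p. \<Sum>i\<in>I. ?k i p)" by (rule Bochner_Integration.integrable_sum) (rule G(1))
  then show "integrable vol L"
    by (rule Bochner_Integration.integrable_cong[OF refl, THEN iffD1, rotated]) (simp only: sum)
  have "(\<integral>p. L p \<partial>vol) = (\<integral>p. (\<Sum>i\<in>I. ?k i p) \<partial>vol)"
    by (rule Bochner_Integration.integral_cong) (simp_all add: sum)
  also have "\<dots> = (\<Sum>i\<in>I. \<integral>p. ?k i p \<partial>vol)" by (rule Bochner_Integration.integral_sum) (rule G(1))
  also have "\<dots> = (\<Sum>i\<in>I. - (\<integral>p. ?G i p \<partial>vol))" by (intro sum.cong refl G(3))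
  also have "\<dots> = - (\<integral>p. (\<Sum>i\<in>I. ?G i p) \<partial>vol)"
    using G(2) by (simp add: sum_negf Bochner_Integration.integral_sum)
  also have "(\<integral>p. (\<Sum>i\<in>I. ?G i p) \<partial>vol) = (\<integral>p. 0 \<partial>vol)"
    by (rule Bochner_Integration.integral_cong) (simp_all only: Gsum)
  finally show "(\<integral>p. L p \<partial>vol) = 0" by simp
qed

end


section \<open>Gradient solitons\<close>

lemma trace_wrt_add: "trace_wrt G x (S + T) = trace_wrt G x S + trace_wrt G x T"
  by (simp add: trace_wrt_def distrib_left sum.distrib)

lemma trace_wrt_scaleR: "trace_wrt G x (r *\<^sub>R T) = r * trace_wrt G x T"
  by (simp add: trace_wrt_def sum_distrib_left mult_ac)

context local_metric
begin

lemma trace_wrt_metric: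
  assumes "x \<in> S"
  shows "trace_wrt G x (G x) = real CARD('n)"
proof -
  have "trace_wrt G x (G x) = (\<Sum>i\<in>UNIV. (matrix_inv (G x) ** G x) $ i $ i)"
    using G_sym[OF assms] by (simp add: trace_wrt_def matrix_mult_nth)
  also have "\<dots> = real CARD('n)"
    by (simp add: matrix_inv_both[OF det_nz[OF assms]] mat_def)
  finally show ?thesis .
qed

lemma cov_deriv_minus_differential:
  assumes u: "smooth_on S u" and x: "x \<in> S"
  shows "cov_deriv G (\<lambda>y. - differential u y) x = - hessian G u x"
proof -
  have "partial i (\<lambda>y. - differential u y $ j) x = - partial i (partial j u) x" for i j
  proof -
    have "partial j u differentiable (at x)"
      using smooth_on_differentiable[OF smooth_on_partial[OF u] x] .
    then show ?thesis
      using partial_bounded_linear[OF bounded_linear_minus[OF bounded_linear_ident]]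
      by (simp add: differential_def)
  qed
  then show ?thesis
    by (simp add: vec_eq_iff cov_deriv_def hessian_nth sum_negf) (simp add: differential_def)
qed

lemma trace_wrt_minus: "trace_wrt G x (- T) = - trace_wrt G x T"
  by (simp add: trace_wrt_def sum_negf)

text \<open>The Hessian is symmetric, so the symmetrisation in \<open>delta_star\<close> leaves it unchanged.\<close>

lemma B_star_minus_differential:
  assumes u: "smooth_on S u" and x: "x \<in> S"
  shows "B_star G (\<lambda>y. - differential u y) x
    = - hessian G u x + (1/2 * laplacian G u x) *\<^sub>R G x"
proof -
  have "delta_star G (\<lambda>y. - differential u y) x = - hessian G u x"
    unfolding delta_star_def cov_deriv_minus_differential[OF u x]
    using hessian_sym[OF u x] by (simp add: vec_eq_iff)
  moreover have "codiff G (\<lambda>y. - differential u y) x = laplacian G u x"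
    by (simp add: codiff_def cov_deriv_minus_differential[OF u x] laplacian_def trace_wrt_minus)
  ultimately show ?thesis by (simp add: B_star_def)
qed

lemma soliton_scalar_curvature:
  assumes "x \<in> S" "ricci G x + hessian G u x = lam *\<^sub>R G x"
  shows "local_scalar G x = real CARD('n) * lam - laplacian G u x"
proof -
  have "trace_wrt G x (ricci G x + hessian G u x) = lam * real CARD('n)"
    by (simp add: assms(2) trace_wrt_scaleR trace_wrt_metric[OF assms(1)])
  then show ?thesis
    by (simp add: trace_wrt_add local_scalar_def laplacian_def mult.commute)
qed

lemma soliton_einstein:
  assumes u: "smooth_on S u" and x: "x \<in> S" and sol: "ricci G x + hessian G u x = lam *\<^sub>R G x"
  shows "einstein G x = B_star G (\<lambda>y. - differential u y) x
    - ((real CARD('n) - 2) / 2 * lam) *\<^sub>R G x"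
proof -
  have "ricci G x = lam *\<^sub>R G x - hessian G u x" using sol by (simp add: eq_diff_eq)
  then have "einstein G x = - hessian G u x
      + (lam - 1/2 * (real CARD('n) * lam - laplacian G u x)) *\<^sub>R G x"
    by (simp add: einstein_def soliton_scalar_curvature[OF x sol] scaleR_diff_left)
  also have "lam - 1/2 * (real CARD('n) * lam - laplacian G u x)
      = 1/2 * laplacian G u x - (real CARD('n) - 2) / 2 * lam" by (simp add: field_simps)
  finally show ?thesis
    unfolding B_star_minus_differential[OF u x] by (simp add: scaleR_diff_left)
qed

end

theorem theorem4p8:
  fixes X :: "'a topology"
    and A :: "('a, 'n::finite) chart set"
    and g :: "('a, 'n) chart \<Rightarrow> real^'n \<Rightarrow> real^'n^'n"
    and f :: "'a \<Rightarrow> real"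
    and lam :: real
  assumes "CARD('n) \<ge> 3"
    and "compact_gradient_ricci_soliton X A g f lam"
  shows "lam = average_scalar_curvature X A g / real CARD('n) \<and> harmonic_critical X A g"
proof -
  let ?n = "real CARD('n)"
  have crm: "compact_riemannian_manifold X A g" and f: "smooth_function A f"
    and sol: "\<And>c x. c \<in> A \<Longrightarrow> x \<in> chart_img c \<Longrightarrow>
        ricci (g c) x + hessian (g c) (f \<circ> chart_inv c) x = lam *\<^sub>R g c x"
    using assms(2) by (auto simp: compact_gradient_ricci_soliton_def)
  interpret compact_riemannian X A g by (unfold_locales) (rule crm)
  have fc: "smooth_on (chart_img c) (f \<circ> chart_inv c)" if "c \<in> A" for c
    using f that by (simp add: smooth_function_def)
  \<comment> \<open>the Laplacian of \<open>f\<close>, read off from the scalar curvature so as to be a function on the manifold\<close>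
  define L where "L p = ?n * lam - scalar_curvature A g p" for p
  have L: "L p = lap c f (chart_map c p)" if c: "c \<in> A" and p: "p \<in> chart_dom c" for c p
  proof -
    define d where "d = (SOME d. d \<in> A \<and> p \<in> chart_dom d)"
    have d: "d \<in> A" "p \<in> chart_dom d"
      using someI[of "\<lambda>d. d \<in> A \<and> p \<in> chart_dom d" c] c p by (auto simp: d_def)
    have "L p = lap d f (chart_map d p)"
      unfolding L_def scalar_curvature_def Let_def d_def[symmetric]
      using local_metric.soliton_scalar_curvature[OF local_metric[OF d(1)] chart_map_img[OF d]
          sol[OF d(1) chart_map_img[OF d]]] by simp
    also have "\<dots> = lap c f (chart_map c p)" by (rule laplacian_invariant[OF d(1) c d(2) p f])
    finally show ?thesis .
  qed
  have intL: "integrable vol L" "(\<integral>p. L p \<partial>vol) = 0"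
    using integral_laplacian_eq_0[OF f L] by auto
  interpret finite_measure vol by (rule finite_vol)
  have "(\<integral>p. scalar_curvature A g p \<partial>vol) = (\<integral>p. ?n * lam - L p \<partial>vol)"
    by (simp add: L_def)
  also have "\<dots> = ?n * lam * measure vol (topspace X)"
    using intL by (simp add: mult.commute)
  finally have avg: "average_scalar_curvature X A g = ?n * lam"
    using measure_vol_pos by (simp add: average_scalar_curvature_def)
  define \<theta> where "\<theta> c x = - differential (f \<circ> chart_inv c) x" for c :: "('a, 'n) chart" and x
  have "smooth_one_form A \<theta>"
    unfolding smooth_one_form_def Let_def
  proof (intro conjI ballI)
    show "smooth_on (chart_img c) (\<theta> c)" if "c \<in> A" for c
      unfolding \<theta>_def[abs_def]
      by (intro smooth_on_minus smooth_on_differential open_img fc that)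
    fix c d p assume c: "c \<in> A" and d: "d \<in> A" and p: "p \<in> chart_dom c \<inter> chart_dom d"
    then have x: "chart_map c p \<in> overlap c d" by (intro mem_overlap) auto
    have t: "transition c d (chart_map c p) = chart_map d p" using transition_map[OF c d] p by blast
    have "(f \<circ> chart_inv d) differentiable (at (chart_map d p))"
      using smooth_on_differentiable[OF fc[OF d]] chart_map_img[OF d] p by blast
    then show "\<theta> c (chart_map c p)
        = transpose (jacobian (transition c d) (at (chart_map c p))) *v \<theta> d (chart_map d p)"
      using differential_transition[OF c d _ x, of f] unfolding t \<theta>_def
      by (simp add: linear_neg[OF matrix_vector_mul_linear])
  qed
  moreover have "einstein (g c) x = B_star (g c) (\<theta> c) x
      - ((?n - 2) / (2 * ?n) * average_scalar_curvature X A g) *\<^sub>R g c x"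
    if c: "c \<in> A" and x: "x \<in> chart_img c" for c x
  proof -
    have "(?n - 2) / (2 * ?n) * average_scalar_curvature X A g = (?n - 2) / 2 * lam"
      by (simp add: avg)
    then show ?thesis
      using local_metric.soliton_einstein[OF local_metric[OF c] fc[OF c] x sol[OF c x]]
      by (simp add: \<theta>_def[abs_def])
  qed
  ultimately have "harmonic_critical X A g"
    unfolding harmonic_critical_def using crm by blast
  then show ?thesis using avg by simp
qed

end
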